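(* Let $\Omega\subset\mathbb{R}^3$ be a bounded domain with Lipschitz boundary, let $2<q<3$, $\gamma>0$, let $Z\colon\mathbb{R}^{3\times3}\to[0,+\infty)$ be convex and $C^1$, and let $h\colon\mathbb{R}\to[0,+\infty]$ be such that: $h$ is convex and $C^1$ on $(0,+\infty)$; $\lim_{t\to0+}h(t)=+\infty$ and $\liminf_{t\to\infty}h(t)/t>0$; and $h(t)=+\infty$ for $t\le0$. Let $$W(A):=|A|^q+\gamma|A|^2+Z(\operatorname{cof}A)+h(\det A),\qquad A\in\mathbb{R}^{3\times3},$$ and $I(u):=\int_\Omega W(\nabla u(x))\,dx$. Let $\kappa=\kappa(q)$ be the constant described in the context. Let $\lambda>0$ satisfy $h'(\lambda^3)>0$, $$\frac{\kappa}{h'(\lambda^3)\,\lambda^{3-q}}\ >\ (q-2)^{(q-2)/2}q^{-q/2}\qquad\text{and}\qquad\frac{\gamma}{\lambda\,h'(\lambda^3)}\ \ge\ \frac12 .$$ Then there is a constant $c=c(\Omega,\lambda,q)>0$ such that for every $u\in\mathcal{A}_\lambda$ $$\int_\Omega|\nabla u-\lambda\mathbf{1}|^q\,dx\ \le\ c\,\delta(u),$$ where $\delta(u):=I(u)-I(u_\lambda)$.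
   Context: $|A|=(\operatorname{tr}(A^TA))^{1/2}$, $A\cdot B=\operatorname{tr}(A^TB)$, $\operatorname{cof}A$ is the cofactor matrix, $\mathbf{1}$ the identity matrix; $u_\lambda(x):=\lambda x$. The admissible class is $\mathcal{A}_\lambda:=\{u\in W^{1,q}(\Omega,\mathbb{R}^3): u=u_\lambda \text{ on }\partial\Omega \text{ (in the sense of traces)},\ \det\nabla u>0\text{ a.e. in }\Omega\}$. The constant $\kappa=\kappa(q)$ is a fixed constant with $2^{2-q}\le\kappa\le q2^{1-q}$ for which $|F|^q\ge|A|^q+q|A|^{q-2}A\cdot(F-A)+\kappa|F-A|^q$ holds for all $A,F\in\mathbb{R}^{3\times3}$. The functions $h$, $Z$ and the constant $\gamma$ are fixed throughout. *)

theory Defs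
  imports "HOL-Analysis.Analysis"
begin

text \<open>
  The norm of \<^typ>\<open>real^3^3\<close> is the Frobenius norm and its inner product is \<open>tr (A\<^sup>T B)\<close>.
\<close>

lemma matrix_inner_eq_trace:
  fixes A B :: "real^'n^'m"
  shows "A \<bullet> B = trace (transpose A ** B)"
proof -
  have "A \<bullet> B = (\<Sum>i\<in>UNIV. \<Sum>j\<in>UNIV. A $ i $ j * B $ i $ j)"
    by (simp add: inner_vec_def)
  also have "\<dots> = (\<Sum>j\<in>UNIV. \<Sum>i\<in>UNIV. A $ i $ j * B $ i $ j)"
    by (rule sum.swap)
  also have "\<dots> = trace (transpose A ** B)"
    by (simp add: trace_def matrix_matrix_mult_def transpose_def)
  finally show ?thesis .
qed

lemma matrix_norm_eq_trace:
  fixes A :: "real^'n^'m"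
  shows "norm A = sqrt (trace (transpose A ** A))"
  by (simp add: norm_eq_sqrt_inner matrix_inner_eq_trace)

text \<open>
  The \<open>(i, j)\<close> cofactor is the determinant of \<open>A\<close> with row \<open>i\<close> and column \<open>j\<close> replaced by unit
  vectors, which is the signed minor \<open>(-1)\<^sup>i\<^sup>+\<^sup>j M\<^sub>i\<^sub>j\<close>.
\<close>

definition cof :: "real^'n^'n \<Rightarrow> real^'n^'n" where
  "cof A = (\<chi> i j. det (\<chi> k l. if k = i \<and> l = j then 1 else if k = i \<or> l = j then 0 else A $ k $ l))"

text \<open>Intended for open \<open>S\<close>.\<close>

primrec Ck_on :: "nat \<Rightarrow> ('a::euclidean_space \<Rightarrow> real) \<Rightarrow> 'a set \<Rightarrow> bool" where
  "Ck_on 0 f S \<longleftrightarrow> continuous_on S f"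
| "Ck_on (Suc k) f S \<longleftrightarrow>
     (\<exists>g. (\<forall>x\<in>S. (f has_derivative (\<lambda>v. g x \<bullet> v)) (at x)) \<and> (\<forall>b\<in>Basis. Ck_on k (\<lambda>x. g x \<bullet> b) S))"

definition smooth :: "('a::euclidean_space \<Rightarrow> real) \<Rightarrow> bool" where
  "smooth f \<longleftrightarrow> (\<forall>k. Ck_on k f UNIV)"

definition test_functions :: "'a::euclidean_space set \<Rightarrow> ('a \<Rightarrow> real) set" where
  "test_functions \<Omega> =
     {\<phi>. smooth \<phi> \<and> compact (closure {x. \<phi> x \<noteq> 0}) \<and> closure {x. \<phi> x \<noteq> 0} \<subseteq> \<Omega>}"

text \<open>
  Near each boundary point, in suitable orthonormal coordinates \<open>y = T x\<close>, the set \<open>\<Omega>\<close> is the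
  region above the graph of a Lipschitz function of \<open>(y\<^sub>1, y\<^sub>2)\<close>.
\<close>

definition lipschitz_boundary :: "(real^3) set \<Rightarrow> bool" where
  "lipschitz_boundary \<Omega> \<longleftrightarrow>
     (\<forall>p\<in>frontier \<Omega>. \<exists>r>0. \<exists>(T :: real^3 \<Rightarrow> real^3) (g :: real \<times> real \<Rightarrow> real) L.
        orthogonal_transformation T \<and> L-lipschitz_on UNIV g \<and>
        (\<forall>x\<in>ball p r. x \<in> \<Omega> \<longleftrightarrow> g (T x $ 1, T x $ 2) < T x $ 3))"

definition lipschitz_domain :: "(real^3) set \<Rightarrow> bool" where
  "lipschitz_domain \<Omega> \<longleftrightarrow>
     \<Omega> \<noteq> {} \<and> open \<Omega> \<and> connected \<Omega> \<and> bounded \<Omega> \<and> lipschitz_boundary \<Omega>"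

definition Lq_on :: "real \<Rightarrow> (real^3) set \<Rightarrow> (real^3 \<Rightarrow> 'b::euclidean_space) \<Rightarrow> bool" where
  "Lq_on q \<Omega> f \<longleftrightarrow>
     set_borel_measurable lebesgue \<Omega> f \<and> set_integrable lebesgue \<Omega> (\<lambda>x. norm (f x) powr q)"

text \<open>Gradients are arranged as \<open>(\<nabla>u)\<^sub>i\<^sub>j = \<partial>\<^sub>j u\<^sub>i\<close>, as for \<^const>\<open>jacobian\<close>.\<close>

definition has_weak_gradient ::
    "real \<Rightarrow> (real^3) set \<Rightarrow> (real^3 \<Rightarrow> real^3) \<Rightarrow> (real^3 \<Rightarrow> real^3^3) \<Rightarrow> bool" where
  "has_weak_gradient q \<Omega> u G \<longleftrightarrow>
     Lq_on q \<Omega> u \<and> Lq_on q \<Omega> G \<and>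
     (\<forall>\<phi>\<in>test_functions \<Omega>. \<forall>i j.
        (LINT x:\<Omega>|lebesgue. u x $ i * frechet_derivative \<phi> (at x) (axis j 1)) =
        - (LINT x:\<Omega>|lebesgue. G x $ i $ j * \<phi> x))"

definition sobolev_W1 :: "real \<Rightarrow> (real^3) set \<Rightarrow> (real^3 \<Rightarrow> real^3) set" where
  "sobolev_W1 q \<Omega> = {u. \<exists>G. has_weak_gradient q \<Omega> u G}"

text \<open>A representative; it is determined up to null sets in \<open>\<Omega>\<close>.\<close>

definition weak_grad :: "real \<Rightarrow> (real^3) set \<Rightarrow> (real^3 \<Rightarrow> real^3) \<Rightarrow> real^3 \<Rightarrow> real^3^3" where
  "weak_grad q \<Omega> u = (SOME G. has_weak_gradient q \<Omega> u G)"

text \<open>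
  Two-dimensional Hausdorff measure, normalised by the area \<open>\<pi> (d/2)\<^sup>2\<close> of a disc of diameter \<open>d\<close>.
  It is a metric outer measure, hence countably additive on the Borel sets.
\<close>

definition hausdorff2_pre :: "real \<Rightarrow> (real^3) set \<Rightarrow> ennreal" where
  "hausdorff2_pre d A =
     (INF C \<in> {C :: nat \<Rightarrow> (real^3) set. A \<subseteq> (\<Union>j. C j) \<and> (\<forall>j. bounded (C j) \<and> diameter (C j) \<le> d)}.
        \<Sum>j. ennreal (pi * (diameter (C j) / 2)\<^sup>2))"

definition hausdorff2_outer :: "(real^3) set \<Rightarrow> ennreal" where
  "hausdorff2_outer A = (SUP d \<in> {0<..}. hausdorff2_pre d A)"

definition hausdorff2 :: "(real^3) measure" where
  "hausdorff2 = measure_of UNIV (sets borel) hausdorff2_outer"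

text \<open>
  The trace operator \<open>W\<^sup>1\<^sup>,\<^sup>q(\<Omega>) \<rightarrow> L\<^sup>q(\<partial>\<Omega>)\<close> is the continuous extension of the restriction map
  \<open>v \<mapsto> v|\<^sub>\<partial>\<^sub>\<Omega>\<close> from the functions smooth up to the boundary: \<open>u\<close> has trace \<open>g\<close> iff some such
  functions \<open>v\<^sub>k\<close> converge to \<open>u\<close> in \<open>W\<^sup>1\<^sup>,\<^sup>q(\<Omega>)\<close> while their restrictions converge to \<open>g\<close> in
  \<open>L\<^sup>q(\<partial>\<Omega>)\<close>.
\<close>

definition has_trace ::
    "real \<Rightarrow> (real^3) set \<Rightarrow> (real^3 \<Rightarrow> real^3) \<Rightarrow> (real^3 \<Rightarrow> real^3) \<Rightarrow> bool" where
  "has_trace q \<Omega> u g \<longleftrightarrow>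
     (\<exists>v :: nat \<Rightarrow> real^3 \<Rightarrow> real^3.
        (\<forall>k i. smooth (\<lambda>x. v k x $ i)) \<and>
        (\<lambda>k. \<integral>\<^sup>+x\<in>\<Omega>. ennreal (norm (v k x - u x) powr q) \<partial>lebesgue) \<longlonglongrightarrow> 0 \<and>
        (\<lambda>k. \<integral>\<^sup>+x\<in>\<Omega>. ennreal (norm (jacobian (v k) (at x) - weak_grad q \<Omega> u x) powr q) \<partial>lebesgue)
          \<longlonglongrightarrow> 0 \<and>
        (\<lambda>k. \<integral>\<^sup>+x\<in>frontier \<Omega>. ennreal (norm (v k x - g x) powr q) \<partial>hausdorff2) \<longlonglongrightarrow> 0)"

definition u_lin :: "real \<Rightarrow> real^3 \<Rightarrow> real^3" where
  "u_lin lam x = lam *\<^sub>R x"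

definition admissible :: "real \<Rightarrow> (real^3) set \<Rightarrow> real \<Rightarrow> (real^3 \<Rightarrow> real^3) set" where
  "admissible q \<Omega> lam =
     {u \<in> sobolev_W1 q \<Omega>. has_trace q \<Omega> u (u_lin lam) \<and>
        (AE x in lebesgue. x \<in> \<Omega> \<longrightarrow> det (weak_grad q \<Omega> u x) > 0)}"

definition stored_energy ::
    "real \<Rightarrow> real \<Rightarrow> (real^3^3 \<Rightarrow> real) \<Rightarrow> (real \<Rightarrow> ennreal) \<Rightarrow> real^3^3 \<Rightarrow> ennreal" where
  "stored_energy q \<gamma> Z h A =
     ennreal (norm A powr q + \<gamma> * (norm A)\<^sup>2 + Z (cof A)) + h (det A)"

definition energy ::
    "real \<Rightarrow> real \<Rightarrow> (real^3^3 \<Rightarrow> real) \<Rightarrow> (real \<Rightarrow> ennreal) \<Rightarrow>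
     (real^3) set \<Rightarrow> (real^3 \<Rightarrow> real^3) \<Rightarrow> ennreal" where
  "energy q \<gamma> Z h \<Omega> u = (\<integral>\<^sup>+x\<in>\<Omega>. stored_energy q \<gamma> Z h (weak_grad q \<Omega> u x) \<partial>lebesgue)"

text \<open>Extended-real valued: the subtraction of \<^typ>\<open>ennreal\<close> would truncate at \<open>0\<close>.\<close>

definition energy_gap ::
    "real \<Rightarrow> real \<Rightarrow> (real^3^3 \<Rightarrow> real) \<Rightarrow> (real \<Rightarrow> ennreal) \<Rightarrow>
     (real^3) set \<Rightarrow> real \<Rightarrow> (real^3 \<Rightarrow> real^3) \<Rightarrow> ereal" where
  "energy_gap q \<gamma> Z h \<Omega> lam u =
     enn2ereal (energy q \<gamma> Z h \<Omega> u) - enn2ereal (energy q \<gamma> Z h \<Omega> (u_lin lam))"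

end

theory Submission
  imports Defs
begin

text \<open>
  Write \<open>F = \<nabla>u = \<lambda>\<one> + G\<close>. Convexity of the four terms of \<open>W\<close> at \<open>\<lambda>\<one>\<close> gives the pointwise bound
  \<open>W F \<ge> W (\<lambda>\<one>) + \<kappa>\<bar>G\<bar>\<^sup>q + \<gamma>\<bar>G\<bar>\<^sup>2 + h'(\<lambda>\<^sup>3) det G\<close> up to terms that are affine in \<open>F\<close> and \<open>cof F\<close>. Since
  \<open>det F > 0\<close>, the matrix \<open>H = G/\<lambda>\<close> satisfies \<open>det H + \<bar>H\<bar>\<^sup>2/2 \<ge> 0\<close>: if \<open>det H < 0 < det (\<one> + H)\<close>, then \<open>-H\<close>
  has an eigenvalue in \<open>(0, 1)\<close>, and Hadamard's inequality applies in an orthonormal basis starting with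
  the eigenvector. So \<open>\<gamma> \<ge> \<lambda> h'(\<lambda>\<^sup>3)/2\<close> absorbs the determinant, and \<open>c = 1/\<kappa>\<close> works once the affine terms
  integrate to zero.

  For the latter, \<open>u - u\<^sub>\<lambda>\<close> is integrated by parts against functions \<open>\<phi>\<close> that need not vanish on
  \<open>\<partial>\<Omega>\<close>; the boundary terms of the approximating functions tend to zero with their traces. Taking
  \<open>\<phi> = 1\<close> yields \<open>\<integral>G = 0\<close>; taking for \<open>\<phi>\<close> the derivatives of the smooth approximations of \<open>u\<close>, the symmetry
  of second derivatives and a passage to the limit yield \<open>\<integral>cof F = \<lambda>\<^sup>2\<bar>\<Omega>\<bar>\<one>\<close>, for which \<open>q \<ge> 2\<close> suffices.
\<close>

subsection \<open>The pointwise energy inequality\<close>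

text \<open>Two obstacles shape the proof. The determinant is cubic in the gradient, and for q < 3
  membership in L^q does not make it integrable; it therefore cannot join the affine terms that
  integrate to zero and has to be absorbed pointwise. Scaling G = \<lambda>H turns det H + |H|^2/2
  into det G + \<lambda>|G|^2/2 after multiplication by \<lambda>^3, which is why exactly
  h'(\<lambda>^3)\<lambda>/2 is asked of \<gamma>.

  Secondly, the boundary condition is given only through smooth functions v_k converging in L^q of
  the boundary, not through an approximation of u - u_\<lambda> by test functions. The boundary
  terms have to be bounded by something that visibly tends to zero, a fixed multiple of the boundary
  integral of |v_k - u_\<lambda>|. An inequality with a crude constant is enough for this, so no
  normal vector and no surface parametrisation occur; in exchange, Hausdorff area has to be shown to
  be a Borel measure, approximable by ball covers, and finite on Lipschitz boundaries.\<close>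

lemma abs_det_3_le_norm_columns:
  fixes B :: "real^3^3"
  shows "\<bar>det B\<bar> \<le> norm (column 1 B) * (norm (column 2 B) * norm (column 3 B))"
proof -
  have "det B = column 1 B \<bullet> cross3 (column 2 B) (column 3 B)"
    by (simp add: cross3_simps column_def)
  then have "\<bar>det B\<bar> \<le> norm (column 1 B) * norm (cross3 (column 2 B) (column 3 B))"
    by (metis Cauchy_Schwarz_ineq2)
  \<comment> \<open>Lagrange's identity: |x \<times> y|^2 + (x . y)^2 = |x|^2 |y|^2.\<close>
  also have "norm (cross3 (column 2 B) (column 3 B)) \<le> norm (column 2 B) * norm (column 3 B)"
  proof (rule power2_le_imp_le)
    show "(norm (cross3 (column 2 B) (column 3 B)))\<^sup>2 \<le> (norm (column 2 B) * norm (column 3 B))\<^sup>2"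
      unfolding norm_cross_dot[symmetric] by simp
  qed simp
  finally show ?thesis by (simp add: mult_left_mono)
qed

lemma norm_matrix_mult_orthogonal:
  fixes A Q :: "real^'n^'n"
  assumes "orthogonal_matrix Q"
  shows "norm (A ** Q) = norm A"
proof -
  have "trace (transpose (A ** Q) ** (A ** Q)) = trace (transpose Q ** (transpose A ** A ** Q))"
    by (simp add: matrix_transpose_mul matrix_mul_assoc)
  also have "\<dots> = trace (transpose A ** A ** (Q ** transpose Q))"
    by (subst trace_mul_sym) (simp add: matrix_mul_assoc)
  also have "\<dots> = trace (transpose A ** A)"
    using assms by (simp add: orthogonal_matrix_def)
  finally show ?thesis by (simp add: matrix_norm_eq_trace)
qed

lemma norm_square_columns_3:
  fixes B :: "real^3^3"
  shows "(norm B)\<^sup>2 = (norm (column 1 B))\<^sup>2 + (norm (column 2 B))\<^sup>2 + (norm (column 3 B))\<^sup>2"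
  by (simp add: power2_norm_eq_inner inner_vec_def sum_3 column_def)

text \<open>The factor 1/2 is that of the arithmetic-geometric mean inequality, applied to the two
  columns left over once the eigenvector column is bounded by 1. It cannot be lowered: test diag(-1
  + \<epsilon>, a, a) with a large and \<epsilon> small.\<close>

lemma det_ge_of_det_id_plus_pos:
  fixes H :: "real^3^3"
  assumes "det (mat 1 + H) > 0"
  shows "0 \<le> det H + (norm H)\<^sup>2 / 2"
proof (cases "det H \<ge> 0")
  case False
  let ?f = "\<lambda>t::real. det (t *\<^sub>R mat 1 + H)"
  have "\<exists>t\<ge>0. t \<le> 1 \<and> ?f t = 0"
    using False assms
    by (intro IVT') (auto simp: det_3 intro!: continuous_intros)
  then obtain t where t: "0 \<le> t" "t \<le> 1" "det (t *\<^sub>R mat 1 + H) = 0" by blast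
  then obtain w where w: "w \<noteq> 0" "(t *\<^sub>R mat 1 + H) *v w = 0"
    by (metis invertible_det_nz invertible_left_inverse matrix_left_invertible_ker)
  define v where "v = w /\<^sub>R norm w"
  have "H *v w = - t *\<^sub>R w"
    using w(2) by (simp add: matrix_vector_mult_add_rdistrib scaleR_matrix_vector_assoc [symmetric] add_eq_0_iff)
  then have Hv: "H *v v = - t *\<^sub>R v"
    by (simp add: v_def matrix_vector_mult_scaleR)
  have nv: "norm v = 1" using w by (simp add: v_def)
  then obtain Q where Q: "orthogonal_matrix Q" "Q *v axis 1 1 = v"
    by (rule orthogonal_matrix_exists_basis)
  \<comment> \<open>The columns of \<open>?B\<close> are the images under \<open>H\<close> of an
    orthonormal basis whose first vector is the eigenvector \<open>v\<close>.\<close>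
  let ?B = "H ** Q"
  have "column 1 ?B = - t *\<^sub>R v"
    using Q(2) Hv by (metis matrix_vector_mul_assoc matrix_vector_mult_basis)
  then have c1: "norm (column 1 ?B) \<le> 1" using t nv by simp
  have "\<bar>det ?B\<bar> = \<bar>det H\<bar>"
    using det_orthogonal_matrix[OF Q(1)] by (auto simp: det_mul)
  then have "\<bar>det H\<bar> \<le> norm (column 1 ?B) * (norm (column 2 ?B) * norm (column 3 ?B))"
    using abs_det_3_le_norm_columns[of ?B] by simp
  also have "\<dots> \<le> norm (column 2 ?B) * norm (column 3 ?B)"
    using c1 by (intro mult_left_le_one_le) auto
  also have "\<dots> \<le> ((norm (column 2 ?B))\<^sup>2 + (norm (column 3 ?B))\<^sup>2) / 2"
    using sum_squares_bound[of "norm (column 2 ?B)" "norm (column 3 ?B)"] by simp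
  also have "\<dots> \<le> (norm ?B)\<^sup>2 / 2" by (simp add: norm_square_columns_3)
  also have "\<dots> = (norm H)\<^sup>2 / 2" using Q(1) by (simp add: norm_matrix_mult_orthogonal)
  finally show ?thesis by simp
qed simp

lemma Ck_on_SucE:
  assumes "Ck_on (Suc k) f S"
  obtains g where "\<And>x. x \<in> S \<Longrightarrow> (f has_derivative (\<lambda>v. g x \<bullet> v)) (at x)"
    and "\<And>b. b \<in> Basis \<Longrightarrow> Ck_on k (\<lambda>x. g x \<bullet> b) S"
  using assms by auto

text \<open>On the line through \<open>x\<close> and \<open>y\<close> this is the one-variable
  tangent inequality, taken at parameter 0 and evaluated at 1.\<close>

lemma convex_on_UNIV_above_tangent:
  fixes f :: "'a::euclidean_space \<Rightarrow> real"
  assumes conv: "convex_on UNIV f" and der: "(f has_derivative f') (at x)"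
  shows "f x + f' (y - x) \<le> f y"
proof -
  let ?p = "\<lambda>t::real. x + t *\<^sub>R (y - x)"
  have "convex_on UNIV (\<lambda>t. f (?p t))"
  proof (intro convex_onI)
    fix t a b :: real assume t: "0 < t" "t < 1"
    have "?p ((1 - t) *\<^sub>R a + t *\<^sub>R b) = (1 - t) *\<^sub>R ?p a + t *\<^sub>R ?p b"
      by (simp add: algebra_simps)
    then show "f (?p ((1 - t) *\<^sub>R a + t *\<^sub>R b)) \<le> (1 - t) * f (?p a) + t * f (?p b)"
      using convex_onD[OF conv, of t "?p a" "?p b"] t by simp
  qed auto
  moreover have "((\<lambda>t. f (?p t)) has_real_derivative f' (y - x)) (at 0)"
  proof -
    have "(?p has_derivative (\<lambda>t. t *\<^sub>R (y - x))) (at 0)"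
      by (auto intro!: derivative_eq_intros)
    then have "((\<lambda>t. f (?p t)) has_derivative (\<lambda>t. f' (t *\<^sub>R (y - x)))) (at 0)"
      using diff_chain_at[of ?p _ 0 f f'] der by (simp add: o_def)
    moreover have "(\<lambda>t. f' (t *\<^sub>R (y - x))) = (*) (f' (y - x))"
      using has_derivative_linear[OF der] by (auto simp: linear_scale)
    ultimately show ?thesis by (simp add: has_field_derivative_def)
  qed
  ultimately have "f (?p 1) - f (?p 0) \<ge> f' (y - x) * (1 - 0)"
    by (intro convex_on_imp_above_tangent[where A=UNIV]) auto
  then show ?thesis by simp
qed

text \<open>Indices are arranged cyclically, so that no signs appear and all nine entries have the
  shape \<open>A $ i $ a * A $ j $ b - A $ i $ b * A $ j $ a\<close>, which is the shape that
  \<open>integral_minor\<close> integrates.\<close>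

lemma cof_3:
  fixes A :: "real^3^3"
  shows "cof A $ 1 $ 1 = A $ 2 $ 2 * A $ 3 $ 3 - A $ 2 $ 3 * A $ 3 $ 2"
    and "cof A $ 1 $ 2 = A $ 2 $ 3 * A $ 3 $ 1 - A $ 2 $ 1 * A $ 3 $ 3"
    and "cof A $ 1 $ 3 = A $ 2 $ 1 * A $ 3 $ 2 - A $ 2 $ 2 * A $ 3 $ 1"
    and "cof A $ 2 $ 1 = A $ 3 $ 2 * A $ 1 $ 3 - A $ 3 $ 3 * A $ 1 $ 2"
    and "cof A $ 2 $ 2 = A $ 3 $ 3 * A $ 1 $ 1 - A $ 3 $ 1 * A $ 1 $ 3"
    and "cof A $ 2 $ 3 = A $ 3 $ 1 * A $ 1 $ 2 - A $ 3 $ 2 * A $ 1 $ 1"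
    and "cof A $ 3 $ 1 = A $ 1 $ 2 * A $ 2 $ 3 - A $ 1 $ 3 * A $ 2 $ 2"
    and "cof A $ 3 $ 2 = A $ 1 $ 3 * A $ 2 $ 1 - A $ 1 $ 1 * A $ 2 $ 3"
    and "cof A $ 3 $ 3 = A $ 1 $ 1 * A $ 2 $ 2 - A $ 1 $ 2 * A $ 2 $ 1"
  by (simp_all add: cof_def det_3)

lemma cof_scaleR_id: "cof (l *\<^sub>R mat 1 :: real^3^3) = l\<^sup>2 *\<^sub>R mat 1"
  by (simp add: vec_eq_iff forall_3 cof_3 mat_def power2_eq_square)

lemma det_scaleR_id: "det (l *\<^sub>R mat 1 :: real^3^3) = l ^ 3"
  by (simp add: det_3 mat_def power3_eq_cube)

lemma det_scaleR_3: "det (l *\<^sub>R A) = l ^ 3 * det (A :: real^3^3)"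
  by (simp add: det_3 power3_eq_cube algebra_simps)

text \<open>With G = F - l\<cdot>1, the usual expansion reads det F - l^3 = l^2 tr G + l tr (cof G)
  + det G. Expressing tr (cof G) through cof F costs 2 l^2 tr G, which reverses the sign of the
  linear term. The point of doing so is that cof F has a computable integral.\<close>

lemma det_expand_about_scaleR_id:
  fixes F :: "real^3^3"
  shows "det F - l ^ 3 = (- l\<^sup>2 *\<^sub>R mat 1) \<bullet> (F - l *\<^sub>R mat 1)
    + (l *\<^sub>R mat 1) \<bullet> (cof F - l\<^sup>2 *\<^sub>R mat 1) + det (F - l *\<^sub>R mat 1)"
  by (simp add: inner_vec_def sum_3 cof_3 mat_def det_3 power2_eq_square power3_eq_cube algebra_simps)

text \<open>The terms with \<open>L\<close> and \<open>M\<close> are kept rather than estimated,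
  because they are the ones that integrate to zero. The real number on the left may be negative and
  is then truncated to 0 by \<open>ennreal\<close>; this does no harm since the stored energy is
  nonnegative.\<close>

lemma energy_density_lower_bound:
  fixes Z :: "real^3^3 \<Rightarrow> real" and h :: "real \<Rightarrow> ennreal" and q \<gamma> \<kappa> l :: real
  assumes Z: "convex_on UNIV Z" "Ck_on 1 Z UNIV"
    and Znn: "\<And>A. Z A \<ge> 0" and \<gamma>nn: "\<gamma> > 0"
    and hfin: "\<And>t. t > 0 \<Longrightarrow> h t < \<infinity>"
    and h: "convex_on {0<..} (\<lambda>t. enn2real (h t))" "Ck_on 1 (\<lambda>t. enn2real (h t)) {0<..}"
    and \<kappa>: "\<And>A F :: real^3^3. norm F powr q \<ge>
           norm A powr q + q * norm A powr (q - 2) * (A \<bullet> (F - A)) + \<kappa> * norm (F - A) powr q"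
    and l: "l > 0" "deriv (\<lambda>t. enn2real (h t)) (l ^ 3) > 0"
    and \<gamma>: "\<gamma> / (l * deriv (\<lambda>t. enn2real (h t)) (l ^ 3)) \<ge> 1 / 2"
  obtains W0 :: real and L M :: "real^3^3"
  where "W0 \<ge> 0" "stored_energy q \<gamma> Z h (l *\<^sub>R mat 1) = ennreal W0"
    and "\<And>F :: real^3^3. det F > 0 \<Longrightarrow>
      ennreal (W0 + L \<bullet> (F - l *\<^sub>R mat 1) + M \<bullet> (cof F - l\<^sup>2 *\<^sub>R mat 1) + \<kappa> * norm (F - l *\<^sub>R mat 1) powr q)
        \<le> stored_energy q \<gamma> Z h F"
proof -
  define A :: "real^3^3" where "A = l *\<^sub>R mat 1"
  define hr where "hr = (\<lambda>t. enn2real (h t))"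
  define h' where "h' = deriv hr (l ^ 3)"
  have h'pos: "h' > 0" using l by (simp add: h'_def hr_def)
  have h_eq: "h t = ennreal (hr t)" if "t > 0" for t
    using hfin[OF that] by (simp add: hr_def less_top)
  obtain g where g: "(Z has_derivative (\<lambda>V. g \<bullet> V)) (at (cof A))"
    using Z(2) by auto
  have Zt: "Z (cof A) + g \<bullet> (cof F - cof A) \<le> Z (cof F)" for F
    by (rule convex_on_UNIV_above_tangent[OF Z(1) g])
  obtain d where "(hr has_derivative (\<lambda>v. d \<bullet> v)) (at (l ^ 3))"
    using Ck_on_SucE[of 0 hr "{0<..}"] h(2) l(1) unfolding hr_def One_nat_def
    by (metis greaterThan_iff zero_less_power)
  then have "(hr has_real_derivative d) (at (l ^ 3))"
    by (simp add: has_field_derivative_def)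
  then have d: "(hr has_real_derivative h') (at (l ^ 3))"
    unfolding h'_def by (simp add: DERIV_imp_deriv)
  have ht: "hr (l ^ 3) + h' * (t - l ^ 3) \<le> hr t" if "t > 0" for t
  proof -
    have "hr t - hr (l ^ 3) \<ge> h' * (t - l ^ 3)"
      using h(1) l(1) that d
      by (intro convex_on_imp_above_tangent[where A="{0<..}"])
         (auto simp: hr_def interior_open has_field_derivative_at_within connected_Ioi)
    then show ?thesis by simp
  qed
  define W0 where "W0 = norm A powr q + \<gamma> * (norm A)\<^sup>2 + Z (cof A) + hr (l ^ 3)"
  \<comment> \<open>\<open>L\<close> collects the gradients of the two norm terms at
    \<open>A\<close> and the linear part of h'(l^3) (det F - l^3); \<open>M\<close> collects the
    gradient of \<open>Z\<close> at \<open>cof A\<close> and the cofactor part of the same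
    expansion.\<close>
  define L where "L = (q * norm A powr (q - 2)) *\<^sub>R A + (2 * \<gamma>) *\<^sub>R A + (- h' * l\<^sup>2) *\<^sub>R mat 1"
  define M where "M = g + (h' * l) *\<^sub>R mat 1"
  have hrnn: "hr t \<ge> 0" for t by (simp add: hr_def)
  have W0nn: "W0 \<ge> 0" using hrnn Znn \<gamma>nn by (simp add: W0_def)
  have detA: "det A = l ^ 3" "cof A = l\<^sup>2 *\<^sub>R mat 1"
    by (simp_all add: A_def det_scaleR_id cof_scaleR_id)
  have "stored_energy q \<gamma> Z h A = ennreal W0"
    using l(1) Znn \<gamma>nn hrnn by (simp add: stored_energy_def W0_def detA h_eq)
  moreover have "ennreal (W0 + L \<bullet> (F - A) + M \<bullet> (cof F - l\<^sup>2 *\<^sub>R mat 1) + \<kappa> * norm (F - A) powr q)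
        \<le> stored_energy q \<gamma> Z h F" if F: "det F > 0" for F
  proof -
    define G where "G = F - A"
    \<comment> \<open>The quadratic term is expanded exactly, since its remainder \<gamma>|G|^2 has
      to pay for h' det G.\<close>
    have sq: "(norm F)\<^sup>2 = (norm A)\<^sup>2 + 2 * (A \<bullet> G) + (norm G)\<^sup>2"
      unfolding G_def power2_norm_eq_inner by (simp add: algebra_simps inner_commute)
    have "F = l *\<^sub>R (mat 1 + G /\<^sub>R l)" using l(1) by (simp add: G_def A_def algebra_simps)
    then have "l ^ 3 * det (mat 1 + G /\<^sub>R l) > 0" using F by (metis det_scaleR_3)
    then have "det (mat 1 + G /\<^sub>R l) > 0" using l(1) by (simp add: zero_less_mult_iff)
    from det_ge_of_det_id_plus_pos[OF this]
    have "0 \<le> det (inverse l *\<^sub>R G) + (norm (inverse l *\<^sub>R G))\<^sup>2 / 2" .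
    then have "0 \<le> l ^ 3 * (inverse l ^ 3 * det G + (inverse l * norm G)\<^sup>2 / 2)"
      using l(1) by (simp add: det_scaleR_3)
    also have "\<dots> = det G + l * (norm G)\<^sup>2 / 2"
      using l(1) by (simp add: field_simps power3_eq_cube power2_eq_square)
    finally have "0 \<le> h' * (det G + l * (norm G)\<^sup>2 / 2)" using h'pos by simp
    \<comment> \<open>This is the hypothesis on \<gamma>, cleared of its denominator.\<close>
    moreover have "h' * l / 2 \<le> \<gamma>"
      using \<gamma> l(1) h'pos by (simp add: h'_def hr_def field_simps)
    then have "(h' * l / 2) * (norm G)\<^sup>2 \<le> \<gamma> * (norm G)\<^sup>2"
      by (rule mult_right_mono) simp
    ultimately have detG: "0 \<le> h' * det G + \<gamma> * (norm G)\<^sup>2"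
      by (simp add: algebra_simps)
    have det_eq: "h' * (det F - l ^ 3) = (- h' * l\<^sup>2) * (mat 1 \<bullet> G) + (h' * l) * (mat 1 \<bullet> (cof F - l\<^sup>2 *\<^sub>R mat 1)) + h' * det G"
      unfolding det_expand_about_scaleR_id[of F l] G_def A_def by (simp add: algebra_simps)
    have "W0 + L \<bullet> G + M \<bullet> (cof F - l\<^sup>2 *\<^sub>R mat 1) + \<kappa> * norm G powr q
       \<le> (norm F powr q + \<gamma> * (norm F)\<^sup>2 + Z (cof F)) + hr (det F)"
      using \<kappa>[of A F] Zt[of F] ht[OF F] detG det_eq
      unfolding W0_def L_def M_def sq detA G_def[symmetric] inner_add_left inner_scaleR_left 
      by (simp add: algebra_simps)
    then show ?thesis
      using Znn \<gamma>nn hrnn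
      by (simp add: stored_energy_def h_eq[OF F] G_def flip: ennreal_plus)
  qed
  ultimately show ?thesis using W0nn by (intro that[of W0 L M]) (auto simp: A_def)
qed

subsection \<open>Partial derivatives of compactly supported functions and cutoffs\<close>

lemma has_derivative_imp_DERIV_line:
  fixes g :: "'a::real_normed_vector \<Rightarrow> real"
  assumes "(g has_derivative D) (at (x + t *\<^sub>R e))"
  shows "((\<lambda>s. g (x + s *\<^sub>R e)) has_real_derivative D e) (at t)"
proof -
  have "((\<lambda>s. x + s *\<^sub>R e) has_derivative (\<lambda>s. s *\<^sub>R e)) (at t)"
    by (auto intro!: derivative_eq_intros)
  then have "((\<lambda>s. g (x + s *\<^sub>R e)) has_derivative (\<lambda>s. D (s *\<^sub>R e))) (at t)"
    using diff_chain_at[of "\<lambda>s. x + s *\<^sub>R e" _ t g D] assms by (simp add: o_def)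
  moreover have "(\<lambda>s. D (s *\<^sub>R e)) = (*) (D e)"
    using has_derivative_linear[OF assms] by (auto simp: linear_scale)
  ultimately show ?thesis by (simp add: has_field_derivative_def)
qed

text \<open>By translation invariance every difference quotient of \<open>g\<close> in direction
  \<open>e\<close> has integral zero. The mean value theorem bounds the quotients by
  \<open>M\<close> on a fixed ball, so dominated convergence applies. Measurability of the
  derivative comes from the same limit.\<close>

lemma integral_partial_derivative_eq_0:
  fixes g :: "'a::euclidean_space \<Rightarrow> real"
  assumes der: "\<And>x. (g has_derivative D x) (at x)"
    and bd: "\<And>x. \<bar>D x e\<bar> \<le> M"
    and S: "bounded S" "\<And>x. x \<notin> S \<Longrightarrow> g x = 0"
  shows "integral\<^sup>L lborel (\<lambda>x. D x e) = 0"
proof -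
  define s where "s n x = real (Suc n) * (g (x + (1 / real (Suc n)) *\<^sub>R e) - g x)" for n x
  have cont: "continuous_on UNIV g"
    using der by (meson continuous_at_imp_continuous_on has_derivative_continuous)
  then have [measurable]: "g \<in> borel_measurable borel" by (rule borel_measurable_continuous_onI)
  obtain r where r: "S \<subseteq> cball 0 r" using S(1) by (auto simp: bounded_iff subset_iff)
  have gint: "integrable lborel g"
  proof -
    have "integrable lborel (\<lambda>x. indicator (cball 0 r) x *\<^sub>R g x)"
      using cont by (intro borel_integrable_compact) (auto intro: continuous_on_subset)
    moreover have "(\<lambda>x. indicator (cball 0 r) x *\<^sub>R g x) = g"
      using r S(2) by (force simp: indicator_def fun_eq_iff)
    ultimately show ?thesis by simp
  qed
  have shift: "integrable lborel (\<lambda>x. g (x + a))" "integral\<^sup>L lborel (\<lambda>x. g (x + a)) = integral\<^sup>L lborel g" for a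
  proof -
    have d: "distr lborel borel ((+) a) = (lborel :: 'a measure)"
      by (rule lborel_distr_plus)
    have "integrable (distr lborel borel ((+) a)) g" using gint by (simp add: d)
    then show "integrable lborel (\<lambda>x. g (x + a))"
      by (subst (asm) integrable_distr_eq) (auto simp: add.commute)
    have "integral\<^sup>L (distr lborel borel ((+) a)) g = integral\<^sup>L lborel (\<lambda>x. g (x + a))"
      by (subst integral_distr) (auto simp: add.commute)
    then show "integral\<^sup>L lborel (\<lambda>x. g (x + a)) = integral\<^sup>L lborel g" by (simp add: d)
  qed
  have s0: "integral\<^sup>L lborel (s n) = 0" for n
    unfolding s_def using shift gint by simp
  have lim: "(\<lambda>n. s n x) \<longlonglongrightarrow> D x e" for x
  proof -
    have "((\<lambda>t. g (x + t *\<^sub>R e)) has_real_derivative D x e) (at 0)"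
      using has_derivative_imp_DERIV_line[of g "D x" x 0 e] der by simp
    then have "((\<lambda>h. (g (x + h *\<^sub>R e) - g x) / h) \<longlongrightarrow> D x e) (at 0)"
      by (simp add: DERIV_def)
    moreover have "filterlim (\<lambda>n. 1 / real (Suc n)) (at 0) sequentially"
      unfolding filterlim_at using LIMSEQ_inverse_real_of_nat by (auto simp: inverse_eq_divide)
    ultimately have "(\<lambda>n. (g (x + (1 / real (Suc n)) *\<^sub>R e) - g x) / (1 / real (Suc n))) \<longlonglongrightarrow> D x e"
      by (rule filterlim_compose)
    then show ?thesis by (simp add: s_def mult.commute)
  qed
  have M: "M \<ge> 0" using bd[of 0] by linarith
  \<comment> \<open>The increment is at most \<open>norm e\<close> long, so beyond radius
    \<open>r + norm e\<close> both points of the quotient lie outside \<open>S\<close>.\<close>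
  have dom: "norm (s n x) \<le> M * indicator (cball 0 (r + norm e)) x" for n x
  proof (cases "x \<in> cball 0 (r + norm e)")
    case True
    let ?h = "1 / real (Suc n)"
    have "\<exists>z>0. z < ?h \<and> g (x + ?h *\<^sub>R e) - g (x + 0 *\<^sub>R e) = (?h - 0) * D (x + z *\<^sub>R e) e"
      by (rule MVT2) (auto intro!: has_derivative_imp_DERIV_line[OF der])
    then obtain z where "g (x + ?h *\<^sub>R e) - g x = ?h * D (x + z *\<^sub>R e) e" by auto
    then have "s n x = D (x + z *\<^sub>R e) e" by (simp add: s_def)
    then show ?thesis using True bd by simp
  next
    case False
    then have nx: "norm x > r + norm e" by simp
    have "norm (x + (1 / real (Suc n)) *\<^sub>R e) \<ge> norm x - norm ((1 / real (Suc n)) *\<^sub>R e)"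
      by (metis norm_diff_ineq)
    moreover have "norm ((1 / real (Suc n)) *\<^sub>R e) \<le> norm e"
      by (simp add: divide_le_eq mult_le_cancel_left1)
    ultimately have "norm (x + (1 / real (Suc n)) *\<^sub>R e) > r" "norm x > r"
      using nx norm_ge_zero[of e] by linarith+
    then have "g (x + (1 / real (Suc n)) *\<^sub>R e) = 0" "g x = 0"
      using r by (auto intro!: S(2))
    then show ?thesis using M by (simp add: s_def)
  qed
  have smeas: "s n \<in> borel_measurable lborel" for n unfolding s_def by measurable
  have meas: "(\<lambda>x. D x e) \<in> borel_measurable lborel"
    using borel_measurable_LIMSEQ_real[OF lim smeas] .
  have w: "integrable lborel (\<lambda>x. M * indicator (cball 0 (r + norm e)) x)"
    using emeasure_lborel_cball_finite[of 0 "r + norm e"]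
    by (intro integrable_mult_right integrable_real_indicator) (auto simp: less_top)
  have "(\<lambda>n. integral\<^sup>L lborel (s n)) \<longlonglongrightarrow> integral\<^sup>L lborel (\<lambda>x. D x e)"
    by (rule integral_dominated_convergence[where s=s, OF meas smeas w]) (use lim dom in auto)
  then show "integral\<^sup>L lborel (\<lambda>x. D x e) = 0"
    unfolding s0 by (simp add: LIMSEQ_const_iff)
qed

section \<open>Continuously differentiable cutoffs that vanish on given balls\<close>

lemma has_real_derivative_max0_square:
  "((\<lambda>t. (max 0 t)\<^sup>2) has_real_derivative 2 * max 0 t) (at (t::real))"
proof -
  consider "t < 0" | "t > 0" | "t = 0" by linarith
  then show ?thesis
  proof cases
    case 1
    have "((\<lambda>t. 0) has_real_derivative 2 * max 0 t) (at t)" using 1 by simp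
    then show ?thesis
      by (rule has_field_derivative_transform_within_open[where S="{..<0}"]) (use 1 in auto)
  next
    case 2
    have "((\<lambda>t. t\<^sup>2) has_real_derivative 2 * max 0 t) (at t)"
      using 2 by (auto intro!: derivative_eq_intros)
    then show ?thesis
      by (rule has_field_derivative_transform_within_open[where S="{0<..}"]) (use 2 in auto)
  next
    case 3
    have "(\<lambda>h::real. (max 0 h)\<^sup>2 / h) = max 0"
      by (auto simp: fun_eq_iff max_def power2_eq_square)
    moreover have "(max 0 \<longlongrightarrow> max 0 (0::real)) (at 0)"
      by (intro tendsto_intros)
    ultimately have "((\<lambda>h::real. (max 0 h)\<^sup>2 / h) \<longlongrightarrow> 0) (at 0)" by simp
    then show ?thesis unfolding 3 DERIV_def by simp
  qed
qed

text \<open>Composing squared positive parts gives a C^1 cutoff, and C^1 suffices because cutoffs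
  are differentiated only once. The gradient bound is 4 * (2/r^2) * 2r = 16/r: the two inner
  derivatives give at most 4, the gradient of |x - c|^2/r^2 gives the rest.\<close>

lemma ball_cutoff:
  fixes c :: "'a::euclidean_space" and r :: real
  assumes r: "r > 0"
  obtains \<eta> D where "\<And>x. (\<eta> has_derivative (\<lambda>v. D x \<bullet> v)) (at x)" "continuous_on UNIV D"
    "\<And>x. 0 \<le> \<eta> x" "\<And>x. \<eta> x \<le> (1::real)" "\<And>x. x \<in> ball c r \<Longrightarrow> \<eta> x = 0"
    "\<And>x. norm (D x) \<le> 16 / r * indicator (cball c (2 * r)) x"
    "\<And>x. 1 - \<eta> x \<le> indicator (cball c (2 * r)) x"
proof -
  define P where "P t = (max 0 t)\<^sup>2" for t :: real
  \<comment> \<open>\<open>k\<close> is at most 0 on the ball of radius \<open>r\<close>, where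
    \<open>\<eta>\<close> becomes 0, and at least 1 outside the ball of radius \<open>2 * r\<close>,
    where \<open>1 - P (k x)\<close> is nonpositive and \<open>\<eta>\<close> becomes 1.\<close>
  define k where "k x = inverse (r\<^sup>2) * ((x - c) \<bullet> (x - c)) - 1" for x
  define \<eta> where "\<eta> x = 1 - P (1 - P (k x))" for x
  define m where "m x = 2 * max 0 (1 - P (k x)) * (2 * max 0 (k x)) * (2 / r\<^sup>2)" for x
  define D where "D x = m x *\<^sub>R (x - c)" for x
  have Pd: "(P has_real_derivative 2 * max 0 t) (at t)" for t
    unfolding P_def by (rule has_real_derivative_max0_square)
  have Pmono: "P s \<le> P t" if "s \<le> t" for s t
    using that unfolding P_def by (intro power_mono) auto
  have P01: "P t \<ge> 0" "P 1 = 1" "P 0 = 0" for t by (auto simp: P_def)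
  have kd: "(k has_derivative (\<lambda>v. (2 / r\<^sup>2) * ((x - c) \<bullet> v))) (at x)" for x
    unfolding k_def by (auto intro!: derivative_eq_intros simp: inner_commute divide_inverse)
  have der: "(\<eta> has_derivative (\<lambda>v. D x \<bullet> v)) (at x)" for x
  proof -
    have "((\<lambda>t. 1 - P (1 - P t)) has_real_derivative (2 * max 0 (1 - P (k x)) * (2 * max 0 (k x)))) (at (k x))"
      by (auto intro!: derivative_eq_intros DERIV_chain2[OF Pd] Pd)
    from has_derivative_compose[OF kd this[unfolded has_field_derivative_def]]
    show ?thesis unfolding \<eta>_def D_def m_def by (simp add: mult.assoc)
  qed
  have small: "k x \<le> 0" if "x \<in> ball c r" for x
  proof -
    have "norm (x - c) < r" using that by (simp add: dist_norm norm_minus_commute)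
    then have "(norm (x - c))\<^sup>2 \<le> r\<^sup>2" by (intro power_mono) auto
    then show ?thesis using r by (simp add: k_def power2_norm_eq_inner[symmetric] field_simps)
  qed
  have large: "k x \<ge> 1" if "x \<notin> cball c (2 * r)" for x
  proof -
    have "norm (x - c) \<ge> 2 * r" using that by (simp add: dist_norm norm_minus_commute)
    then have "(2 * r)\<^sup>2 \<le> (norm (x - c))\<^sup>2" using r by (intro power_mono) auto
    then have "4 * r\<^sup>2 \<le> (norm (x - c))\<^sup>2" by (simp add: power_mult_distrib)
    then have "4 \<le> (norm (x - c))\<^sup>2 / r\<^sup>2" using r by (simp add: le_divide_eq)
    then show ?thesis by (simp add: k_def power2_norm_eq_inner[symmetric] divide_inverse mult.commute)
  qed
  have Pge1: "max 0 (1 - P t) = 0" if "t \<ge> 1" for t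
    using Pmono[OF that] P01 by simp
  have e0: "\<eta> x \<le> 1" "\<eta> x \<ge> 0" for x
    using P01 Pmono[of "1 - P (k x)" 1] by (auto simp: \<eta>_def)
  have "\<eta> x = 0" if "x \<in> ball c r" for x
    using small[OF that] by (simp add: \<eta>_def P_def)
  moreover have "1 - \<eta> x \<le> indicator (cball c (2 * r)) x" for x
    using large[of x] Pge1[of "k x"] e0[of x] by (cases "x \<in> cball c (2 * r)") (auto simp: \<eta>_def P_def)
  moreover have "norm (D x) \<le> 16 / r * indicator (cball c (2 * r)) x" for x
  proof (cases "x \<in> cball c (2 * r)")
    case True
    have "max 0 (1 - P (k x)) * max 0 (k x) \<le> 1"
    proof (cases "k x \<ge> 1")
      case False
      then show ?thesis using P01(1)[of "k x"] by (intro mult_le_one) auto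
    qed (simp add: Pge1)
    then have "m x \<le> 4 * (2 / r\<^sup>2)"
      unfolding m_def by (intro mult_right_mono) auto
    moreover have m0: "m x \<ge> 0" by (simp add: m_def)
    moreover have "norm (x - c) \<le> 2 * r" using True by (simp add: dist_norm norm_minus_commute)
    ultimately have "norm (D x) \<le> 4 * (2 / r\<^sup>2) * (2 * r)"
      unfolding D_def by (simp only: norm_scaleR) (intro mult_mono; simp)
    then show ?thesis using True r by (simp add: power2_eq_square)
  next
    case False
    then show ?thesis using Pge1[OF large[OF False]] by (simp add: D_def m_def)
  qed
  moreover have "continuous_on UNIV D"
    unfolding D_def m_def P_def k_def using r by (intro continuous_intros) auto
  ultimately show ?thesis using that[of \<eta> D] der e0 by blast
qed

text \<open>The product of the single cutoffs. As all factors lie in [0, 1], the Leibniz rule and 1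
  - ab \<le> (1 - a) + (1 - b) make both bounds additive, regardless of how the balls
  overlap.\<close>

lemma finite_balls_cutoff:
  fixes c :: "'i \<Rightarrow> 'a::euclidean_space" and r :: "'i \<Rightarrow> real"
  assumes "finite I" "\<And>i. i \<in> I \<Longrightarrow> r i > 0"
  shows "\<exists>\<eta> D. (\<forall>x. (\<eta> has_derivative (\<lambda>v. D x \<bullet> v)) (at x)) \<and> continuous_on UNIV D \<and>
    (\<forall>x. 0 \<le> \<eta> x \<and> \<eta> x \<le> (1::real)) \<and> (\<forall>i\<in>I. \<forall>x\<in>ball (c i) (r i). \<eta> x = 0) \<and>
    (\<forall>x. norm (D x) \<le> (\<Sum>i\<in>I. 16 / r i * indicator (cball (c i) (2 * r i)) x)) \<and>
    (\<forall>x. 1 - \<eta> x \<le> (\<Sum>i\<in>I. indicator (cball (c i) (2 * r i)) x))"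
    (is "\<exists>\<eta> D. ?Q I \<eta> D")
  using assms
proof (induction I rule: finite_induct)
  case empty
  show ?case by (intro exI[of _ "\<lambda>_. 1"] exI[of _ "\<lambda>_. 0"]) auto
next
  case (insert i I)
  have "\<exists>\<eta> D. ?Q I \<eta> D" by (rule insert.IH) (use insert.prems in simp)
  then obtain \<eta> D where "?Q I \<eta> D" by (elim exE) (rule that)
  then have IH: "\<And>x. (\<eta> has_derivative (\<lambda>v. D x \<bullet> v)) (at x)" "continuous_on UNIV D"
    "\<And>x. 0 \<le> \<eta> x" "\<And>x. \<eta> x \<le> (1::real)" "\<And>i x. i \<in> I \<Longrightarrow> x \<in> ball (c i) (r i) \<Longrightarrow> \<eta> x = 0"
    "\<And>x. norm (D x) \<le> (\<Sum>i\<in>I. 16 / r i * indicator (cball (c i) (2 * r i)) x)"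
    "\<And>x. 1 - \<eta> x \<le> (\<Sum>i\<in>I. indicator (cball (c i) (2 * r i)) x)"
    by blast+
  obtain \<theta> E where N: "\<And>x. (\<theta> has_derivative (\<lambda>v. E x \<bullet> v)) (at x)" "continuous_on UNIV E"
    "\<And>x. 0 \<le> \<theta> x" "\<And>x. \<theta> x \<le> (1::real)" "\<And>x. x \<in> ball (c i) (r i) \<Longrightarrow> \<theta> x = 0"
    "\<And>x. norm (E x) \<le> 16 / r i * indicator (cball (c i) (2 * r i)) x"
    "\<And>x. 1 - \<theta> x \<le> indicator (cball (c i) (2 * r i)) x"
    using ball_cutoff[of "r i" "c i"] insert.prems by blast
  have cont: "continuous_on UNIV \<eta>" "continuous_on UNIV \<theta>"
    using IH(1) N(1) by (meson continuous_at_imp_continuous_on has_derivative_continuous)+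
  show ?case
  proof (intro exI[of _ "\<lambda>x. \<theta> x * \<eta> x"] exI[of _ "\<lambda>x. \<theta> x *\<^sub>R D x + \<eta> x *\<^sub>R E x"] conjI allI ballI)
    fix x
    show "((\<lambda>x. \<theta> x * \<eta> x) has_derivative (\<lambda>v. (\<theta> x *\<^sub>R D x + \<eta> x *\<^sub>R E x) \<bullet> v)) (at x)"
      by (rule has_derivative_eq_rhs[OF has_derivative_mult[OF N(1) IH(1)]])
         (auto simp: inner_add_left fun_eq_iff)
    show "0 \<le> \<theta> x * \<eta> x" "\<theta> x * \<eta> x \<le> 1"
      using N(3,4) IH(3,4) by (auto intro: mult_le_one)
    have "norm (\<theta> x *\<^sub>R D x + \<eta> x *\<^sub>R E x) \<le> \<theta> x * norm (D x) + \<eta> x * norm (E x)"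
      using norm_triangle_ineq[of "\<theta> x *\<^sub>R D x" "\<eta> x *\<^sub>R E x"] N(3) IH(3) by simp
    also have "\<dots> \<le> norm (D x) + norm (E x)"
      using N(3,4) IH(3,4) by (intro add_mono mult_left_le_one_le) auto
    also have "\<dots> \<le> (\<Sum>i\<in>insert i I. 16 / r i * indicator (cball (c i) (2 * r i)) x)"
      using insert.hyps IH(6)[of x] N(6)[of x] by simp
    finally show "norm (\<theta> x *\<^sub>R D x + \<eta> x *\<^sub>R E x) \<le> (\<Sum>i\<in>insert i I. 16 / r i * indicator (cball (c i) (2 * r i)) x)" .
    have "1 - \<theta> x * \<eta> x = (1 - \<theta> x) + \<theta> x * (1 - \<eta> x)" by (simp add: algebra_simps)
    also have "\<dots> \<le> (1 - \<theta> x) + (1 - \<eta> x)"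
      using N(3,4) IH(3,4) by (intro add_mono mult_left_le_one_le) auto
    also have "\<dots> \<le> (\<Sum>i\<in>insert i I. indicator (cball (c i) (2 * r i)) x)"
      using insert.hyps IH(7)[of x] N(7)[of x] by simp
    finally show "1 - \<theta> x * \<eta> x \<le> (\<Sum>i\<in>insert i I. indicator (cball (c i) (2 * r i)) x)" .
  next
    fix j x assume "j \<in> insert i I" "x \<in> ball (c j) (r j)"
    then show "\<theta> x * \<eta> x = 0" using N(5) IH(5) by auto
  next
    show "continuous_on UNIV (\<lambda>x. \<theta> x *\<^sub>R D x + \<eta> x *\<^sub>R E x)"
      by (intro continuous_intros cont IH N)
  qed
qed

subsection \<open>Hausdorff measure\<close>

lemma hausdorff2_pre_le:
  assumes "A \<subseteq> (\<Union>j. C j)" "\<And>j. bounded (C j)" "\<And>j. diameter (C j) \<le> d"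
  shows "hausdorff2_pre d A \<le> (\<Sum>j. ennreal (pi * (diameter (C j) / 2)\<^sup>2))"
  unfolding hausdorff2_pre_def using assms by (intro INF_lower) auto

lemma hausdorff2_pre_lessE:
  assumes "hausdorff2_pre d A < e"
  obtains C where "A \<subseteq> (\<Union>j::nat. C j)" "\<And>j. bounded (C j)" "\<And>j. diameter (C j) \<le> d"
    "(\<Sum>j. ennreal (pi * (diameter (C j) / 2)\<^sup>2)) < e"
  using assms unfolding hausdorff2_pre_def INF_less_iff by auto

lemma hausdorff2_pre_mono: "A \<subseteq> B \<Longrightarrow> hausdorff2_pre d A \<le> hausdorff2_pre d B"
  unfolding hausdorff2_pre_def by (intro INF_superset_mono) auto

lemma hausdorff2_pre_antimono: "d \<le> e \<Longrightarrow> hausdorff2_pre e A \<le> hausdorff2_pre d A"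
  unfolding hausdorff2_pre_def by (intro INF_superset_mono) (auto intro: order_trans)

lemma hausdorff2_pre_le_outer: "d > 0 \<Longrightarrow> hausdorff2_pre d A \<le> hausdorff2_outer A"
  unfolding hausdorff2_outer_def by (intro SUP_upper) auto

lemma hausdorff2_outer_leI: "(\<And>d. d > 0 \<Longrightarrow> hausdorff2_pre d A \<le> c) \<Longrightarrow> hausdorff2_outer A \<le> c"
  unfolding hausdorff2_outer_def by (intro SUP_least) auto

lemma hausdorff2_outer_mono: "A \<subseteq> B \<Longrightarrow> hausdorff2_outer A \<le> hausdorff2_outer B"
  by (meson hausdorff2_outer_leI hausdorff2_pre_le_outer hausdorff2_pre_mono order_trans)

lemma hausdorff2_outer_empty [simp]: "hausdorff2_outer {} = 0"
proof -
  have "hausdorff2_pre d {} \<le> 0" if "d > 0" for d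
    using hausdorff2_pre_le[of "{}" "\<lambda>_. {}" d] that by simp
  then have "hausdorff2_outer {} \<le> 0" by (rule hausdorff2_outer_leI)
  then show ?thesis by simp
qed

lemma hausdorff2_pre_UN_le: "hausdorff2_pre d (\<Union>i::nat. A i) \<le> (\<Sum>i. hausdorff2_pre d (A i))"
proof (rule ennreal_le_epsilon)
  let ?h = "hausdorff2_pre d"
  fix e :: real assume "(\<Sum>i. ?h (A i)) < top" and e: "0 < e"
  then have *: "?h (A n) < ?h (A n) + e * (1/2)^Suc n" for n
    by (auto simp add: less_top dest!: ennreal_suminf_lessD)
  let ?c = "\<lambda>D::(real^3) set. ennreal (pi * (diameter D / 2)\<^sup>2)"
  have "\<exists>C. A n \<subseteq> (\<Union>j::nat. C j) \<and> (\<forall>j. bounded (C j) \<and> diameter (C j) \<le> d) \<and>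
      (\<Sum>j. ?c (C j)) \<le> ?h (A n) + e * (1/2)^Suc n" for n
    using hausdorff2_pre_lessE[OF *[of n]] by (metis less_imp_le)
  then obtain B where B: "\<And>n. A n \<subseteq> (\<Union>j::nat. B n j)" "\<And>n j. bounded (B n j)" "\<And>n j. diameter (B n j) \<le> d"
      "\<And>n. (\<Sum>j. ?c (B n j)) \<le> ?h (A n) + e * (1/2)^Suc n"
    by metis
  \<comment> \<open>The covers of all the \<open>A n\<close> are interleaved into a single
    sequence.\<close>
  define C where "C = case_prod B \<circ> prod_decode"
  have "(\<Union>i. A i) \<subseteq> (\<Union>i. C i)"
    using B(1) by (auto simp add: C_def subset_eq) (metis prod.case prod_encode_inverse)
  then have "?h (\<Union>i. A i) \<le> (\<Sum>i. ?c (C i))"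
    using B by (intro hausdorff2_pre_le) (auto simp: C_def split_def)
  also have "\<dots> = (\<Sum>n. \<Sum>i. ?c (B n i))"
  proof -
    define f where "f = (\<lambda>(n, i). ?c (B n i))"
    have "(\<Sum>i. f (prod_decode i)) = (\<Sum>n. \<Sum>i. f (n, i))"
      by (rule suminf_ennreal_2dimen) (rule refl)
    moreover have "?c (C i) = f (prod_decode i)" for i
      unfolding f_def C_def by (cases "prod_decode i") (simp only: comp_def prod.case)
    ultimately show ?thesis by (simp only: f_def prod.case)
  qed
  also have "\<dots> \<le> (\<Sum>n. ?h (A n) + e * (1/2) ^ Suc n)"
    by (intro suminf_le allI B) auto
  also have "\<dots> = (\<Sum>n. ?h (A n)) + (\<Sum>n. ennreal e * ennreal ((1/2) ^ Suc n))"
    using e by (subst suminf_add[symmetric])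
      (auto simp del: ennreal_suminf_cmult simp add: ennreal_mult[symmetric])
  also have "\<dots> = (\<Sum>n. ?h (A n)) + e"
    unfolding ennreal_suminf_cmult
    by (subst suminf_ennreal_eq[OF zero_le_power power_half_series]) auto
  finally show "?h (\<Union>i. A i) \<le> (\<Sum>i. ?h (A i)) + e" .
qed

lemma hausdorff2_outer_UN_le: "hausdorff2_outer (\<Union>i::nat. A i) \<le> (\<Sum>i. hausdorff2_outer (A i))"
proof (rule hausdorff2_outer_leI)
  fix d :: real assume "d > 0"
  then show "hausdorff2_pre d (\<Union>i. A i) \<le> (\<Sum>i. hausdorff2_outer (A i))"
    by (intro order_trans[OF hausdorff2_pre_UN_le] suminf_le allI hausdorff2_pre_le_outer) auto
qed

lemma outer_measure_space_hausdorff2: "outer_measure_space (Pow UNIV) hausdorff2_outer"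
  unfolding outer_measure_space_def positive_def increasing_def countably_subadditive_def
  using hausdorff2_outer_mono hausdorff2_outer_UN_le by auto

section \<open>Additivity on separated sets and measurability of closed sets\<close>

lemma hausdorff2_outer_Un_le: "hausdorff2_outer (A \<union> B) \<le> hausdorff2_outer A + hausdorff2_outer B"
proof -
  have "(\<Union>i::nat. if i = 0 then A else if i = 1 then B else {}) = A \<union> B"
    by (auto split: if_splits)
  then have "hausdorff2_outer (A \<union> B) \<le> (\<Sum>i::nat. hausdorff2_outer (if i = 0 then A else if i = 1 then B else {}))"
    using hausdorff2_outer_UN_le[of "\<lambda>i::nat. if i = 0 then A else if i = 1 then B else {}"] by simp
  also have "\<dots> = (\<Sum>i\<in>{0,1}. hausdorff2_outer (if i = 0 then A else if i = (1::nat) then B else {}))"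
    by (intro suminf_finite) auto
  finally show ?thesis by simp
qed

lemma hausdorff2_outer_UN_finite_le:
  "finite I \<Longrightarrow> hausdorff2_outer (\<Union>i\<in>I. A i) \<le> (\<Sum>i\<in>I. hausdorff2_outer (A i))"
proof (induction I rule: finite_induct)
  case (insert x F)
  then show ?case
    using hausdorff2_outer_Un_le[of "A x" "\<Union>i\<in>F. A i"] by (auto intro: order_trans add_left_mono)
qed simp

text \<open>At scales below \<delta> no covering set can meet both \<open>A\<close> and
  \<open>B\<close>, so a cover of the union splits into a cover of each at no extra cost.\<close>

lemma hausdorff2_outer_add_separated:
  assumes \<delta>: "\<delta> > 0" and sep: "\<And>x y. x \<in> A \<Longrightarrow> y \<in> B \<Longrightarrow> \<delta> \<le> dist x y"
  shows "hausdorff2_outer A + hausdorff2_outer B \<le> hausdorff2_outer (A \<union> B)"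
proof -
  let ?h = hausdorff2_pre and ?H = hausdorff2_outer
  let ?c = "\<lambda>D::(real^3) set. ennreal (pi * (diameter D / 2)\<^sup>2)"
  have main: "?h d A + ?h d B \<le> ?h d (A \<union> B)" if d: "0 < d" "d < \<delta>" for d
    unfolding hausdorff2_pre_def[of d "A \<union> B"]
  proof (intro INF_greatest, safe)
    fix C :: "nat \<Rightarrow> (real^3) set"
    assume C: "A \<union> B \<subseteq> (\<Union>j. C j)" "\<forall>j. bounded (C j) \<and> diameter (C j) \<le> d"
    \<comment> \<open>Sets missing \<open>S\<close> are replaced by the empty set, which has
      diameter 0 and costs nothing, so the index set remains the naturals.\<close>
    let ?P = "\<lambda>S j. if C j \<inter> S \<noteq> {} then C j else {}"
    have "?h d A \<le> (\<Sum>j. ?c (?P A j))" "?h d B \<le> (\<Sum>j. ?c (?P B j))"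
      using C d by (intro hausdorff2_pre_le; fastforce split: if_splits)+
    then have "?h d A + ?h d B \<le> (\<Sum>j. ?c (?P A j) + ?c (?P B j))"
      by (subst suminf_add[symmetric]) (auto intro: add_mono)
    also have "\<dots> \<le> (\<Sum>j. ?c (C j))"
    proof (intro suminf_le)
      fix j
      have "C j \<inter> A = {} \<or> C j \<inter> B = {}"
      proof (rule ccontr)
        assume "\<not> ?thesis"
        then obtain x y where xy: "x \<in> C j" "x \<in> A" "y \<in> C j" "y \<in> B" by auto
        then have "dist x y \<le> diameter (C j)" using C(2) by (auto intro: diameter_bounded_bound)
        then show False using sep[of x y] xy C(2) d by (smt (verit))
      qed
      then show "?c (?P A j) + ?c (?P B j) \<le> ?c (C j)" by auto
    qed auto
    finally show "?h d A + ?h d B \<le> (\<Sum>j. ?c (C j))" .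
  qed
  have "?H A + ?H B = (SUP d\<in>{0<..}. ?h d A + ?h d B)"
    unfolding hausdorff2_outer_def
  proof (intro SUP_add_directed_ennreal[symmetric])
    fix i j :: real assume "i \<in> {0<..}" "j \<in> {0<..}"
    then show "\<exists>k\<in>{0<..}. ?h i A + ?h j B \<le> ?h k A + ?h k B"
      by (intro bexI[of _ "min i j"] add_mono hausdorff2_pre_antimono) auto
  qed
  also have "\<dots> \<le> ?H (A \<union> B)"
  proof (intro SUP_least)
    fix d :: real assume "d \<in> {0<..}"
    define k where "k = min d (\<delta>/2)"
    have k: "0 < k" "k < \<delta>" "k \<le> d" using \<delta> \<open>d \<in> _\<close> by (auto simp: k_def)
    then have "?h d A + ?h d B \<le> ?h k A + ?h k B"
      by (intro add_mono hausdorff2_pre_antimono)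
    also have "\<dots> \<le> ?h k (A \<union> B)" by (rule main[OF k(1,2)])
    also have "\<dots> \<le> ?H (A \<union> B)" by (rule hausdorff2_pre_le_outer[OF k(1)])
    finally show "?h d A + ?h d B \<le> ?H (A \<union> B)" .
  qed
  finally show ?thesis .
qed

lemma suminf_ennreal_tail_tendsto_0:
  fixes f :: "nat \<Rightarrow> ennreal"
  assumes "(\<Sum>i. f i) < top"
  shows "(\<lambda>n. \<Sum>i. f (i + n)) \<longlonglongrightarrow> 0"
proof -
  have fin: "f i < top" for i using assms by (metis ennreal_suminf_lessD)
  define r where "r i = enn2real (f i)" for i
  have f: "f i = ennreal (r i)" for i using fin[of i] by (simp add: r_def)
  have sm: "summable r"
    using assms unfolding f by (intro summable_suminf_not_top) (auto simp: r_def)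
  have eq: "(\<Sum>i. f (i + n)) = ennreal (\<Sum>i. r (i + n))" for n
    unfolding f using summable_sums[OF summable_ignore_initial_segment[OF sm, of n]]
    by (intro suminf_ennreal_eq) (auto simp: r_def)
  have "(\<lambda>n. \<Sum>i. r (i + n)) \<longlonglongrightarrow> 0"
    unfolding LIMSEQ_iff using suminf_exist_split[OF _ sm] by simp
  then have "(\<lambda>n. ennreal (\<Sum>i. r (i + n))) \<longlonglongrightarrow> ennreal 0"
    by (rule tendsto_ennrealI)
  then show ?thesis by (simp add: eq)
qed

text \<open>The second assumption gives one positive distance from \<open>R k\<close> to all later
  sets simultaneously, hence to their union. Additivity on separated sets can then be iterated from
  the top index downwards, adding one set below the existing union each time.\<close>

lemma hausdorff2_outer_sum_separated_le:
  fixes N :: nat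
  assumes "\<And>k. R k \<subseteq> A"
    and "\<And>k l. k < l \<Longrightarrow> \<exists>\<delta>>0. \<forall>x y m. m \<ge> l \<longrightarrow> x \<in> R k \<longrightarrow> y \<in> R m \<longrightarrow> \<delta> \<le> dist x y"
  shows "(\<Sum>k<N. hausdorff2_outer (R k)) \<le> hausdorff2_outer A"
proof -
  let ?H = hausdorff2_outer
  have "(\<Sum>k\<in>{N-m..<N}. ?H (R k)) \<le> ?H (\<Union>k\<in>{N-m..<N}. R k)" for m
  proof (induction m)
    case (Suc m)
    show ?case
    proof (cases "m < N")
      case True
      define k where "k = N - Suc m"
      have k: "{N - Suc m..<N} = insert k {N-m..<N}" "k \<notin> {N-m..<N}" "N - m = Suc k"
        using True by (auto simp: k_def)
      obtain \<delta> where \<delta>: "\<delta> > 0" "\<And>x y m. m \<ge> Suc k \<Longrightarrow> x \<in> R k \<Longrightarrow> y \<in> R m \<Longrightarrow> \<delta> \<le> dist x y"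
        using assms(2)[of k "Suc k"] by blast
      have "(\<Sum>k\<in>{N - Suc m..<N}. ?H (R k)) =
          ?H (R k) + (\<Sum>k\<in>{N-m..<N}. ?H (R k))"
        using k by simp
      also have "\<dots> \<le> ?H (R k) + ?H (\<Union>k\<in>{N-m..<N}. R k)"
        by (intro add_left_mono Suc.IH)
      also have "\<dots> \<le> ?H (R k \<union> (\<Union>k\<in>{N-m..<N}. R k))"
        using \<delta> k(3) by (intro hausdorff2_outer_add_separated[OF \<delta>(1)]) auto
      finally show ?thesis using k by simp
    qed (use Suc in simp)
  qed simp
  from this[of N] have "(\<Sum>k<N. ?H (R k)) \<le> ?H (\<Union>k\<in>{0..<N}. R k)"
    by (simp add: lessThan_atLeast0)
  also have "\<dots> \<le> ?H A" using assms(1) by (intro hausdorff2_outer_mono) auto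
  finally show ?thesis .
qed

lemma closed_in_lambda_system_hausdorff2:
  fixes C :: "(real^3) set"
  assumes C: "closed C"
  shows "C \<in> lambda_system UNIV (Pow UNIV) hausdorff2_outer"
proof -
  let ?H = hausdorff2_outer
  have "?H (C \<inter> A) + ?H ((UNIV - C) \<inter> A) \<le> ?H A" for A
  proof (cases "C = {} \<or> ?H A = top")
    case False
    then have Cne: "C \<noteq> {}" and fin: "?H A < top" by (auto simp: less_top)
    define \<rho> where "\<rho> x = infdist x C" for x
    have \<rho>_pos: "\<rho> x > 0 \<longleftrightarrow> x \<notin> C" for x
      using C Cne by (simp add: \<rho>_def infdist_pos_not_in_closed in_closed_iff_infdist_zero
          order_less_le infdist_nonneg)
    have \<rho>_lip: "\<rho> x \<le> \<rho> y + dist x y" for x y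
      unfolding \<rho>_def by (rule infdist_triangle)
    define a where "a n = {x\<in>A. 1 / real (n + 1) \<le> \<rho> x}" for n
    define R where "R k = {x\<in>A. 1 / real (k + 2) \<le> \<rho> x \<and> \<rho> x < 1 / real (k + 1)}" for k
    \<comment> \<open>Adjacent shells may touch, but with an index gap of 2 the distances to
      \<open>C\<close> differ by at least 1/(k+2) - 1/(k+3). This is why the even and the odd shells
      are summed separately, each family contributing at most \<open>?H A\<close>.\<close>
    have sep: "\<exists>\<delta>>0. \<forall>x y m. m \<ge> l \<longrightarrow> x \<in> R k \<longrightarrow> y \<in> R m \<longrightarrow> \<delta> \<le> dist x y" if "k + 2 \<le> l" for k l
    proof (intro exI[of _ "1 / real (k + 2) - 1 / real (k + 3)"] conjI allI impI)
      fix x y m assume *: "m \<ge> l" "x \<in> R k" "y \<in> R m"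
      have "\<rho> y < 1 / real (m + 1)" "1 / real (k + 2) \<le> \<rho> x" using * by (auto simp: R_def)
      moreover have "1 / real (m + 1) \<le> 1 / real (k + 3)"
        using * that by (intro divide_left_mono) auto
      ultimately show "1 / real (k + 2) - 1 / real (k + 3) \<le> dist x y"
        using \<rho>_lip[of x y] by linarith
    qed (simp add: divide_strict_left_mono)
    have R_sub: "R k \<subseteq> A" for k by (auto simp: R_def)
    have even: "(\<Sum>k<N. ?H (R (2 * k))) \<le> ?H A" for N
    proof (rule hausdorff2_outer_sum_separated_le[OF R_sub])
      fix k l :: nat assume "k < l"
      then have "2 * k + 2 \<le> 2 * l" by simp
      from sep[OF this] show "\<exists>\<delta>>0. \<forall>x y m. m \<ge> l \<longrightarrow> x \<in> R (2 * k) \<longrightarrow> y \<in> R (2 * m) \<longrightarrow> \<delta> \<le> dist x y"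
        by (meson mult_le_mono2)
    qed
    have odd: "(\<Sum>k<N. ?H (R (2 * k + 1))) \<le> ?H A" for N
    proof (rule hausdorff2_outer_sum_separated_le[OF R_sub])
      fix k l :: nat assume "k < l"
      then have "2 * k + 1 + 2 \<le> 2 * l + 1" by simp
      from sep[OF this] show "\<exists>\<delta>>0. \<forall>x y m. m \<ge> l \<longrightarrow> x \<in> R (2 * k + 1) \<longrightarrow> y \<in> R (2 * m + 1) \<longrightarrow> \<delta> \<le> dist x y"
        by (meson add_le_mono1 mult_le_mono2)
    qed
    have "(\<Sum>k<2 * N. f k) = (\<Sum>k<N. f (2 * k)) + (\<Sum>k<N. f (2 * k + 1))" for N and f :: "nat \<Rightarrow> ennreal"
      by (induction N) (auto simp: algebra_simps)
    then have "(\<Sum>k<2 * N. ?H (R k)) \<le> ?H A + ?H A" for N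
      using even[of N] odd[of N] by (simp add: add_mono)
    moreover have "(\<Sum>k<N. ?H (R k)) \<le> (\<Sum>k<2 * N. ?H (R k))" for N
      by (intro sum_mono2) auto
    ultimately have "(\<Sum>k. ?H (R k)) \<le> ?H A + ?H A"
      unfolding suminf_eq_SUP by (intro SUP_least) (meson order_trans)
    also have "\<dots> < top" using fin by simp
    finally have tail: "(\<lambda>n. \<Sum>k. ?H (R (k + n))) \<longlonglongrightarrow> 0"
      by (rule suminf_ennreal_tail_tendsto_0)
    have bound: "?H (C \<inter> A) + ?H ((UNIV - C) \<inter> A)
        \<le> ?H A + (\<Sum>k. ?H (R (k + n)))" for n
    proof -
      have "(UNIV - C) \<inter> A \<subseteq> a n \<union> (\<Union>k. R (k + n))"
      proof
        fix x assume x: "x \<in> (UNIV - C) \<inter> A"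
        then have pos: "\<rho> x > 0" using \<rho>_pos by auto
        show "x \<in> a n \<union> (\<Union>k. R (k + n))"
        proof (cases "1 / real (n + 1) \<le> \<rho> x")
          case False
          \<comment> \<open>For the least such \<open>j\<close> the point lies in shell
            \<open>j - 1\<close>; since the threshold fails at \<open>n\<close>, \<open>j\<close>
            exceeds \<open>n\<close> and the shell belongs to the tail.\<close>
          define j where "j = (LEAST j. 1 / real (j + 1) \<le> \<rho> x)"
          obtain i where "1 / real (Suc i) < \<rho> x" using pos nat_approx_posE by blast
          then have "1 / real (i + 1) \<le> \<rho> x" by simp
          then have j: "1 / real (j + 1) \<le> \<rho> x"
            unfolding j_def by (rule LeastI)
          have jn: "n < j"
          proof (rule ccontr)
            assume "\<not> n < j"
            then have "1 / real (n + 1) \<le> 1 / real (j + 1)" by (intro divide_left_mono) auto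
            then show False using j False by simp
          qed
          then have "\<not> 1 / real ((j - 1) + 1) \<le> \<rho> x"
            using not_less_Least[of "j - 1" "\<lambda>j. 1 / real (j + 1) \<le> \<rho> x"] unfolding j_def[symmetric] by simp
          then have "x \<in> R ((j - 1 - n) + n)"
            using x j jn by (auto simp: R_def of_nat_diff)
          then show ?thesis by blast
        qed (use x in \<open>auto simp: a_def\<close>)
      qed
      then have "?H ((UNIV - C) \<inter> A) \<le> ?H (a n \<union> (\<Union>k. R (k + n)))"
        by (rule hausdorff2_outer_mono)
      also have "\<dots> \<le> ?H (a n) + ?H (\<Union>k. R (k + n))"
        by (rule hausdorff2_outer_Un_le)
      also have "\<dots> \<le> ?H (a n) + (\<Sum>k. ?H (R (k + n)))"
        by (intro add_left_mono hausdorff2_outer_UN_le)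
      finally have "?H (C \<inter> A) + ?H ((UNIV - C) \<inter> A) \<le>
         (?H (C \<inter> A) + ?H (a n)) + (\<Sum>k. ?H (R (k + n)))"
        by (simp add: add.assoc add_left_mono)
      also have "?H (C \<inter> A) + ?H (a n) \<le> ?H (C \<inter> A \<union> a n)"
      proof (rule hausdorff2_outer_add_separated)
        fix x y assume "x \<in> C \<inter> A" "y \<in> a n"
        then have "\<rho> x = 0" "1 / real (n + 1) \<le> \<rho> y"
          by (auto simp: \<rho>_def a_def)
        then show "1 / real (n + 1) \<le> dist x y"
          using \<rho>_lip[of y x] by (simp add: dist_commute)
      qed simp
      also have "\<dots> \<le> ?H A"
        by (rule hausdorff2_outer_mono) (auto simp: a_def)
      finally show ?thesis by (simp add: add_right_mono)
    qed
    have "(\<lambda>n. ?H A + (\<Sum>k. ?H (R (k + n)))) \<longlonglongrightarrow> ?H A + 0"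
      by (intro tendsto_intros tail)
    then show ?thesis using bound by (intro LIMSEQ_le_const[of _ "?H A"]) auto
  qed auto
  moreover have "?H A \<le> ?H (C \<inter> A) + ?H ((UNIV - C) \<inter> A)" for A
    using hausdorff2_outer_Un_le[of "C \<inter> A" "(UNIV - C) \<inter> A"]
    by (simp add: Int_commute Un_Diff_Int Int_Un_distrib[symmetric])
  ultimately show ?thesis
    unfolding lambda_system_def by (auto intro: antisym)
qed

lemma sets_hausdorff2 [simp, measurable_cong]: "sets hausdorff2 = sets borel"
  using sets.sigma_sets_eq[of "borel :: (real^3) measure"] by (simp add: hausdorff2_def)

lemma space_hausdorff2 [simp]: "space hausdorff2 = UNIV"
  by (simp add: hausdorff2_def)

text \<open>\<open>measure_of\<close> returns the given set function only when that is countably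
  additive on the generated sigma-algebra, and 0 otherwise. Closed sets generate the Borel sets and
  are Caratheodory measurable, which supplies this condition.\<close>

lemma emeasure_hausdorff2:
  assumes "A \<in> sets borel"
  shows "emeasure hausdorff2 A = hausdorff2_outer A"
proof -
  interpret P: sigma_algebra UNIV "Pow UNIV :: (real^3) set set" by (rule sigma_algebra_Pow)
  let ?L = "lambda_system UNIV (Pow UNIV) hausdorff2_outer"
  have ms: "measure_space UNIV ?L hausdorff2_outer"
    by (rule P.caratheodory_lemma[OF outer_measure_space_hausdorff2])
  then have sa: "sigma_algebra UNIV ?L" by (simp add: measure_space_def)
  have "sets (borel :: (real^3) measure) = sigma_sets UNIV (Collect closed)"
    by (simp add: borel_eq_closed)
  also have "\<dots> \<subseteq> ?L"
    using closed_in_lambda_system_hausdorff2 by (intro sigma_algebra.sigma_sets_subset[OF sa]) auto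
  finally have "measure_space UNIV (sets borel) hausdorff2_outer"
    using sets.sigma_algebra_axioms[of "borel :: (real^3) measure"]
    by (intro measure_down[OF ms]) auto
  then show ?thesis
    using assms unfolding hausdorff2_def measure_space_def
    by (intro emeasure_measure_of_sigma) auto
qed

section \<open>Efficient covers by balls centred on the set\<close>

lemma hausdorff2_cover_balls:
  fixes E :: "(real^3) set" and d e :: real
  assumes E: "E \<noteq> {}" "hausdorff2_outer E < top" and d: "d > 0" and e: "e > 0"
  obtains x r where "E \<subseteq> (\<Union>j::nat. ball (x j) (r j))" "\<And>j. x j \<in> E" "\<And>j. 0 < r j" "\<And>j. r j \<le> d"
    "(\<Sum>j. ennreal ((r j)\<^sup>2)) \<le> 4 * hausdorff2_outer E + ennreal e"
proof -
  let ?H = hausdorff2_outer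
  let ?c = "\<lambda>D::(real^3) set. ennreal (pi * (diameter D / 2)\<^sup>2)"
  have "hausdorff2_pre (d/2) E \<le> ?H E"
    using d by (intro hausdorff2_pre_le_outer) auto
  also have "\<dots> < ?H E + ennreal (e / 8)"
    using E(2) e by (simp add: less_top)
  finally obtain C where C: "E \<subseteq> (\<Union>j::nat. C j)" "\<And>j. bounded (C j)" "\<And>j. diameter (C j) \<le> d/2"
    "(\<Sum>j. ?c (C j)) < ?H E + ennreal (e / 8)"
    by (rule hausdorff2_pre_lessE) blast
  obtain x0 where x0: "x0 \<in> E" using E(1) by blast
  \<comment> \<open>A strictly positive enlargement, needed because covering sets may have diameter
    0 while the balls are open. The squares sum to at most \<open>e / 4\<close>, hence contribute at
    most \<open>e / 2\<close> after doubling; the other half comes from 4 times the excess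
    \<open>e / 8\<close> of the cover.\<close>
  define \<epsilon> where "\<epsilon> j = min (d/2) (sqrt (e / 4 * (1/2) ^ Suc j))" for j :: nat
  have \<epsilon>: "\<epsilon> j > 0" "\<epsilon> j \<le> d/2" for j
    using d e by (auto simp: \<epsilon>_def)
  have \<epsilon>2: "(\<epsilon> j)\<^sup>2 \<le> e / 4 * (1/2) ^ Suc j" for j
  proof -
    have "(\<epsilon> j)\<^sup>2 \<le> (sqrt (e / 4 * (1/2) ^ Suc j))\<^sup>2"
      using \<epsilon>(1)[of j] by (intro power_mono) (auto simp: \<epsilon>_def)
    then show ?thesis using e by simp
  qed
  \<comment> \<open>Covering sets that miss \<open>E\<close> receive the dummy centre
    \<open>x0\<close>, so that all centres lie in \<open>E\<close>.\<close>
  define x where "x j = (if C j \<inter> E = {} then x0 else (SOME y. y \<in> C j \<inter> E))" for j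
  define r where "r j = diameter (C j) + \<epsilon> j" for j
  have xin: "x j \<in> C j \<inter> E" if "C j \<inter> E \<noteq> {}" for j
    using that unfolding x_def by (metis some_in_eq)
  have diam: "diameter (C j) \<ge> 0" for j by (rule diameter_ge_0[OF C(2)])
  show ?thesis
  proof (rule that[of x r])
    show "E \<subseteq> (\<Union>j. ball (x j) (r j))"
    proof
      fix y assume y: "y \<in> E"
      then obtain j where j: "y \<in> C j" using C(1) by blast
      then have "x j \<in> C j" using xin y by blast
      then have "dist (x j) y \<le> diameter (C j)" using j C(2) by (intro diameter_bounded_bound) auto
      then show "y \<in> (\<Union>j. ball (x j) (r j))" using \<epsilon>(1)[of j] by (auto simp: r_def intro!: exI[of _ j])
    qed
    show "x j \<in> E" for j using xin x0 by (cases "C j \<inter> E = {}") (auto simp: x_def)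
    show "0 < r j" for j using diam \<epsilon>(1) by (simp add: r_def add_nonneg_pos)
    show "r j \<le> d" for j using C(3)[of j] \<epsilon>(2)[of j] by (simp add: r_def)
    have tm: "ennreal ((r j)\<^sup>2) \<le> 4 * ?c (C j) + ennreal (e / 2 * (1/2) ^ Suc j)" for j
    proof -
      have "(r j)\<^sup>2 \<le> 2 * (diameter (C j))\<^sup>2 + 2 * (\<epsilon> j)\<^sup>2"
        unfolding r_def using sum_squares_bound[of "diameter (C j)" "\<epsilon> j"] by (simp add: power2_sum)
      \<comment> \<open>Here 2 \<le> pi absorbs the factor 2 from squaring the sum; rewriting the
        disc area in terms of the diameter then produces the factor 4 of the conclusion.\<close>
      also have "2 * (diameter (C j))\<^sup>2 \<le> pi * (diameter (C j))\<^sup>2"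
        using pi_ge_two by (intro mult_right_mono) auto
      also have "pi * (diameter (C j))\<^sup>2 = 4 * (pi * (diameter (C j) / 2)\<^sup>2)"
        by (simp add: power_divide)
      finally have "(r j)\<^sup>2 \<le> 4 * (pi * (diameter (C j) / 2)\<^sup>2) + e / 2 * (1/2) ^ Suc j"
        using \<epsilon>2[of j] by simp
      then have "ennreal ((r j)\<^sup>2) \<le> ennreal (4 * (pi * (diameter (C j) / 2)\<^sup>2) + e / 2 * (1/2) ^ Suc j)"
        by (rule ennreal_leI)
      also have "\<dots> = ennreal (4 * (pi * (diameter (C j) / 2)\<^sup>2)) + ennreal (e / 2 * (1/2) ^ Suc j)"
        using e by (intro ennreal_plus) auto
      also have "ennreal (4 * (pi * (diameter (C j) / 2)\<^sup>2)) = 4 * ?c (C j)"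
        by (subst ennreal_mult) auto
      finally show ?thesis .
    qed
    have "(\<Sum>j. ennreal ((r j)\<^sup>2)) \<le> (\<Sum>j. 4 * ?c (C j) + ennreal (e / 2 * (1/2) ^ Suc j))"
      by (intro suminf_le tm) auto
    also have "\<dots> = (\<Sum>j. 4 * ?c (C j)) + (\<Sum>j. ennreal (e / 2 * (1/2) ^ Suc j))"
      by (intro suminf_add[symmetric]) auto
    also have "(\<Sum>j. 4 * ?c (C j)) = 4 * (\<Sum>j. ?c (C j))" by (rule ennreal_suminf_cmult)
    also have "(\<Sum>j. ennreal (e / 2 * (1/2) ^ Suc j)) = ennreal (e / 2 * 1)"
      using e by (intro suminf_ennreal_eq sums_mult power_half_series) auto
    also have "4 * (\<Sum>j. ?c (C j)) + ennreal (e / 2 * 1) \<le> 4 * (?H E + ennreal (e / 8)) + ennreal (e / 2 * 1)"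
      by (intro add_right_mono mult_left_mono less_imp_le[OF C(4)]) simp
    also have "\<dots> = 4 * ?H E + (4 * ennreal (e / 8) + ennreal (e / 2))"
      by (simp only: distrib_left add.assoc mult_1_right)
    also have "4 * ennreal (e / 8) = ennreal (4 * (e / 8))"
      by (subst ennreal_mult) (use e in auto)
    also have "ennreal (4 * (e / 8)) + ennreal (e / 2) = ennreal (4 * (e / 8) + e / 2)"
      using e by (intro ennreal_plus[symmetric]) auto
    also have "4 * (e / 8) + e / 2 = e" by simp
    finally show "(\<Sum>j. ennreal ((r j)\<^sup>2)) \<le> 4 * ?H E + ennreal e" .
  qed
qed

text \<open>A cover that is efficient for area says nothing about the values of \<open>f\<close> at
  the centres. Therefore \<open>K\<close> is cut into slices on which \<open>f\<close> varies by
  less than \<delta>, and each slice is covered separately by balls centred in it. The resulting sum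
  is comparable with a lower simple function of \<open>f\<close>. Compactness makes the family
  finite; its indices are pairs (slice, ball).\<close>

lemma hausdorff2_weighted_ball_cover:
  fixes K :: "(real^3) set" and f :: "real^3 \<Rightarrow> real" and d e :: real
  assumes K: "compact K" "hausdorff2_outer K < top"
    and f: "continuous_on UNIV f" "\<And>x. f x \<ge> 0" and d: "d > 0" and e: "e > 0"
  obtains I :: "(nat \<times> nat) set" and x r where "finite I"
    "\<And>i. i \<in> I \<Longrightarrow> x i \<in> K" "\<And>i. i \<in> I \<Longrightarrow> 0 < r i" "\<And>i. i \<in> I \<Longrightarrow> r i \<le> d"
    "K \<subseteq> (\<Union>i\<in>I. ball (x i) (r i))"
    "ennreal (\<Sum>i\<in>I. f (x i) * (r i)\<^sup>2) \<le> 4 * (\<integral>\<^sup>+x\<in>K. ennreal (f x) \<partial>hausdorff2) + ennreal e"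
    "ennreal (\<Sum>i\<in>I. (r i)\<^sup>2) \<le> 4 * hausdorff2_outer K + 1"
proof -
  let ?H = hausdorff2_outer
  have [measurable]: "f \<in> borel_measurable borel" using f(1) by (rule borel_measurable_continuous_onI)
  have [measurable]: "K \<in> sets borel" using K(1) by (intro borel_closed compact_imp_closed)
  define HK where "HK = enn2real (?H K)"
  have HK: "?H K = ennreal HK" "HK \<ge> 0" using K(2) by (auto simp: HK_def less_top)
  \<comment> \<open>Chosen so that the oscillation on slices costs at most \<open>e / 2\<close>,
    namely 4\<delta> times the area of \<open>K\<close>; the summand 1 avoids division by
    zero.\<close>
  define \<delta> where "\<delta> = e / (8 * (HK + 1))"
  have \<delta>: "\<delta> > 0" using e HK by (simp add: \<delta>_def)
  have \<delta>HK: "4 * (\<delta> * HK) \<le> e / 2"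
  proof -
    have "4 * (\<delta> * HK) = (e / 2) * (HK / (HK + 1))" using HK by (simp add: \<delta>_def field_simps)
    also have "\<dots> \<le> e / 2" using HK e by (intro mult_left_le) (auto simp: divide_le_eq)
    finally show ?thesis .
  qed
  have "bounded (f ` K)"
    using K(1) f(1) by (intro compact_imp_bounded compact_continuous_image) (auto intro: continuous_on_subset)
  then obtain B where B: "\<And>x. x \<in> K \<Longrightarrow> f x \<le> B" by (auto simp: bounded_iff abs_le_iff)
  obtain N :: nat where N: "B < real N * \<delta>" using \<delta> reals_Archimedean3 by (metis)
  define E where "E m = {x\<in>K. real m * \<delta> \<le> f x \<and> f x < real (Suc m) * \<delta>}" for m :: nat
  have Em [measurable]: "E m \<in> sets borel" for m unfolding E_def by measurable
  have E_sub: "E m \<subseteq> K" for m by (auto simp: E_def)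
  have E_fin: "?H (E m) < top" for m
    using hausdorff2_outer_mono[OF E_sub] K(2) by (rule order_le_less_trans)
  have E_disj: "disjoint_family_on E A" for A
  proof -
    have "m = n" if "x \<in> E m" "x \<in> E n" for x m n
    proof -
      have "real m * \<delta> < real (Suc n) * \<delta>" "real n * \<delta> < real (Suc m) * \<delta>"
        using that unfolding E_def by auto
      then have "real m < real (Suc n)" "real n < real (Suc m)" using \<delta> by (auto simp: mult_less_cancel_right)
      then show ?thesis by simp
    qed
    then show ?thesis by (auto simp: disjoint_family_on_def)
  qed
  have E_cover: "K \<subseteq> (\<Union>m<N. E m)"
  proof
    fix x assume x: "x \<in> K"
    define m where "m = nat \<lfloor>f x / \<delta>\<rfloor>"
    have rm: "real m = of_int \<lfloor>f x / \<delta>\<rfloor>" using f(2)[of x] \<delta> by (simp add: m_def)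
    have "real m \<le> f x / \<delta>" "f x / \<delta> < real m + 1" unfolding rm by linarith+
    then have m: "real m * \<delta> \<le> f x" "f x < real (Suc m) * \<delta>" using \<delta> by (auto simp: field_simps)
    have "real m * \<delta> < real N * \<delta>" using m(1) B[OF x] N by linarith
    then have "m < N" using \<delta> by (simp add: mult_less_cancel_right)
    then show "x \<in> (\<Union>m<N. E m)" using m x by (auto simp: E_def)
  qed
  \<comment> \<open>The two entries serve the two conclusions: at most \<open>N\<close> slices with
    excess \<epsilon> add at most 1 to the sum of squared radii, and with weights up to (N +
    1)\<delta> they add at most \<open>e / 2\<close> to the weighted sum.\<close>
  define \<epsilon> where "\<epsilon> = min (1 / (real N + 1)) (e / (2 * (real N + 1)\<^sup>2 * \<delta>))"
  have \<epsilon>: "\<epsilon> > 0" using e \<delta> by (simp add: \<epsilon>_def)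
  define good where "good m p \<longleftrightarrow> E m \<subseteq> (\<Union>j::nat. ball (fst p j) (snd p j)) \<and>
    (\<forall>j. fst p j \<in> E m \<and> 0 < snd p j \<and> snd p j \<le> d) \<and>
    (\<Sum>j. ennreal ((snd p j)\<^sup>2)) \<le> 4 * ?H (E m) + ennreal \<epsilon>" for m p
  have "\<forall>m\<in>{m. E m \<noteq> {}}. \<exists>p. good m p"
  proof
    fix m assume "m \<in> {m. E m \<noteq> {}}"
    then have "E m \<noteq> {}" by simp
    from this E_fin d \<epsilon> obtain x r where "E m \<subseteq> (\<Union>j::nat. ball (x j) (r j))" "\<And>j. x j \<in> E m" "\<And>j. 0 < r j" "\<And>j. r j \<le> d"
      "(\<Sum>j. ennreal ((r j)\<^sup>2)) \<le> 4 * ?H (E m) + ennreal \<epsilon>"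
      by (rule hausdorff2_cover_balls) (rule that)
    then have "good m (x, r)" by (simp add: good_def)
    then show "\<exists>p. good m p" ..
  qed
  from bchoice[OF this] obtain p where p: "\<And>m. E m \<noteq> {} \<Longrightarrow> good m (p m)" by auto
  define x r where "x m = fst (p m)" and "r m = snd (p m)" for m
  have xr: "\<And>m. E m \<noteq> {} \<Longrightarrow> E m \<subseteq> (\<Union>j::nat. ball (x m j) (r m j))"
    "\<And>m j. E m \<noteq> {} \<Longrightarrow> x m j \<in> E m" "\<And>m j. E m \<noteq> {} \<Longrightarrow> 0 < r m j"
    "\<And>m j. E m \<noteq> {} \<Longrightarrow> r m j \<le> d"
    "\<And>m. E m \<noteq> {} \<Longrightarrow> (\<Sum>j. ennreal ((r m j)\<^sup>2)) \<le> 4 * ?H (E m) + ennreal \<epsilon>"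
    using p unfolding good_def x_def r_def by blast+
  define M where "M = {m\<in>{..<N}. E m \<noteq> {}}"
  have finM: "finite M" "card M \<le> N" "M \<subseteq> {..<N}"
    using card_mono[of "{..<N}" M] by (auto simp: M_def)
  have "K \<subseteq> (\<Union>i\<in>M \<times> UNIV. ball (case_prod x i) (case_prod r i))"
  proof
    fix y assume "y \<in> K"
    then obtain m where m: "m < N" "y \<in> E m" using E_cover by blast
    then obtain j where "y \<in> ball (x m j) (r m j)" using xr(1)[of m] by blast
    then show "y \<in> (\<Union>i\<in>M \<times> UNIV. ball (case_prod x i) (case_prod r i))"
      using m by (intro UN_I[of "(m, j)"]) (auto simp: M_def)
  qed
  then obtain I where I: "I \<subseteq> M \<times> UNIV" "finite I" "K \<subseteq> (\<Union>i\<in>I. ball (case_prod x i) (case_prod r i))"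
    using compactE_image[OF K(1), of "M \<times> UNIV" "\<lambda>i. ball (case_prod x i) (case_prod r i)"] by auto
  have IM: "E (fst i) \<noteq> {}" if "i \<in> I" for i using that I(1) by (auto simp: M_def)
  obtain n where n: "I \<subseteq> M \<times> {..<n}"
  proof -
    obtain n where "\<forall>j\<in>snd ` I. j < n" using I(2) finite_nat_set_iff_bounded by blast
    then show ?thesis using I(1) that[of n] by fastforce
  qed
  have sum_le: "(\<Sum>i\<in>I. g (fst i) (snd i)) \<le> (\<Sum>m\<in>M. \<Sum>j. g m j)" for g :: "nat \<Rightarrow> nat \<Rightarrow> ennreal"
  proof -
    have "(\<Sum>i\<in>I. g (fst i) (snd i)) \<le> (\<Sum>i\<in>M \<times> {..<n}. g (fst i) (snd i))"
      using n finM by (intro sum_mono2) auto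
    also have "\<dots> = (\<Sum>m\<in>M. \<Sum>j<n. g m j)" by (simp add: sum.cartesian_product split_def)
    also have "\<dots> \<le> (\<Sum>m\<in>M. \<Sum>j. g m j)" by (intro sum_mono sum_le_suminf) auto
    finally show ?thesis .
  qed
  have HE: "(\<Sum>m\<in>M. ?H (E m)) \<le> ?H K"
  proof -
    have "(\<Sum>m\<in>M. emeasure hausdorff2 (E m)) = emeasure hausdorff2 (\<Union>m\<in>M. E m)"
      using E_disj finM by (intro sum_emeasure) auto
    also have "\<dots> \<le> emeasure hausdorff2 K" using E_sub by (intro emeasure_mono) auto
    finally show ?thesis by (simp add: emeasure_hausdorff2)
  qed
  \<comment> \<open>The slices are disjoint and \<open>f\<close> is at least
    \<open>m * \<delta>\<close> on slice \<open>m\<close>, so this is the integral of a simple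
    function below \<open>f\<close>.\<close>
  have fE: "(\<Sum>m\<in>M. ennreal (real m * \<delta>) * ?H (E m)) \<le> (\<integral>\<^sup>+x\<in>K. ennreal (f x) \<partial>hausdorff2)"
  proof -
    have "(\<Sum>m\<in>M. ennreal (real m * \<delta>) * ?H (E m))
        = (\<integral>\<^sup>+x. (\<Sum>m\<in>M. ennreal (real m * \<delta>) * indicator (E m) x) \<partial>hausdorff2)"
      by (subst nn_integral_sum) (auto simp: emeasure_hausdorff2 nn_integral_cmult)
    also have "\<dots> \<le> (\<integral>\<^sup>+x\<in>K. ennreal (f x) \<partial>hausdorff2)"
    proof (intro nn_integral_mono)
      fix y
      show "(\<Sum>m\<in>M. ennreal (real m * \<delta>) * indicator (E m) y) \<le> ennreal (f y) * indicator K y"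
      proof (cases "\<exists>m\<in>M. y \<in> E m")
        case True
        then obtain m where m: "m \<in> M" "y \<in> E m" by blast
        have "(\<Sum>k\<in>M. ennreal (real k * \<delta>) * indicator (E k) y) = (\<Sum>k\<in>{m}. ennreal (real k * \<delta>) * indicator (E k) y)"
          using m finM E_disj[of UNIV] by (intro sum.mono_neutral_right) (auto simp: disjoint_family_on_def indicator_def)
        moreover have "real m * \<delta> \<le> f y" "y \<in> K" using m by (auto simp: E_def)
        ultimately show ?thesis using m(2) by (simp add: ennreal_leI)
      next
        case False
        then have "(\<Sum>k\<in>M. ennreal (real k * \<delta>) * indicator (E k) y) = 0"
          by (intro sum.neutral) (auto simp: indicator_def)
        then show ?thesis by simp
      qed
    qed
    finally show ?thesis .
  qed
  show ?thesis
  proof (rule that[of I "case_prod x" "case_prod r"])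
    show "finite I" by (rule I)
    show "K \<subseteq> (\<Union>i\<in>I. ball (case_prod x i) (case_prod r i))" by (rule I)
    show "case_prod x i \<in> K" "0 < case_prod r i" "case_prod r i \<le> d" if "i \<in> I" for i
      using IM[OF that] xr(2-4)[of "fst i" "snd i"] E_sub by (auto simp: split_def)
    have "ennreal (\<Sum>i\<in>I. (case_prod r i)\<^sup>2) = (\<Sum>i\<in>I. ennreal ((r (fst i) (snd i))\<^sup>2))"
      by (simp add: split_def)
    also have "\<dots> \<le> (\<Sum>m\<in>M. \<Sum>j. ennreal ((r m j)\<^sup>2))"
      by (rule sum_le)
    also have "\<dots> \<le> (\<Sum>m\<in>M. 4 * ?H (E m) + ennreal \<epsilon>)"
      by (intro sum_mono xr) (auto simp: M_def)
    also have "\<dots> = 4 * (\<Sum>m\<in>M. ?H (E m)) + of_nat (card M) * ennreal \<epsilon>"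
      by (simp add: sum.distrib sum_distrib_left)
    also have "\<dots> \<le> 4 * ?H K + 1"
    proof (intro add_mono mult_left_mono HE)
      have "real (card M) * \<epsilon> \<le> (real N + 1) * (1 / (real N + 1))"
        using finM \<epsilon> by (intro mult_mono) (auto simp: \<epsilon>_def)
      then have "ennreal (real (card M) * \<epsilon>) \<le> 1" by simp
      then show "of_nat (card M) * ennreal \<epsilon> \<le> 1"
        by (simp add: ennreal_mult' ennreal_of_nat_eq_real_of_nat)
    qed auto
    finally show "ennreal (\<Sum>i\<in>I. (case_prod r i)\<^sup>2) \<le> 4 * ?H K + 1" .
    have "ennreal (\<Sum>i\<in>I. f (case_prod x i) * (case_prod r i)\<^sup>2)
        = (\<Sum>i\<in>I. ennreal (f (x (fst i) (snd i)) * (r (fst i) (snd i))\<^sup>2))"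
      using f(2) by (simp add: split_def)
    also have "\<dots> \<le> (\<Sum>m\<in>M. \<Sum>j. ennreal (f (x m j) * (r m j)\<^sup>2))"
      by (rule sum_le)
    also have "\<dots> \<le> (\<Sum>m\<in>M. 4 * (ennreal (real m * \<delta>) * ?H (E m))
        + (4 * ennreal \<delta> * ?H (E m) + ennreal ((real N + 1) * \<delta> * \<epsilon>)))"
    proof (intro sum_mono)
      fix m assume m: "m \<in> M"
      then have mE: "E m \<noteq> {}" "m < N" by (auto simp: M_def)
      have "(\<Sum>j. ennreal (f (x m j) * (r m j)\<^sup>2)) \<le> (\<Sum>j. ennreal (real (Suc m) * \<delta>) * ennreal ((r m j)\<^sup>2))"
      proof (intro suminf_le)
        fix j
        have "f (x m j) \<le> real (Suc m) * \<delta>" using xr(2)[OF mE(1), of j] by (auto simp: E_def)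
        then show "ennreal (f (x m j) * (r m j)\<^sup>2) \<le> ennreal (real (Suc m) * \<delta>) * ennreal ((r m j)\<^sup>2)"
          using \<delta> by (subst ennreal_mult[symmetric]) (auto intro!: ennreal_leI mult_right_mono)
      qed auto
      also have "\<dots> = ennreal (real (Suc m) * \<delta>) * (\<Sum>j. ennreal ((r m j)\<^sup>2))"
        by (rule ennreal_suminf_cmult)
      also have "\<dots> \<le> ennreal (real (Suc m) * \<delta>) * (4 * ?H (E m) + ennreal \<epsilon>)"
        by (intro mult_left_mono xr mE) auto
      also have "\<dots> = (ennreal (real m * \<delta>) + ennreal \<delta>) * (4 * ?H (E m)) + ennreal (real (Suc m) * \<delta> * \<epsilon>)"
      proof -
        have "ennreal (real (Suc m) * \<delta>) = ennreal (real m * \<delta>) + ennreal \<delta>"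
          using \<delta> by (subst ennreal_plus[symmetric]) (auto simp: algebra_simps)
        moreover have "ennreal (real (Suc m) * \<delta>) * ennreal \<epsilon> = ennreal (real (Suc m) * \<delta> * \<epsilon>)"
          using \<delta> \<epsilon> by (intro ennreal_mult[symmetric]) auto
        ultimately show ?thesis by (simp only: distrib_left)
      qed
      also have "\<dots> = 4 * (ennreal (real m * \<delta>) * ?H (E m))
          + (4 * ennreal \<delta> * ?H (E m) + ennreal (real (Suc m) * \<delta> * \<epsilon>))"
        by (simp add: distrib_right mult.assoc mult.left_commute add.assoc)
      also have "\<dots> \<le> 4 * (ennreal (real m * \<delta>) * ?H (E m))
          + (4 * ennreal \<delta> * ?H (E m) + ennreal ((real N + 1) * \<delta> * \<epsilon>))"
        using mE \<delta> \<epsilon> by (intro add_left_mono ennreal_leI mult_right_mono) auto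
      finally show "(\<Sum>j. ennreal (f (x m j) * (r m j)\<^sup>2)) \<le> \<dots>" .
    qed
    also have "\<dots> = 4 * (\<Sum>m\<in>M. ennreal (real m * \<delta>) * ?H (E m))
        + (4 * ennreal \<delta> * (\<Sum>m\<in>M. ?H (E m)) + of_nat (card M) * ennreal ((real N + 1) * \<delta> * \<epsilon>))"
      by (simp add: sum.distrib sum_distrib_left)
    also have "\<dots> \<le> 4 * (\<integral>\<^sup>+x\<in>K. ennreal (f x) \<partial>hausdorff2) + (ennreal (e / 2) + ennreal (e / 2))"
    proof (intro add_mono mult_left_mono fE)
      have "4 * ennreal \<delta> * (\<Sum>m\<in>M. ?H (E m)) \<le> 4 * ennreal \<delta> * ennreal HK"
        using HE by (intro mult_left_mono) (auto simp: HK)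
      also have "\<dots> = ennreal (4 * (\<delta> * HK))"
        using \<delta> HK by (simp add: ennreal_mult mult.assoc)
      also have "\<dots> \<le> ennreal (e / 2)" by (rule ennreal_leI[OF \<delta>HK])
      finally show "4 * ennreal \<delta> * (\<Sum>m\<in>M. ?H (E m)) \<le> ennreal (e / 2)" .
      have le: "real (card M) * ((real N + 1) * \<delta> * \<epsilon>) \<le> (real N + 1) * ((real N + 1) * \<delta> * (e / (2 * (real N + 1)\<^sup>2 * \<delta>)))"
        using finM \<delta> \<epsilon> by (intro mult_mono) (auto simp: \<epsilon>_def)
      have "a * (a * \<delta> * (e / (2 * a\<^sup>2 * \<delta>))) = e / 2" if "a > 0" for a :: real
        using \<delta> that by (simp add: power2_eq_square)
      from this[of "real N + 1"] have "(real N + 1) * ((real N + 1) * \<delta> * (e / (2 * (real N + 1)\<^sup>2 * \<delta>))) = e / 2"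
        by simp
      with le have "ennreal (real (card M) * ((real N + 1) * \<delta> * \<epsilon>)) \<le> ennreal (e / 2)"
        by (intro ennreal_leI) linarith
      then show "of_nat (card M) * ennreal ((real N + 1) * \<delta> * \<epsilon>) \<le> ennreal (e / 2)"
        using \<delta> \<epsilon> by (subst (asm) ennreal_mult) (auto simp: ennreal_of_nat_eq_real_of_nat)
    qed auto
    also have "ennreal (e / 2) + ennreal (e / 2) = ennreal e"
      using e by (simp flip: ennreal_plus)
    finally show "ennreal (\<Sum>i\<in>I. f (case_prod x i) * (case_prod r i)\<^sup>2) \<le>
        4 * (\<integral>\<^sup>+x\<in>K. ennreal (f x) \<partial>hausdorff2) + ennreal e" .
  qed
qed

subsection \<open>The boundary estimate\<close>

lemma measure_cball_double_le:
  fixes c :: "real^3"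
  assumes "r > 0"
  shows "measure lborel (cball c (2 * r)) \<le> 64 * r ^ 3"
proof -
  have "measure lborel (cball c (2 * r)) = 4 / 3 * pi * (2 * r) ^ 3"
    using assms by (simp add: content_cball unit_ball_vol_3)
  also have "\<dots> = (32 / 3 * pi) * r ^ 3" by (simp add: power_mult_distrib)
  also have "\<dots> \<le> 64 * r ^ 3"
    using pi_less_4 assms by (intro mult_right_mono) auto
  finally show ?thesis .
qed

text \<open>The product \<open>\<eta> * f\<close>, extended by zero outside \<Omega>, is
  differentiable everywhere because \<open>\<eta>\<close> vanishes on a neighbourhood of the
  boundary. No regularity of the boundary enters.\<close>

lemma set_integral_partial_derivative_cutoff:
  fixes \<Omega> :: "'a::euclidean_space set" and f \<eta> :: "'a \<Rightarrow> real"
  assumes \<Omega>: "open \<Omega>" "bounded \<Omega>"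
    and f: "\<And>x. (f has_derivative (\<lambda>v. g x \<bullet> v)) (at x)" "continuous_on UNIV g"
    and \<eta>: "\<And>x. (\<eta> has_derivative (\<lambda>v. D x \<bullet> v)) (at x)" "continuous_on UNIV D"
    and U: "open U" "frontier \<Omega> \<subseteq> U" "\<And>x. x \<in> U \<Longrightarrow> \<eta> x = 0"
  shows "(LINT x:\<Omega>|lborel. \<eta> x * (g x \<bullet> e) + f x * (D x \<bullet> e)) = 0"
proof -
  define k where "k x = (if x \<in> \<Omega> then \<eta> x * f x else 0)" for x
  define K where "K x v = (if x \<in> \<Omega> then \<eta> x * (g x \<bullet> v) + f x * (D x \<bullet> v) else 0)" for x v
  have cont: "continuous_on UNIV f" "continuous_on UNIV \<eta>"
    using f(1) \<eta>(1) by (meson continuous_at_imp_continuous_on has_derivative_continuous)+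
  have der: "(k has_derivative K x) (at x)" for x
  proof -
    consider "x \<in> \<Omega>" | "x \<in> U" "x \<notin> \<Omega>" | "x \<notin> closure \<Omega>"
      using U(2) \<Omega>(1) by (auto simp: frontier_def interior_open)
    then show ?thesis
    proof cases
      case 1
      have "((\<lambda>x. \<eta> x * f x) has_derivative K x) (at x)"
        by (rule has_derivative_eq_rhs[OF has_derivative_mult[OF \<eta>(1) f(1)]])
          (use 1 in \<open>auto simp: K_def fun_eq_iff\<close>)
      then show ?thesis
        by (rule has_derivative_transform_within_open[OF _ \<Omega>(1) 1]) (simp add: k_def)
    next
      case 2
      have "((\<lambda>x. 0) has_derivative K x) (at x)"
        using 2 by (simp add: K_def[abs_def])
      then show ?thesis
        by (rule has_derivative_transform_within_open[OF _ U(1) 2(1)]) (simp add: k_def U(3))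
    next
      case 3
      then have "x \<in> - closure \<Omega>" "x \<notin> \<Omega>" using closure_subset by auto
      have "((\<lambda>x. 0) has_derivative K x) (at x)"
        using \<open>x \<notin> \<Omega>\<close> by (simp add: K_def[abs_def])
      then show ?thesis
        by (rule has_derivative_transform_within_open[OF _ _ \<open>x \<in> - closure \<Omega>\<close>])
          (use closure_subset[of \<Omega>] in \<open>auto simp: k_def\<close>)
    qed
  qed
  have "compact (closure \<Omega>)" using \<Omega>(2) by simp
  moreover have "continuous_on (closure \<Omega>) (\<lambda>x. \<eta> x * (g x \<bullet> e) + f x * (D x \<bullet> e))"
    by (intro continuous_intros continuous_on_subset[OF cont(1)] continuous_on_subset[OF cont(2)]
        continuous_on_subset[OF f(2)] continuous_on_subset[OF \<eta>(2)]) auto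
  ultimately have "bounded ((\<lambda>x. \<eta> x * (g x \<bullet> e) + f x * (D x \<bullet> e)) ` closure \<Omega>)"
    by (intro compact_imp_bounded compact_continuous_image)
  then obtain B where B: "\<And>x. x \<in> closure \<Omega> \<Longrightarrow> \<bar>\<eta> x * (g x \<bullet> e) + f x * (D x \<bullet> e)\<bar> \<le> B"
    by (auto simp: bounded_iff)
  have "\<bar>K x e\<bar> \<le> max B 0" for x
    using B[of x] closure_subset[of \<Omega>] by (auto simp: K_def)
  then have "integral\<^sup>L lborel (\<lambda>x. K x e) = 0"
    by (rule integral_partial_derivative_eq_0[OF der _ \<Omega>(2)]) (simp add: k_def)
  moreover have "(\<lambda>x. K x e) = (\<lambda>x. indicator \<Omega> x *\<^sub>R (\<eta> x * (g x \<bullet> e) + f x * (D x \<bullet> e)))"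
    by (auto simp: K_def indicator_def)
  ultimately show ?thesis by (simp add: set_lebesgue_integral_def)
qed

lemma set_integrable_lborel_continuous:
  fixes f :: "'a::euclidean_space \<Rightarrow> real"
  assumes "open \<Omega>" "bounded \<Omega>" "continuous_on UNIV f"
  shows "set_integrable lborel \<Omega> f"
proof -
  have "set_integrable lborel (closure \<Omega>) f"
    unfolding set_integrable_def using assms
    by (intro borel_integrable_compact) (auto intro: continuous_on_subset)
  then show ?thesis
    using assms closure_subset by (rule_tac set_integrable_subset) auto
qed

text \<open>
  The divergence theorem in the form of an inequality, valid on every bounded open set with finite
  boundary area. Cover the boundary by balls \<open>B(x\<^sub>i, r\<^sub>i)\<close> with \<open>\<Sum>\<bar>f x\<^sub>i\<bar> r\<^sub>i\<^sup>2\<close> close to the boundary integral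
  and integrate by parts against the product of the cutoffs vanishing on these balls; the gradient
  of the \<open>i\<close>-th cutoff contributes \<open>\<bar>f x\<^sub>i\<bar> r\<^sub>i\<^sup>-\<^sup>1 r\<^sub>i\<^sup>3\<close>.
\<close>

lemma abs_integral_partial_derivative_le_boundary:
  fixes \<Omega> :: "(real^3) set" and f :: "real^3 \<Rightarrow> real"
  assumes \<Omega>: "open \<Omega>" "bounded \<Omega>" "hausdorff2_outer (frontier \<Omega>) < top"
    and f: "\<And>x. (f has_derivative (\<lambda>v. g x \<bullet> v)) (at x)" "continuous_on UNIV g"
    and e: "norm e \<le> 1"
  shows "ennreal \<bar>LINT x:\<Omega>|lborel. g x \<bullet> e\<bar> \<le> 4096 * (\<integral>\<^sup>+x\<in>frontier \<Omega>. ennreal \<bar>f x\<bar> \<partial>hausdorff2)"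
proof (rule ennreal_le_epsilon)
  fix \<epsilon> :: real assume \<epsilon>: "0 < \<epsilon>"
  define S where "S = (\<integral>\<^sup>+x\<in>frontier \<Omega>. ennreal \<bar>f x\<bar> \<partial>hausdorff2)"
  have contf: "continuous_on UNIV f"
    using f(1) by (meson continuous_at_imp_continuous_on has_derivative_continuous)
  obtain R where R: "\<And>x. x \<in> closure \<Omega> \<Longrightarrow> norm x \<le> R"
    using bounded_closure[OF \<Omega>(2)] by (auto simp: bounded_iff)
  \<comment> \<open>All doubled balls have radius at most 2 and centres on the boundary, so one
    gradient bound on this larger ball covers every comparison of \<open>f x\<close> with
    \<open>f (c i)\<close>.\<close>
  have "compact (g ` cball 0 (R + 2))"
    using f(2) by (intro compact_continuous_image) (auto intro: continuous_on_subset)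
  then obtain M0 where M0: "\<And>x. x \<in> cball 0 (R + 2) \<Longrightarrow> norm (g x) \<le> M0"
    by (metis compact_imp_bounded bounded_iff imageI)
  define M where "M = max M0 0"
  have M: "\<And>x. x \<in> cball 0 (R + 2) \<Longrightarrow> norm (g x) \<le> M" "M \<ge> 0" using M0 by (auto simp: M_def intro: le_max_iff_disj[THEN iffD2])
  define K where "K = frontier \<Omega>"
  have K: "compact K" using \<Omega>(2) by (simp add: K_def compact_frontier_bounded)
  define HK where "HK = enn2real (hausdorff2_outer K)"
  have HK: "hausdorff2_outer K = ennreal HK" "HK \<ge> 0" using \<Omega>(3) by (auto simp: HK_def K_def less_top)
  \<comment> \<open>The radius bound makes the gradient term negligible: it is cubic in the radii,
    hence at most \<open>d\<close> times their sum of squares, and that sum is at most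
    \<open>4 * HK + 1\<close>.\<close>
  define d where "d = min 1 (\<epsilon> / (2 * (2112 * (M + 1) * (4 * HK + 1))))"
  have d: "d > 0" "d \<le> 1" using \<epsilon> HK M by (auto simp: d_def)
  have dM: "2112 * M * d * (4 * HK + 1) \<le> \<epsilon> / 2"
  proof -
    have "2112 * M * d * (4 * HK + 1) \<le> 2112 * (M + 1) * d * (4 * HK + 1)"
      using d HK M by (intro mult_right_mono) auto
    also have "\<dots> = d * (2112 * (M + 1) * (4 * HK + 1))" by simp
    also have "\<dots> \<le> (\<epsilon> / (2 * (2112 * (M + 1) * (4 * HK + 1)))) * (2112 * (M + 1) * (4 * HK + 1))"
      using HK M by (intro mult_right_mono) (auto simp: d_def)
    also have "\<dots> = \<epsilon> / 2" using HK M by simp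
    finally show ?thesis .
  qed
  have e2: "\<epsilon> / 2048 > 0" using \<epsilon> by simp
  obtain I :: "(nat \<times> nat) set" and c r where I: "finite I"
    "\<And>i. i \<in> I \<Longrightarrow> c i \<in> K" "\<And>i. i \<in> I \<Longrightarrow> 0 < r i" "\<And>i. i \<in> I \<Longrightarrow> r i \<le> d"
    "K \<subseteq> (\<Union>i\<in>I. ball (c i) (r i))"
    "ennreal (\<Sum>i\<in>I. \<bar>f (c i)\<bar> * (r i)\<^sup>2) \<le> 4 * (\<integral>\<^sup>+x\<in>K. ennreal \<bar>f x\<bar> \<partial>hausdorff2) + ennreal (\<epsilon> / 2048)"
    "ennreal (\<Sum>i\<in>I. (r i)\<^sup>2) \<le> 4 * hausdorff2_outer K + 1"
    by (rule hausdorff2_weighted_ball_cover[OF K \<Omega>(3)[folded K_def], of "\<lambda>x. \<bar>f x\<bar>" d "\<epsilon> / 2048"])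
       (use contf d e2 in \<open>auto intro!: continuous_intros\<close>)
  obtain \<eta> D where \<eta>: "\<And>x. (\<eta> has_derivative (\<lambda>v. D x \<bullet> v)) (at x)" "continuous_on UNIV D"
    "\<And>x. 0 \<le> \<eta> x" "\<And>x. \<eta> x \<le> (1::real)" "\<And>i x. i \<in> I \<Longrightarrow> x \<in> ball (c i) (r i) \<Longrightarrow> \<eta> x = 0"
    "\<And>x. norm (D x) \<le> (\<Sum>i\<in>I. 16 / r i * indicator (cball (c i) (2 * r i)) x)"
    "\<And>x. 1 - \<eta> x \<le> (\<Sum>i\<in>I. indicator (cball (c i) (2 * r i)) x)"
    using finite_balls_cutoff[of I r c] I(1,3) by blast
  let ?I = "LINT x:\<Omega>|lborel. g x \<bullet> e" and ?S = "\<Sum>i\<in>I. \<bar>f (c i)\<bar> * (r i)\<^sup>2" and ?B = "\<lambda>i. cball (c i) (2 * r i)"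
  \<comment> \<open>\<open>?r\<close> is the derivative of \<open>\<eta> * f\<close>, with integral
    zero, and \<open>?p\<close> is the remainder of \<open>g x \<bullet> e\<close>, concentrated
    near the boundary.\<close>
  let ?p = "\<lambda>x. (1 - \<eta> x) * (g x \<bullet> e) - f x * (D x \<bullet> e)" and ?r = "\<lambda>x. \<eta> x * (g x \<bullet> e) + f x * (D x \<bullet> e)"
  have cont\<eta>: "continuous_on UNIV \<eta>"
    using \<eta>(1) by (meson continuous_at_imp_continuous_on has_derivative_continuous)
  have zero: "(LINT x:\<Omega>|lborel. ?r x) = 0"
    using I(5) \<eta>(5) unfolding K_def
    by (intro set_integral_partial_derivative_cutoff[OF \<Omega>(1,2) f \<eta>(1,2), of "\<Union>i\<in>I. ball (c i) (r i)"]) auto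
  have cball_sub: "?B i \<subseteq> cball 0 (R + 2)" if "i \<in> I" for i
  proof
    fix x assume "x \<in> ?B i"
    then have "dist (c i) x \<le> 2" using I(4)[OF that] d by simp
    moreover have "norm (c i) \<le> R" using I(2)[OF that] R by (auto simp: K_def frontier_def)
    ultimately show "x \<in> cball 0 (R + 2)"
      using norm_triangle_sub[of x "c i"] by (simp add: dist_norm norm_minus_commute)
  qed
  have f_le: "\<bar>f x\<bar> \<le> \<bar>f (c i)\<bar> + 2 * M * r i" if "i \<in> I" "x \<in> ?B i" for i x
  proof -
    have "norm (f x - f (c i)) \<le> M * norm (x - c i)"
    proof (rule differentiable_bound[where f'="\<lambda>x v. g x \<bullet> v" and S="cball 0 (R + 2)"])
      show "(f has_derivative (\<lambda>v. g y \<bullet> v)) (at y within cball 0 (R + 2))" for y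
        using f(1) by (rule has_derivative_at_withinI)
      show "onorm (\<lambda>v. g y \<bullet> v) \<le> M" if "y \<in> cball 0 (R + 2)" for y
        using M(1)[OF that] by (intro onorm_bound M(2))
          (metis Cauchy_Schwarz_ineq2 mult_right_mono norm_ge_zero order_trans real_norm_def)
      show "x \<in> cball 0 (R + 2)" using that cball_sub by blast
      have "c i \<in> ?B i" using I(3)[OF that(1)] by simp
      then show "c i \<in> cball 0 (R + 2)" using that cball_sub by blast
    qed simp
    also have "\<dots> \<le> M * (2 * r i)"
      using that(2) M(2) by (intro mult_left_mono) (auto simp: dist_norm norm_minus_commute)
    finally show ?thesis by simp
  qed
  have ge: "\<bar>g x \<bullet> e\<bar> \<le> M" if "x \<in> closure \<Omega>" for x
  proof -
    have "\<bar>g x \<bullet> e\<bar> \<le> norm (g x) * norm e" by (rule Cauchy_Schwarz_ineq2)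
    also have "\<dots> \<le> M * 1" using M(1)[of x] R[OF that] M(2) e by (intro mult_mono) auto
    finally show ?thesis by simp
  qed
  \<comment> \<open>In 33 M, one M comes from \<open>(1 - \<eta> x) * (g x \<bullet> e)\<close> and
    32 M from replacing \<open>f x\<close> by \<open>f (c i)\<close> in the cutoff gradient, (16 /
    r) * 2 M r. The volume bound 64 r^3 turns 33 and 16 into 2112 and 1024, and the ball cover turns
    1024 into 4096.\<close>
  define H where "H x = (\<Sum>i\<in>I. (33 * M + 16 / r i * \<bar>f (c i)\<bar>) * indicator (?B i) x)" for x
  have H_int: "integrable lborel H"
    unfolding H_def by (intro Bochner_Integration.integrable_sum integrable_mult_right integrable_real_indicator)
      (auto simp: emeasure_lborel_cball_finite[unfolded infinity_ennreal_def])
  have bound: "\<bar>?p x\<bar> \<le> H x" if x: "x \<in> \<Omega>" for x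
  proof -
    have xc: "x \<in> closure \<Omega>" using x closure_subset by auto
    have "\<bar>D x \<bullet> e\<bar> \<le> norm (D x) * norm e" by (rule Cauchy_Schwarz_ineq2)
    also have "\<dots> \<le> norm (D x)" using e by (simp add: mult_left_le)
    finally have De: "\<bar>D x \<bullet> e\<bar> \<le> norm (D x)" .
    have "\<bar>?p x\<bar> \<le> \<bar>1 - \<eta> x\<bar> * \<bar>g x \<bullet> e\<bar> + \<bar>f x\<bar> * \<bar>D x \<bullet> e\<bar>"
      unfolding abs_mult[symmetric] by (rule abs_triangle_ineq4)
    also have "\<dots> \<le> (1 - \<eta> x) * M + \<bar>f x\<bar> * norm (D x)"
      using \<eta>(3,4)[of x] ge[OF xc] De M by (intro add_mono mult_mono) auto
    also have "\<dots> \<le> (\<Sum>i\<in>I. indicator (?B i) x) * M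
       + \<bar>f x\<bar> * (\<Sum>i\<in>I. 16 / r i * indicator (?B i) x)"
      using \<eta>(6,7)[of x] M(2) by (intro add_mono mult_mono) (auto intro!: sum_nonneg)
    also have "\<dots> = (\<Sum>i\<in>I. (M + 16 / r i * \<bar>f x\<bar>) * indicator (?B i) x)"
      by (simp add: sum_distrib_left sum_distrib_right sum.distrib[symmetric] algebra_simps)
    also have "\<dots> \<le> H x"
      unfolding H_def
    proof (intro sum_mono)
      fix i assume i: "i \<in> I"
      show "(M + 16 / r i * \<bar>f x\<bar>) * indicator (?B i) x
        \<le> (33 * M + 16 / r i * \<bar>f (c i)\<bar>) * indicator (?B i) x"
      proof (cases "x \<in> ?B i")
        case True
        have "16 / r i * \<bar>f x\<bar> \<le> 16 / r i * (\<bar>f (c i)\<bar> + 2 * M * r i)"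
          using f_le[OF i True] I(3)[OF i] by (intro mult_left_mono) auto
        also have "\<dots> = 16 / r i * \<bar>f (c i)\<bar> + 32 * M"
          using I(3)[OF i] by (simp add: field_simps)
        finally show ?thesis using True by simp
      qed simp
    qed
    finally show ?thesis .
  qed
  have int: "set_integrable lborel \<Omega> (\<lambda>x. g x \<bullet> e)" "set_integrable lborel \<Omega> (\<lambda>x. ?r x)"
    using \<Omega>(1,2) f(2) \<eta>(2) cont\<eta> contf
    by (auto intro!: set_integrable_lborel_continuous continuous_intros)
  have "?I = ?I - (LINT x:\<Omega>|lborel. ?r x)"
    by (simp add: zero)
  also have "\<dots> = (LINT x:\<Omega>|lborel. ?p x)"
    by (subst set_integral_diff(2)[OF int, symmetric]) (simp add: algebra_simps)
  also have "\<bar>\<dots>\<bar> \<le> integral\<^sup>L lborel H"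
  proof -
    have "norm (LINT x:\<Omega>|lborel. ?p x) \<le> integral\<^sup>L lborel H"
      unfolding set_lebesgue_integral_def
    proof (rule Bochner_Integration.integral_norm_bound_integral[OF _ H_int])
      have "set_integrable lborel \<Omega> (\<lambda>x. ?p x)"
        using \<Omega>(1,2) f(2) \<eta>(2) cont\<eta> contf
        by (auto intro!: set_integrable_lborel_continuous continuous_intros)
      then show "integrable lborel (\<lambda>x. indicator \<Omega> x *\<^sub>R ?p x)"
        by (simp add: set_integrable_def)
      have "H x \<ge> 0" for x
        unfolding H_def using M(2) I(3) by (intro sum_nonneg mult_nonneg_nonneg) (auto simp: less_imp_le)
      then show "norm (indicator \<Omega> x *\<^sub>R ?p x) \<le> H x" for x
        using bound[of x] by (cases "x \<in> \<Omega>") auto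
    qed
    then show ?thesis by simp
  qed
  also have "integral\<^sup>L lborel H = (\<Sum>i\<in>I. (33 * M + 16 / r i * \<bar>f (c i)\<bar>) * measure lborel (?B i))"
    unfolding H_def by (subst Bochner_Integration.integral_sum)
      (auto simp: emeasure_lborel_cball_finite[unfolded infinity_ennreal_def] intro!: integrable_mult_right integrable_real_indicator)
  also have "\<dots> \<le> (\<Sum>i\<in>I. 2112 * M * d * (r i)\<^sup>2 + 1024 * (\<bar>f (c i)\<bar> * (r i)\<^sup>2))"
  proof (intro sum_mono)
    fix i assume i: "i \<in> I"
    note ri = I(3)[OF i]
    have "(33 * M + 16 / r i * \<bar>f (c i)\<bar>) * measure lborel (?B i)
      \<le> (33 * M + 16 / r i * \<bar>f (c i)\<bar>) * (64 * r i ^ 3)"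
      using ri M by (intro mult_left_mono measure_cball_double_le) auto
    also have "\<dots> = 2112 * M * r i * (r i)\<^sup>2 + 1024 * (\<bar>f (c i)\<bar> * (r i)\<^sup>2)"
      using ri by (simp add: field_simps power2_eq_square power3_eq_cube)
    also have "\<dots> \<le> 2112 * M * d * (r i)\<^sup>2 + 1024 * (\<bar>f (c i)\<bar> * (r i)\<^sup>2)"
      using I(4)[OF i] M by (intro add_right_mono mult_right_mono mult_left_mono) auto
    finally show "(33 * M + 16 / r i * \<bar>f (c i)\<bar>) * measure lborel (?B i)
      \<le> 2112 * M * d * (r i)\<^sup>2 + 1024 * (\<bar>f (c i)\<bar> * (r i)\<^sup>2)" .
  qed
  also have "\<dots> = 2112 * M * d * (\<Sum>i\<in>I. (r i)\<^sup>2) + 1024 * ?S"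
    by (simp add: sum.distrib sum_distrib_left)
  also have "2112 * M * d * (\<Sum>i\<in>I. (r i)\<^sup>2) \<le> \<epsilon> / 2"
  proof -
    have "ennreal (\<Sum>i\<in>I. (r i)\<^sup>2) \<le> ennreal (4 * HK + 1)"
      using I(7) HK by (simp add: ennreal_mult)
    then have "(\<Sum>i\<in>I. (r i)\<^sup>2) \<le> 4 * HK + 1" using HK by (subst (asm) ennreal_le_iff) auto
    then have "2112 * M * d * (\<Sum>i\<in>I. (r i)\<^sup>2) \<le> 2112 * M * d * (4 * HK + 1)"
      using M d by (intro mult_left_mono) auto
    then show ?thesis using dM by linarith
  qed
  finally have main: "\<bar>?I\<bar> \<le> \<epsilon> / 2 + 1024 * ?S"
    by simp
  have "ennreal \<bar>?I\<bar> \<le> ennreal (\<epsilon> / 2 + 1024 * ?S)"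
    by (rule ennreal_leI[OF main])
  also have "\<dots> = ennreal (\<epsilon> / 2) + 1024 * ennreal ?S"
  proof -
    have "0 \<le> ?S" by (intro sum_nonneg) auto
    then show ?thesis using \<epsilon> by (subst ennreal_plus) (auto simp: ennreal_mult)
  qed
  also have "\<dots> \<le> ennreal (\<epsilon> / 2) + 1024 * (4 * S + ennreal (\<epsilon> / 2048))"
    using I(6) by (intro add_left_mono mult_left_mono) (auto simp: S_def K_def)
  also have "\<dots> = 4096 * S + (ennreal (\<epsilon> / 2) + 1024 * ennreal (\<epsilon> / 2048))"
    by (simp add: distrib_left mult.assoc[symmetric] add.left_commute)
  also have "1024 * ennreal (\<epsilon> / 2048) = ennreal (\<epsilon> / 2)"
  proof -
    have "1024 * ennreal (\<epsilon> / 2048) = ennreal (1024 * (\<epsilon> / 2048))"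
      using \<epsilon> by (subst ennreal_mult) auto
    then show ?thesis by simp
  qed
  also have "ennreal (\<epsilon> / 2) + ennreal (\<epsilon> / 2) = ennreal \<epsilon>"
    using \<epsilon> by (simp flip: ennreal_plus)
  finally show "ennreal \<bar>?I\<bar> \<le>
      4096 * (\<integral>\<^sup>+x\<in>frontier \<Omega>. ennreal \<bar>f x\<bar> \<partial>hausdorff2) + ennreal \<epsilon>"
    by (simp add: S_def)
qed

subsection \<open>Area of Lipschitz boundaries\<close>

text \<open>Cutting the square into n^2 equal pieces gives images of diameter at most 4La/n. The
  total cost n^2 * pi * (2La/n)^2 does not depend on n, so it bounds the premeasure at every
  scale.\<close>

lemma hausdorff2_outer_lipschitz_image_square:
  fixes G :: "real \<times> real \<Rightarrow> real^3"
  assumes G: "L-lipschitz_on UNIV G" and a: "a > 0"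
  shows "hausdorff2_outer (G ` cbox (-a, -a) (a, a)) < top"
proof -
  have L: "L \<ge> 0" using G by (rule lipschitz_on_nonneg)
  have "hausdorff2_outer (G ` cbox (-a, -a) (a, a)) \<le> ennreal (pi * (4 * L * a / 2)\<^sup>2)"
  proof (rule hausdorff2_outer_leI)
    fix d :: real assume d: "d > 0"
    obtain n0 :: nat where "4 * L * a / d < real n0" using reals_Archimedean2 by blast
    then obtain n :: nat where n: "n > 0" "4 * L * a / d < real n" by (intro that[of "Suc n0"]) auto
    then have nd: "4 * L * a / real n \<le> d" using d by (simp add: field_simps)
    define s where "s i = - a + 2 * a * real i / real n" for i :: nat
    define Q where "Q i j = cbox (s i, s j) (s (Suc i), s (Suc j))" for i j
    \<comment> \<open>Piece (i, j) is stored at index i * n + j; the remaining indices are padded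
      with the empty set.\<close>
    define C where "C k = (if k < n * n then G ` Q (k div n) (k mod n) else {})" for k
    have step: "s (Suc i) - s i = 2 * a / real n" for i
      using n by (simp add: s_def field_simps)
    have find: "\<exists>i<n. s i \<le> t \<and> t \<le> s (Suc i)" if t: "-a \<le> t" "t \<le> a" for t
    \<comment> \<open>The right endpoint is separate, since rounding down would give the index
      \<open>n\<close>, one past the last interval.\<close>
    proof (cases "t = a")
      case True
      have "s (n - 1) \<le> a" "s (Suc (n - 1)) = a"
        using n a by (auto simp: s_def field_simps of_nat_diff)
      then show ?thesis using n True by (intro exI[of _ "n - 1"]) auto
    next
      case False
      define y where "y = (t + a) * real n / (2 * a)"
      have y0: "0 \<le> y" using t a by (simp add: y_def)
      have "(t + a) * real n < (2 * a) * real n" using t False n by (intro mult_strict_right_mono) auto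
      then have y: "0 \<le> y" "y < real n" using y0 a by (auto simp: y_def divide_less_eq mult.commute)
      define i where "i = nat \<lfloor>y\<rfloor>"
      have ri: "real i = of_int \<lfloor>y\<rfloor>" using y by (simp add: i_def)
      have i: "real i \<le> y" "y \<le> real (Suc i)" using ri by simp_all linarith+
      have "i < n" using i y by linarith
      moreover have "s i \<le> t" "t \<le> s (Suc i)"
        using i a n by (auto simp: s_def y_def field_simps)
      ultimately show ?thesis by blast
    qed
    have diamC: "bounded (C k)" "diameter (C k) \<le> 4 * L * a / real n" for k
    proof -
      have dQ: "dist p p' \<le> 4 * a / real n" if "p \<in> Q i j" "p' \<in> Q i j" for p p' i j
      proof -
        have "\<bar>fst p - fst p'\<bar> \<le> 2 * a / real n" "\<bar>snd p - snd p'\<bar> \<le> 2 * a / real n"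
          using that step[of i] step[of j]
          by (cases p, cases p', simp add: Q_def mem_box Basis_prod_def abs_le_iff)+
        moreover have "dist p p' \<le> \<bar>fst p - fst p'\<bar> + \<bar>snd p - snd p'\<bar>"
          using sqrt_sum_squares_le_sum_abs[of "fst p - fst p'" "snd p - snd p'"]
          by (simp add: dist_prod_def dist_real_def)
        ultimately show ?thesis by simp
      qed
      have dG: "dist (G p) (G p') \<le> 4 * L * a / real n" if "p \<in> Q i j" "p' \<in> Q i j" for p p' i j
      proof -
        have "dist (G p) (G p') \<le> L * dist p p'" using G by (rule lipschitz_onD) auto
        also have "\<dots> \<le> L * (4 * a / real n)" using dQ[OF that] L by (intro mult_left_mono) auto
        finally show ?thesis by (simp add: mult.commute mult.left_commute)
      qed
      show "bounded (C k)"
      proof (cases "k < n * n")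
        case True
        have "compact (G ` Q (k div n) (k mod n))"
          unfolding Q_def using lipschitz_on_continuous_on[OF G]
          by (intro compact_continuous_image) (auto intro: continuous_on_subset)
        then show ?thesis using True by (simp add: C_def compact_imp_bounded)
      qed (simp add: C_def)
      show "diameter (C k) \<le> 4 * L * a / real n"
        by (rule diameter_le) (use dG[unfolded dist_norm] L a in \<open>auto simp: C_def split: if_splits\<close>)
    qed
    have cover: "G ` cbox (-a, -a) (a, a) \<subseteq> (\<Union>k. C k)"
    proof
      fix y assume "y \<in> G ` cbox (-a, -a) (a, a)"
      then obtain p q where y: "y = G (p, q)" "(p, q) \<in> cbox (-a, -a) (a, a)" by (metis imageE surj_pair)
      then have pq: "-a \<le> p" "p \<le> a" "-a \<le> q" "q \<le> a"
        by (auto simp: mem_box Basis_prod_def)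
      obtain i j where ij: "i < n" "s i \<le> p" "p \<le> s (Suc i)" "j < n" "s j \<le> q" "q \<le> s (Suc j)"
        using find[OF pq(1,2)] find[OF pq(3,4)] by blast
      have "(p, q) \<in> Q i j" using ij by (auto simp: Q_def mem_box Basis_prod_def)
      moreover have "i * n + j < n * n"
      proof -
        have "i * n + j < Suc i * n" using ij by simp
        also have "\<dots> \<le> n * n" using ij by (intro mult_le_mono1) auto
        finally show ?thesis .
      qed
      ultimately have "G (p, q) \<in> C (i * n + j)"
        using ij by (simp add: C_def)
      then show "y \<in> (\<Union>k. C k)" using y by blast
    qed
    have "hausdorff2_pre d (G ` cbox (-a, -a) (a, a)) \<le> (\<Sum>k. ennreal (pi * (diameter (C k) / 2)\<^sup>2))"
      using cover diamC(1) order_trans[OF diamC(2) nd] by (rule hausdorff2_pre_le)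
    also have "\<dots> = (\<Sum>k<n * n. ennreal (pi * (diameter (C k) / 2)\<^sup>2))"
      by (intro suminf_finite) (auto simp: C_def)
    also have "\<dots> \<le> (\<Sum>k<n * n. ennreal (pi * (4 * L * a / real n / 2)\<^sup>2))"
      using diamC diameter_ge_0 by (intro sum_mono ennreal_leI mult_left_mono power_mono divide_right_mono) auto
    also have "\<dots> = ennreal (\<Sum>k<n * n. pi * (4 * L * a / real n / 2)\<^sup>2)"
      by (intro sum_ennreal) auto
    also have "(\<Sum>k<n * n. pi * (4 * L * a / real n / 2)\<^sup>2) = pi * (4 * L * a / 2)\<^sup>2"
      using n by (simp add: power2_eq_square)
    finally show "hausdorff2_pre d (G ` cbox (-a, -a) (a, a)) \<le> ennreal (pi * (4 * L * a / 2)\<^sup>2)" .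
  qed
  also have "\<dots> < top" by simp
  finally show ?thesis .
qed

text \<open>In the chart a frontier point lies exactly on the graph: it is not in the open set
  \<Omega>, hence not above, and a point strictly below has a neighbourhood disjoint from \<Omega>.
  The graph map \<open>G\<close> is Lipschitz, and \<open>a = norm p + r\<close> bounds all
  coordinates because \<open>T\<close> is an isometry.\<close>

lemma hausdorff2_outer_frontier_lipschitz_chart:
  fixes \<Omega> :: "(real^3) set"
  assumes \<Omega>: "open \<Omega>" and r: "r > 0"
    and T: "orthogonal_transformation (T :: real^3 \<Rightarrow> real^3)"
    and g: "L-lipschitz_on UNIV (g :: real \<times> real \<Rightarrow> real)"
    and chart: "\<forall>x\<in>ball p r. x \<in> \<Omega> \<longleftrightarrow> g (T x $ 1, T x $ 2) < T x $ 3"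
  shows "hausdorff2_outer (frontier \<Omega> \<inter> ball p r) < top"
proof -
  define a where "a = norm p + r"
  have a: "a > 0" using r by (simp add: a_def add_nonneg_pos)
  define G where "G z = inv T (vector [fst z, snd z, g z])" for z
  have Ti: "orthogonal_transformation (inv T)" using T by (rule orthogonal_transformation_inv)
  have L: "L \<ge> 0" using g by (rule lipschitz_on_nonneg)
  have "(2 + L)-lipschitz_on UNIV G"
  proof (rule lipschitz_onI)
    fix z w :: "real \<times> real"
    let ?v = "\<lambda>z. vector [fst z, snd z, g z] :: real^3"
    have "dist (G z) (G w) = norm (inv T (?v z - ?v w))"
      using orthogonal_transformation_linear[OF Ti] by (simp add: dist_norm G_def linear_diff)
    also have "\<dots> = norm (?v z - ?v w)" using Ti by (rule orthogonal_transformation_norm)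
    also have "\<dots> \<le> \<bar>fst z - fst w\<bar> + \<bar>snd z - snd w\<bar> + \<bar>g z - g w\<bar>"
      using norm_le_l1_cart[of "?v z - ?v w"] by (simp add: sum_3)
    also have "\<bar>fst z - fst w\<bar> \<le> dist z w" using dist_fst_le[of z w] by (simp add: dist_real_def)
    also have "\<bar>snd z - snd w\<bar> \<le> dist z w" using dist_snd_le[of z w] by (simp add: dist_real_def)
    also have "\<bar>g z - g w\<bar> \<le> L * dist z w" using lipschitz_onD[OF g, of z w] by (simp add: dist_real_def)
    finally show "dist (G z) (G w) \<le> (2 + L) * dist z w" by (simp add: algebra_simps)
  qed (use L in simp)
  from hausdorff2_outer_lipschitz_image_square[OF this a]
  have fin: "hausdorff2_outer (G ` cbox (-a, -a) (a, a)) < top" .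
  have contT: "continuous_on UNIV T"
    using orthogonal_transformation_linear[OF T] by (simp add: linear_continuous_on linear_linear)
  have contg: "continuous_on UNIV (\<lambda>x. g (T x $ 1, T x $ 2))"
  proof (rule continuous_on_compose2[OF lipschitz_on_continuous_on[OF g]])
    show "continuous_on UNIV (\<lambda>x. (T x $ 1, T x $ 2))" by (intro continuous_intros contT)
  qed simp
  have "frontier \<Omega> \<inter> ball p r \<subseteq> G ` cbox (-a, -a) (a, a)"
  proof
    fix x assume x: "x \<in> frontier \<Omega> \<inter> ball p r"
    have xn: "x \<notin> \<Omega>" using x \<Omega> by (auto simp: frontier_def interior_open)
    then have "T x $ 3 \<le> g (T x $ 1, T x $ 2)" using chart x by force
    moreover have "\<not> T x $ 3 < g (T x $ 1, T x $ 2)"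
    proof
      assume lt: "T x $ 3 < g (T x $ 1, T x $ 2)"
      let ?U = "ball p r \<inter> {x. T x $ 3 < g (T x $ 1, T x $ 2)}"
      have "open ?U"
        using contT contg by (intro open_Int open_ball open_Collect_less continuous_intros)
      moreover have "?U \<inter> \<Omega> = {}" using chart by force
      ultimately have "?U \<inter> closure \<Omega> = {}" by (simp add: open_Int_closure_eq_empty)
      then show False using x lt by (auto simp: frontier_def)
    qed
    ultimately have "T x $ 3 = g (T x $ 1, T x $ 2)" by simp
    then have "vector [T x $ 1, T x $ 2, g (T x $ 1, T x $ 2)] = T x"
      by (simp add: vec_eq_iff forall_3)
    then have "x = G (T x $ 1, T x $ 2)"
      using orthogonal_transformation_inj[OF T] by (simp add: G_def)
    moreover have "\<bar>T x $ i\<bar> \<le> a" for i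
    proof -
      have "\<bar>T x $ i\<bar> \<le> norm (T x)" by (rule component_le_norm_cart)
      also have "\<dots> = norm x" using T by (rule orthogonal_transformation_norm)
      also have "\<dots> \<le> a" using x norm_triangle_sub[of x p] by (simp add: a_def dist_norm norm_minus_commute)
      finally show ?thesis .
    qed
    then have "(T x $ 1, T x $ 2) \<in> cbox (-a, -a) (a, a)"
      by (auto simp: mem_box Basis_prod_def abs_le_iff minus_le_iff)
    ultimately show "x \<in> G ` cbox (-a, -a) (a, a)" by blast
  qed
  then show ?thesis using fin hausdorff2_outer_mono order_le_less_trans by blast
qed

lemma hausdorff2_outer_frontier_lipschitz_domain:
  assumes "lipschitz_domain \<Omega>"
  shows "hausdorff2_outer (frontier \<Omega>) < top"
proof -
  let ?H = hausdorff2_outer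
  have \<Omega>: "open \<Omega>" "bounded \<Omega>" "lipschitz_boundary \<Omega>" using assms by (auto simp: lipschitz_domain_def)
  have "\<exists>r>0. ?H (frontier \<Omega> \<inter> ball p r) < top" if "p \<in> frontier \<Omega>" for p
    using \<Omega>(3) that hausdorff2_outer_frontier_lipschitz_chart[OF \<Omega>(1)]
    unfolding lipschitz_boundary_def by meson
  then obtain r where r: "\<And>p. p \<in> frontier \<Omega> \<Longrightarrow> r p > 0"
      "\<And>p. p \<in> frontier \<Omega> \<Longrightarrow> ?H (frontier \<Omega> \<inter> ball p (r p)) < top"
    by metis
  have "compact (frontier \<Omega>)" using \<Omega>(2) by (rule compact_frontier_bounded)
  moreover have "frontier \<Omega> \<subseteq> (\<Union>p\<in>frontier \<Omega>. ball p (r p))" using r(1) by force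
  ultimately obtain P where P: "P \<subseteq> frontier \<Omega>" "finite P" "frontier \<Omega> \<subseteq> (\<Union>p\<in>P. ball p (r p))"
    using compactE_image[of "frontier \<Omega>" "frontier \<Omega>" "\<lambda>p. ball p (r p)"] by auto
  have "?H (frontier \<Omega>) \<le> ?H (\<Union>p\<in>P. frontier \<Omega> \<inter> ball p (r p))"
    using P(3) by (intro hausdorff2_outer_mono) blast
  also have "\<dots> \<le> (\<Sum>p\<in>P. ?H (frontier \<Omega> \<inter> ball p (r p)))"
    by (rule hausdorff2_outer_UN_finite_le[OF P(2)])
  also have "\<dots> < top" using r(2) P by (auto simp: less_top)
  finally show ?thesis .
qed

subsection \<open>Smooth functions\<close>

lemma has_derivative_imp_continuous_on:
  assumes "\<And>x. x \<in> S \<Longrightarrow> (f has_derivative f' x) (at x)"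
  shows "continuous_on S f"
  using assms by (meson continuous_at_imp_continuous_on has_derivative_continuous)

lemma Ck_on_SucI:
  assumes "\<And>x. x \<in> S \<Longrightarrow> (f has_derivative (\<lambda>v. g x \<bullet> v)) (at x)"
    and "\<And>b. b \<in> Basis \<Longrightarrow> Ck_on k (\<lambda>x. g x \<bullet> b) S"
  shows "Ck_on (Suc k) f S"
  using assms by auto

lemma Ck_on_Suc_imp: "Ck_on (Suc k) f S \<Longrightarrow> Ck_on k f S"
proof (induction k arbitrary: f)
  case 0
  then show ?case by (auto elim!: Ck_on_SucE intro: has_derivative_imp_continuous_on simp del: Ck_on.simps(2))
next
  case (Suc k)
  from Suc.prems obtain g where g: "\<And>x. x \<in> S \<Longrightarrow> (f has_derivative (\<lambda>v. g x \<bullet> v)) (at x)"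
    "\<And>b. b \<in> Basis \<Longrightarrow> Ck_on (Suc k) (\<lambda>x. g x \<bullet> b) S" by (rule Ck_on_SucE) (rule that)
  show ?case by (rule Ck_on_SucI[OF g(1)]) (use Suc.IH g(2) in auto)
qed

lemma Ck_on_const: "Ck_on k (\<lambda>x. c) S"
proof (induction k arbitrary: c)
  case (Suc k)
  show ?case by (rule Ck_on_SucI[where g="\<lambda>_. 0"]) (auto simp: Suc)
qed simp

lemma Ck_on_inner: "Ck_on k (\<lambda>x. a \<bullet> x) S"
proof (cases k)
  case (Suc k)
  show ?thesis unfolding Suc
    by (rule Ck_on_SucI[where g="\<lambda>_. a"]) (auto intro!: derivative_eq_intros Ck_on_const)
qed (auto intro!: continuous_intros)

lemma Ck_on_add: "Ck_on k f S \<Longrightarrow> Ck_on k h S \<Longrightarrow> Ck_on k (\<lambda>x. f x + h x) S"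
proof (induction k arbitrary: f h)
  case 0
  then show ?case by (auto intro!: continuous_intros)
next
  case (Suc k)
  from Suc.prems(1) obtain f' where f': "\<And>x. x \<in> S \<Longrightarrow> (f has_derivative (\<lambda>v. f' x \<bullet> v)) (at x)"
    "\<And>b. b \<in> Basis \<Longrightarrow> Ck_on k (\<lambda>x. f' x \<bullet> b) S" by (rule Ck_on_SucE) (rule that)
  from Suc.prems(2) obtain h' where h': "\<And>x. x \<in> S \<Longrightarrow> (h has_derivative (\<lambda>v. h' x \<bullet> v)) (at x)"
    "\<And>b. b \<in> Basis \<Longrightarrow> Ck_on k (\<lambda>x. h' x \<bullet> b) S" by (rule Ck_on_SucE) (rule that)
  show ?case
  proof (rule Ck_on_SucI[where g="\<lambda>x. f' x + h' x"])
    show "((\<lambda>x. f x + h x) has_derivative (\<lambda>v. (f' x + h' x) \<bullet> v)) (at x)" if "x \<in> S" for x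
      using has_derivative_add[OF f'(1) h'(1), OF that that] by (simp add: inner_add_left)
    show "Ck_on k (\<lambda>x. (f' x + h' x) \<bullet> b) S" if "b \<in> Basis" for b
      using Suc.IH[OF f'(2) h'(2), OF that that] by (simp add: inner_add_left)
  qed
qed

lemma Ck_on_mult: "Ck_on k f S \<Longrightarrow> Ck_on k h S \<Longrightarrow> Ck_on k (\<lambda>x. f x * h x) S"
proof (induction k arbitrary: f h)
  case 0
  then show ?case by (auto intro!: continuous_intros)
next
  case (Suc k)
  from Suc.prems(1) obtain f' where f': "\<And>x. x \<in> S \<Longrightarrow> (f has_derivative (\<lambda>v. f' x \<bullet> v)) (at x)"
    "\<And>b. b \<in> Basis \<Longrightarrow> Ck_on k (\<lambda>x. f' x \<bullet> b) S" by (rule Ck_on_SucE) (rule that)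
  from Suc.prems(2) obtain h' where h': "\<And>x. x \<in> S \<Longrightarrow> (h has_derivative (\<lambda>v. h' x \<bullet> v)) (at x)"
    "\<And>b. b \<in> Basis \<Longrightarrow> Ck_on k (\<lambda>x. h' x \<bullet> b) S" by (rule Ck_on_SucE) (rule that)
  show ?case
  proof (rule Ck_on_SucI[where g="\<lambda>x. f x *\<^sub>R h' x + h x *\<^sub>R f' x"])
    show "((\<lambda>x. f x * h x) has_derivative (\<lambda>v. (f x *\<^sub>R h' x + h x *\<^sub>R f' x) \<bullet> v)) (at x)" if "x \<in> S" for x
      by (rule has_derivative_eq_rhs[OF has_derivative_mult[OF f'(1) h'(1), OF that that]])
        (auto simp: inner_add_left fun_eq_iff)
    show "Ck_on k (\<lambda>x. (f x *\<^sub>R h' x + h x *\<^sub>R f' x) \<bullet> b) S" if "b \<in> Basis" for b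
      using Ck_on_add[OF Suc.IH[OF Ck_on_Suc_imp[OF Suc.prems(1)] h'(2)[OF that]]
          Suc.IH[OF Ck_on_Suc_imp[OF Suc.prems(2)] f'(2)[OF that]]]
      by (simp add: inner_add_left)
  qed
qed

lemma Ck_on_compose:
  fixes \<theta> :: "real \<Rightarrow> real"
  shows "Ck_on k \<theta> UNIV \<Longrightarrow> Ck_on k f S \<Longrightarrow> Ck_on k (\<lambda>x. \<theta> (f x)) S"
proof (induction k arbitrary: \<theta>)
  case 0
  then show ?case by (auto intro: continuous_on_compose2)
next
  case (Suc k)
  from Suc.prems(1) obtain t where t: "\<And>x. (\<theta> has_derivative (\<lambda>v. t x \<bullet> v)) (at x)"
    "Ck_on k (\<lambda>x. t x \<bullet> 1) UNIV" by (rule Ck_on_SucE) auto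
  from Suc.prems(2) obtain f' where f': "\<And>x. x \<in> S \<Longrightarrow> (f has_derivative (\<lambda>v. f' x \<bullet> v)) (at x)"
    "\<And>b. b \<in> Basis \<Longrightarrow> Ck_on k (\<lambda>x. f' x \<bullet> b) S" by (rule Ck_on_SucE) (rule that)
  show ?case
  proof (rule Ck_on_SucI[where g="\<lambda>x. t (f x) *\<^sub>R f' x"])
    show "((\<lambda>x. \<theta> (f x)) has_derivative (\<lambda>v. (t (f x) *\<^sub>R f' x) \<bullet> v)) (at x)" if "x \<in> S" for x
      using has_derivative_compose[OF f'(1)[OF that] t(1)] by simp
    show "Ck_on k (\<lambda>x. (t (f x) *\<^sub>R f' x) \<bullet> b) S" if "b \<in> Basis" for b
      using Ck_on_mult[OF Suc.IH[OF t(2) Ck_on_Suc_imp[OF Suc.prems(2)]] f'(2)[OF that]] by simp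
  qed
qed

lemma smooth_const: "smooth (\<lambda>x. c)"
  and smooth_inner: "smooth (\<lambda>x. a \<bullet> x)"
  and smooth_add: "smooth f \<Longrightarrow> smooth h \<Longrightarrow> smooth (\<lambda>x. f x + h x)"
  and smooth_mult: "smooth f \<Longrightarrow> smooth h \<Longrightarrow> smooth (\<lambda>x. f x * h x)"
  and smooth_compose: "smooth \<theta> \<Longrightarrow> smooth f \<Longrightarrow> smooth (\<lambda>x. \<theta> (f x))"
  by (auto simp: smooth_def intro: Ck_on_const Ck_on_inner Ck_on_add Ck_on_mult Ck_on_compose)

lemma smooth_prod: "(\<And>i. i \<in> I \<Longrightarrow> smooth (f i)) \<Longrightarrow> smooth (\<lambda>x. \<Prod>i\<in>I. f i x)"
  by (induction I rule: infinite_finite_induct) (auto intro: smooth_const smooth_mult)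

text \<open>\<open>Ck_on\<close> asserts a gradient separately for every order. Uniqueness of
  derivatives makes all of them coincide, so a single gradient has smooth components.\<close>

lemma smooth_gradientE:
  fixes f :: "'a::euclidean_space \<Rightarrow> real"
  assumes "smooth f"
  obtains g where "\<And>x. (f has_derivative (\<lambda>v. g x \<bullet> v)) (at x)" "\<And>b. b \<in> Basis \<Longrightarrow> smooth (\<lambda>x. g x \<bullet> b)"
proof -
  have ex: "\<exists>g. (\<forall>x. (f has_derivative (\<lambda>v. g x \<bullet> v)) (at x)) \<and> (\<forall>b\<in>Basis. Ck_on k (\<lambda>x. g x \<bullet> b) UNIV)" for k
    using assms Ck_on.simps(2)[of k f UNIV] unfolding smooth_def by (metis UNIV_I)
  then obtain g where g: "\<And>x. (f has_derivative (\<lambda>v. g x \<bullet> v)) (at x)" by blast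
  have "Ck_on k (\<lambda>x. g x \<bullet> b) UNIV" if b: "b \<in> Basis" for b k
  proof -
    obtain g' where g': "\<And>x. (f has_derivative (\<lambda>v. g' x \<bullet> v)) (at x)" "Ck_on k (\<lambda>x. g' x \<bullet> b) UNIV"
      using ex[of k] b by blast
    have "(\<lambda>v. g x \<bullet> v) = (\<lambda>v. g' x \<bullet> v)" for x
      by (rule has_derivative_unique[OF g g'(1)])
    then have "g x \<bullet> b = g' x \<bullet> b" for x by metis
    then show ?thesis using g'(2) by simp
  qed
  then have "\<And>b. b \<in> Basis \<Longrightarrow> smooth (\<lambda>x. g x \<bullet> b)" by (simp add: smooth_def)
  with g show ?thesis by (rule that)
qed

lemma smooth_continuous: "smooth f \<Longrightarrow> continuous_on UNIV f"
  by (auto simp: smooth_def dest: spec[of _ 0])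

lemma continuous_gradient:
  fixes g :: "'a::euclidean_space \<Rightarrow> 'a"
  assumes "\<And>b. b \<in> Basis \<Longrightarrow> smooth (\<lambda>x. g x \<bullet> b)"
  shows "continuous_on UNIV g"
  using assms by (subst continuous_on_componentwise) (auto intro: smooth_continuous)

text \<open>The second difference \<open>?\<Delta>\<close> is symmetric in the two directions. Two
  applications of the mean value theorem identify it with h^2 times either mixed derivative at
  points that tend to \<open>x\<close> with h, and continuity finishes the argument.\<close>

lemma mixed_partials_eq:
  fixes f :: "'a::euclidean_space \<Rightarrow> real"
  assumes f: "\<And>x. (f has_derivative (\<lambda>v. g x \<bullet> v)) (at x)"
    and ga: "\<And>x. ((\<lambda>x. g x \<bullet> a) has_derivative (\<lambda>v. ga x \<bullet> v)) (at x)" "continuous_on UNIV ga"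
    and gb: "\<And>x. ((\<lambda>x. g x \<bullet> b) has_derivative (\<lambda>v. gb x \<bullet> v)) (at x)" "continuous_on UNIV gb"
  shows "ga x \<bullet> b = gb x \<bullet> a"
proof -
  let ?\<Delta> = "\<lambda>h a b. f (x + h *\<^sub>R a + h *\<^sub>R b) - f (x + h *\<^sub>R a) - f (x + h *\<^sub>R b) + f x"
  \<comment> \<open>The directions and the gradient are quantified anew, so that the fact can be
    used in both orders.\<close>
  have mvt: "\<exists>s t. 0 < s \<and> s < h \<and> 0 < t \<and> t < h \<and>
      ?\<Delta> h a b = h * (h * (ga (x + s *\<^sub>R a + t *\<^sub>R b) \<bullet> b))"
    if h: "h > 0" and ga: "\<And>x. ((\<lambda>x. g x \<bullet> a) has_derivative (\<lambda>v. ga x \<bullet> v)) (at x)"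
    for h a b ga
  proof -
    have "\<exists>s>0. s < h \<and> (f (x + h *\<^sub>R b + h *\<^sub>R a) - f (x + h *\<^sub>R a)) - (f (x + h *\<^sub>R b + 0 *\<^sub>R a) - f (x + 0 *\<^sub>R a))
        = (h - 0) * (g (x + h *\<^sub>R b + s *\<^sub>R a) \<bullet> a - g (x + s *\<^sub>R a) \<bullet> a)"
      by (rule MVT2[OF h]) (intro DERIV_diff has_derivative_imp_DERIV_line f)
    then obtain s where s: "0 < s" "s < h" "(f (x + h *\<^sub>R b + h *\<^sub>R a) - f (x + h *\<^sub>R a)) - (f (x + h *\<^sub>R b) - f x)
        = h * (g (x + h *\<^sub>R b + s *\<^sub>R a) \<bullet> a - g (x + s *\<^sub>R a) \<bullet> a)" by auto
    have "\<exists>t>0. t < h \<and> g (x + s *\<^sub>R a + h *\<^sub>R b) \<bullet> a - g (x + s *\<^sub>R a + 0 *\<^sub>R b) \<bullet> a = (h - 0) * (ga (x + s *\<^sub>R a + t *\<^sub>R b) \<bullet> b)"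
      by (rule MVT2[OF h]) (intro has_derivative_imp_DERIV_line ga)
    then obtain t where t: "0 < t" "t < h" "g (x + s *\<^sub>R a + h *\<^sub>R b) \<bullet> a - g (x + s *\<^sub>R a) \<bullet> a = h * (ga (x + s *\<^sub>R a + t *\<^sub>R b) \<bullet> b)"
      by auto
    have e: "x + h *\<^sub>R b + s *\<^sub>R a = x + s *\<^sub>R a + h *\<^sub>R b" "x + h *\<^sub>R b + h *\<^sub>R a = x + h *\<^sub>R a + h *\<^sub>R b"
      by (simp_all add: algebra_simps)
    have "?\<Delta> h a b = h * (h * (ga (x + s *\<^sub>R a + t *\<^sub>R b) \<bullet> b))"
      using s(3) unfolding e t(3) by linarith
    then show ?thesis using s t by blast
  qed
  have "\<exists>s t s' t'. \<bar>s\<bar> \<le> h \<and> \<bar>t\<bar> \<le> h \<and> \<bar>s'\<bar> \<le> h \<and> \<bar>t'\<bar> \<le> h \<and>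
      ga (x + s *\<^sub>R a + t *\<^sub>R b) \<bullet> b = gb (x + s' *\<^sub>R b + t' *\<^sub>R a) \<bullet> a" if h: "h > 0" for h
  proof -
    obtain s t where st: "0 < s" "s < h" "0 < t" "t < h"
      "?\<Delta> h a b = h * (h * (ga (x + s *\<^sub>R a + t *\<^sub>R b) \<bullet> b))"
      using mvt[OF h ga(1), of b] by blast
    obtain s' t' where st': "0 < s'" "s' < h" "0 < t'" "t' < h"
      "?\<Delta> h b a = h * (h * (gb (x + s' *\<^sub>R b + t' *\<^sub>R a) \<bullet> a))"
      using mvt[OF h gb(1), of a] by blast
    have e: "x + h *\<^sub>R b + h *\<^sub>R a = x + h *\<^sub>R a + h *\<^sub>R b" by (simp add: algebra_simps)
    have "h * (h * (ga (x + s *\<^sub>R a + t *\<^sub>R b) \<bullet> b)) = h * (h * (gb (x + s' *\<^sub>R b + t' *\<^sub>R a) \<bullet> a))"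
      using st(5) st'(5) unfolding e by linarith
    then have "ga (x + s *\<^sub>R a + t *\<^sub>R b) \<bullet> b = gb (x + s' *\<^sub>R b + t' *\<^sub>R a) \<bullet> a" using h by simp
    then show ?thesis using st st' by (intro exI[of _ s] exI[of _ t] exI[of _ s'] exI[of _ t']) auto
  qed
  then have "\<exists>s t s' t'. \<bar>s\<bar> \<le> inverse (real (Suc n)) \<and> \<bar>t\<bar> \<le> inverse (real (Suc n)) \<and>
      \<bar>s'\<bar> \<le> inverse (real (Suc n)) \<and> \<bar>t'\<bar> \<le> inverse (real (Suc n)) \<and>
      ga (x + s *\<^sub>R a + t *\<^sub>R b) \<bullet> b = gb (x + s' *\<^sub>R b + t' *\<^sub>R a) \<bullet> a" for n
    by simp
  then obtain s t s' t' where st: "\<And>n. \<bar>s n\<bar> \<le> inverse (real (Suc n))" "\<And>n. \<bar>t n\<bar> \<le> inverse (real (Suc n))"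
      "\<And>n. \<bar>s' n\<bar> \<le> inverse (real (Suc n))" "\<And>n. \<bar>t' n\<bar> \<le> inverse (real (Suc n))"
      "\<And>n. ga (x + s n *\<^sub>R a + t n *\<^sub>R b) \<bullet> b = gb (x + s' n *\<^sub>R b + t' n *\<^sub>R a) \<bullet> a"
    by metis
  have lim: "s \<longlonglongrightarrow> 0" "t \<longlonglongrightarrow> 0" "s' \<longlonglongrightarrow> 0" "t' \<longlonglongrightarrow> 0"
    using st(1-4) by (auto intro!: Lim_null_comparison[OF _ LIMSEQ_inverse_real_of_nat] always_eventually)
  have "(\<lambda>n. ga (x + s n *\<^sub>R a + t n *\<^sub>R b)) \<longlonglongrightarrow> ga (x + 0 *\<^sub>R a + 0 *\<^sub>R b)"
    by (rule continuous_on_tendsto_compose[OF ga(2)]) (intro tendsto_intros lim | simp)+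
  then have A: "(\<lambda>n. ga (x + s n *\<^sub>R a + t n *\<^sub>R b) \<bullet> b) \<longlonglongrightarrow> ga x \<bullet> b"
    by (auto intro!: tendsto_intros)
  have "(\<lambda>n. gb (x + s' n *\<^sub>R b + t' n *\<^sub>R a)) \<longlonglongrightarrow> gb (x + 0 *\<^sub>R b + 0 *\<^sub>R a)"
    by (rule continuous_on_tendsto_compose[OF gb(2)]) (intro tendsto_intros lim | simp)+
  then have B: "(\<lambda>n. gb (x + s' n *\<^sub>R b + t' n *\<^sub>R a) \<bullet> a) \<longlonglongrightarrow> gb x \<bullet> a"
    by (auto intro!: tendsto_intros)
  show ?thesis using LIMSEQ_unique[OF A] B unfolding st(5) by blast
qed

section \<open>Flat functions, bump functions and the fundamental lemma\<close>

definition exp_neg_inverse :: "nat \<Rightarrow> real \<Rightarrow> real" where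
  "exp_neg_inverse n t = (if t \<le> 0 then 0 else exp (- inverse t) * inverse t ^ n)"

lemma exp_neg_inverse_tendsto_0: "(exp_neg_inverse n \<longlongrightarrow> 0) (at 0)"
proof -
  have "((\<lambda>t. (inverse t) ^ n / exp (inverse t)) \<longlongrightarrow> 0) (at_right (0::real))"
    by (rule filterlim_compose[OF tendsto_power_div_exp_0 filterlim_inverse_at_top_right])
  then have "(exp_neg_inverse n \<longlongrightarrow> 0) (at_right 0)"
    by (rule Lim_transform_eventually)
      (auto simp: eventually_at_right_field exp_neg_inverse_def exp_minus divide_inverse intro!: exI[of _ 1])
  moreover have "(exp_neg_inverse n \<longlongrightarrow> 0) (at_left 0)"
    by (rule Lim_transform_eventually[OF tendsto_const])
      (auto simp: eventually_at_left_field exp_neg_inverse_def intro!: exI[of _ "-1"])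
  ultimately show ?thesis by (simp add: filterlim_split_at)
qed

text \<open>The powers of 1/t are part of the family so that it is closed under differentiation up
  to linear combinations; smoothness of all members then follows by one induction on the
  order.\<close>

lemma exp_neg_inverse_has_derivative:
  "(exp_neg_inverse n has_real_derivative
     exp_neg_inverse (n + 2) t - real n * exp_neg_inverse (n + 1) t) (at t)"
proof -
  consider "t < 0" | "t > 0" | "t = 0" by linarith
  then show ?thesis
  proof cases
    case 1
    have "((\<lambda>t. 0) has_real_derivative exp_neg_inverse (n + 2) t - real n * exp_neg_inverse (n + 1) t) (at t)"
      using 1 by (simp add: exp_neg_inverse_def)
    then show ?thesis
      by (rule has_field_derivative_transform_within_open[where S="{..<0}"])
        (use 1 in \<open>auto simp: exp_neg_inverse_def\<close>)
  next
    case 2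
    have "((\<lambda>t. exp (- inverse t) * inverse t ^ n) has_real_derivative
      exp_neg_inverse (n + 2) t - real n * exp_neg_inverse (n + 1) t) (at t)"
    proof -
      have "((\<lambda>t. exp (- inverse t) * inverse t ^ n) has_real_derivative
        exp (- inverse t) * (inverse t)\<^sup>2 * inverse t ^ n + (real n * inverse t ^ (n - 1) * - (inverse t)\<^sup>2) * exp (- inverse t)) (at t)"
        using 2 by (auto intro!: derivative_eq_intros simp: power2_eq_square)
      moreover have "real n * inverse t ^ (n - 1) * - (inverse t)\<^sup>2 = - (real n * inverse t ^ (n + 1))"
        by (cases n) (auto simp: power2_eq_square)
      moreover have "exp (- inverse t) * (inverse t)\<^sup>2 * inverse t ^ n + - (real n * inverse t ^ (n + 1)) * exp (- inverse t)
          = exp_neg_inverse (n + 2) t - real n * exp_neg_inverse (n + 1) t"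
        using 2 by (simp add: exp_neg_inverse_def power_add power2_eq_square)
      ultimately show ?thesis by (simp only:)
    qed
    then show ?thesis
      by (rule has_field_derivative_transform_within_open[where S="{0<..}"])
        (use 2 in \<open>auto simp: exp_neg_inverse_def\<close>)
  next
    case 3
    \<comment> \<open>At the origin the difference quotient is itself the next member of the family,
      which tends to 0.\<close>
    have "(\<lambda>h. exp_neg_inverse n h / h) = exp_neg_inverse (Suc n)"
      by (auto simp: exp_neg_inverse_def fun_eq_iff divide_inverse)
    then have "((\<lambda>h. exp_neg_inverse n h / h) \<longlongrightarrow> 0) (at 0)"
      by (simp add: exp_neg_inverse_tendsto_0)
    then show ?thesis unfolding 3 DERIV_def by (simp add: exp_neg_inverse_def)
  qed
qed

lemma smooth_exp_neg_inverse: "smooth (exp_neg_inverse n)"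
proof -
  have d: "(exp_neg_inverse n has_derivative (\<lambda>v. (exp_neg_inverse (n + 2) x - real n * exp_neg_inverse (n + 1) x) \<bullet> v)) (at x)" for n x
    using exp_neg_inverse_has_derivative[of n x] by (simp add: has_field_derivative_def)
  have "Ck_on k (exp_neg_inverse n) UNIV" for k
  proof (induction k arbitrary: n)
    case 0
    show ?case using has_derivative_imp_continuous_on[OF d] by simp
  next
    case (Suc k)
    have "Ck_on k (\<lambda>x. exp_neg_inverse (n + 2) x + (- real n) * exp_neg_inverse (n + 1) x) UNIV"
      by (intro Ck_on_add Ck_on_mult Ck_on_const Suc)
    then show ?case by (intro Ck_on_SucI[OF d]) auto
  qed
  then show ?thesis by (simp add: smooth_def)
qed

lemma smooth_exp_scaled: "smooth (\<lambda>s::real. exp (c * s))"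
proof -
  have d: "((\<lambda>s. exp (c * s)) has_derivative (\<lambda>v. (c * exp (c * x)) \<bullet> v)) (at x)" for x
    by (auto intro!: derivative_eq_intros)
  have "Ck_on k (\<lambda>s. exp (c * s)) UNIV" for k
  proof (induction k)
    case (Suc k)
    show ?case by (rule Ck_on_SucI[OF d]) (auto intro: Ck_on_mult[OF Ck_on_const Suc])
  qed (auto intro!: continuous_intros)
  then show ?thesis by (simp add: smooth_def)
qed

text \<open>\<open>\<psi>\<close> is smooth, positive on the open box and zero elsewhere;
  \<open>\<phi> n\<close> is 1 - exp(-(n+1)\<psi>), which tends to 1 on the box and keeps the closed
  box as its support.\<close>

lemma test_functions_approximate_box:
  fixes a b :: "'a::euclidean_space"
  assumes "box a b \<noteq> {}" "cbox a b \<subseteq> \<Omega>"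
  obtains \<phi> :: "nat \<Rightarrow> 'a \<Rightarrow> real" where "\<And>n. \<phi> n \<in> test_functions \<Omega>" "\<And>n x. \<bar>\<phi> n x\<bar> \<le> 1"
    "\<And>x. (\<lambda>n. \<phi> n x) \<longlonglongrightarrow> indicator (box a b) x"
proof -
  define \<psi> where "\<psi> x = (\<Prod>i\<in>Basis. exp_neg_inverse 0 (i \<bullet> x + - (i \<bullet> a)) * exp_neg_inverse 0 ((- i) \<bullet> x + i \<bullet> b))" for x
  have sm: "smooth \<psi>"
    unfolding \<psi>_def
    by (intro smooth_prod smooth_mult smooth_compose[OF smooth_exp_neg_inverse] smooth_add smooth_const smooth_inner)
  have e0: "exp_neg_inverse 0 t \<ge> 0" "exp_neg_inverse 0 t = 0 \<longleftrightarrow> t \<le> 0" for t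
    by (auto simp: exp_neg_inverse_def)
  have nn: "\<psi> x \<ge> 0" for x unfolding \<psi>_def by (intro prod_nonneg mult_nonneg_nonneg e0)
  have zero: "\<psi> x = 0 \<longleftrightarrow> x \<notin> box a b" for x
    unfolding \<psi>_def mem_box by (auto simp: e0 inner_commute not_less)
  define \<phi> where "\<phi> n x = 1 + (- 1) * exp (- real (Suc n) * \<psi> x)" for n x
  show ?thesis
  proof (rule that[of \<phi>])
    fix n
    have "smooth (\<phi> n)"
      unfolding \<phi>_def by (intro smooth_add smooth_mult smooth_const smooth_compose[OF smooth_exp_scaled sm])
    moreover have "{x. \<phi> n x \<noteq> 0} = box a b"
      using zero by (auto simp: \<phi>_def)
    ultimately show "\<phi> n \<in> test_functions \<Omega>"
      using assms by (simp add: test_functions_def closure_box)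
    show "\<bar>\<phi> n x\<bar> \<le> 1" for x
    proof -
      have "0 \<le> real (Suc n) * \<psi> x" using nn[of x] by (intro mult_nonneg_nonneg) auto
      then have "- real (Suc n) * \<psi> x \<le> 0" by (simp only: mult_minus_left neg_le_0_iff_le)
      then have "exp (- real (Suc n) * \<psi> x) \<le> 1" by (simp only: exp_le_one_iff)
      moreover have "exp (- real (Suc n) * \<psi> x) > 0" by simp
      ultimately show ?thesis unfolding \<phi>_def abs_le_iff by linarith
    qed
  next
    fix x
    show "(\<lambda>n. \<phi> n x) \<longlonglongrightarrow> indicator (box a b) x"
    proof (cases "x \<in> box a b")
      case True
      then have "\<psi> x > 0" using zero[of x] nn[of x] by linarith
      have "(\<lambda>n. exp (- \<psi> x) ^ Suc n) \<longlonglongrightarrow> 0"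
        using \<open>\<psi> x > 0\<close> by (intro LIMSEQ_Suc LIMSEQ_realpow_zero) auto
      moreover have "exp (- \<psi> x) ^ Suc n = exp (- real (Suc n) * \<psi> x)" for n
        by (subst exp_of_nat_mult[symmetric]) (simp add: algebra_simps)
      ultimately have "(\<lambda>n. exp (- real (Suc n) * \<psi> x)) \<longlonglongrightarrow> 0" by (simp only:)
      then have "(\<lambda>n. 1 + (- 1) * exp (- real (Suc n) * \<psi> x)) \<longlonglongrightarrow> 1 + (- 1) * 0"
        by (intro tendsto_add tendsto_mult tendsto_const)
      then show ?thesis using True by (simp add: \<phi>_def)
    next
      case False
      then show ?thesis using zero[of x] by (simp add: \<phi>_def)
    qed
  qed
qed

text \<open>Approximating indicators by test functions shows that \<open>D\<close> has integral zero
  over every nondegenerate box whose closure lies in \<Omega>. Lebesgue differentiation along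
  shrinking cubes then gives the value 0 at almost every point.\<close>

lemma fundamental_lemma_calculus_of_variations:
  fixes D :: "'a::euclidean_space \<Rightarrow> real"
  assumes \<Omega>: "open \<Omega>" and D: "set_integrable lebesgue \<Omega> D"
    and test: "\<And>\<phi>. \<phi> \<in> test_functions \<Omega> \<Longrightarrow> (LINT x:\<Omega>|lebesgue. D x * \<phi> x) = 0"
  shows "AE x in lebesgue. x \<in> \<Omega> \<longrightarrow> D x = 0"
proof -
  define F where "F x = indicator \<Omega> x *\<^sub>R D x" for x
  have F: "integrable lebesgue F" using D by (simp add: F_def[abs_def] set_integrable_def)
  have F_on: "F integrable_on cbox a b" for a b
    using integrable_on_lebesgue[OF F] by (rule integrable_on_subcbox) auto
  have zero: "integral (cbox a b) F = 0" if ab: "box a b \<noteq> {}" "cbox a b \<subseteq> \<Omega>" for a b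
  proof -
    obtain \<phi> where \<phi>: "\<And>n. \<phi> n \<in> test_functions \<Omega>" "\<And>n x. \<bar>\<phi> n x\<bar> \<le> (1::real)"
      "\<And>x. (\<lambda>n. \<phi> n x) \<longlonglongrightarrow> indicator (box a b) x"
      using test_functions_approximate_box[OF ab] by blast
    have [measurable]: "\<phi> n \<in> borel_measurable borel" for n
      using \<phi>(1)[of n] by (intro borel_measurable_continuous_onI smooth_continuous) (simp add: test_functions_def)
    have \<phi>m [measurable]: "\<phi> n \<in> borel_measurable lebesgue" for n
      by (intro measurable_completion) simp
    have [measurable]: "F \<in> borel_measurable lebesgue" using F by simp
    have [measurable]: "box a b \<in> sets lebesgue" by simp
    have "(\<lambda>n. LINT x|lebesgue. F x * \<phi> n x) \<longlonglongrightarrow> (LINT x|lebesgue. F x * indicator (box a b) x)"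
    proof (rule integral_dominated_convergence[where w="\<lambda>x. \<bar>F x\<bar>"])
      show "integrable lebesgue (\<lambda>x. \<bar>F x\<bar>)" using F by simp
      show "AE x in lebesgue. (\<lambda>n. F x * \<phi> n x) \<longlonglongrightarrow> F x * indicator (box a b) x"
        by (intro always_eventually allI tendsto_intros \<phi>(3))
      show "AE x in lebesgue. norm (F x * \<phi> n x) \<le> \<bar>F x\<bar>" for n
        using \<phi>(2) by (intro always_eventually allI) (auto simp: abs_mult mult_left_le)
    qed measurable
    moreover have "(LINT x|lebesgue. F x * \<phi> n x) = 0" for n
      using test[OF \<phi>(1)[of n]] by (simp add: F_def set_lebesgue_integral_def mult.assoc)
    ultimately have "(LINT x|lebesgue. F x * indicator (box a b) x) = 0"
      by (simp add: LIMSEQ_const_iff)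
    then have "(LINT x:box a b|lebesgue. F x) = 0"
      by (simp add: set_lebesgue_integral_def mult.commute)
    moreover have "set_integrable lebesgue (box a b) F"
      unfolding set_integrable_def using F by (intro integrable_mult_indicator) auto
    ultimately have "integral (box a b) F = 0"
      by (simp add: set_lebesgue_integral_eq_integral)
    then show ?thesis by (simp add: integral_open_interval)
  qed
  obtain N where N: "negligible N"
    "\<And>x e. \<lbrakk>x \<notin> N; 0 < e\<rbrakk> \<Longrightarrow> \<exists>d>0. \<forall>h. 0 < h \<and> h < d \<longrightarrow>
       norm (integral (cbox x (x + h *\<^sub>R One)) F /\<^sub>R h ^ DIM('a) - F x) < e"
    using integrable_ccontinuous_explicit[OF F_on] by blast
  have "D x = 0" if x: "x \<in> \<Omega>" "x \<notin> N" for x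
  proof (rule ccontr)
    assume "D x \<noteq> 0"
    then have "norm (F x) > 0" using x by (simp add: F_def)
    from N(2)[OF x(2) this] obtain d where d: "d > 0"
      "\<And>h. 0 < h \<Longrightarrow> h < d \<Longrightarrow> norm (integral (cbox x (x + h *\<^sub>R One)) F /\<^sub>R h ^ DIM('a) - F x) < norm (F x)"
      by blast
    obtain \<epsilon> where \<epsilon>: "\<epsilon> > 0" "ball x \<epsilon> \<subseteq> \<Omega>" using \<Omega> x(1) openE by blast
    \<comment> \<open>Every point of the cube of side h is within DIM * h of \<open>x\<close>, so
      the cube stays inside the ball contained in \<Omega>.\<close>
    define h where "h = min (d / 2) (\<epsilon> / (2 * real DIM('a)))"
    have h: "h > 0" "h < d" using d \<epsilon> by (auto simp: h_def)
    have hD: "real DIM('a) * h < \<epsilon>"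
    proof -
      have "real DIM('a) * h \<le> real DIM('a) * (\<epsilon> / (2 * real DIM('a)))"
        by (intro mult_left_mono) (auto simp: h_def)
      also have "\<dots> = \<epsilon> / 2" by simp
      finally show ?thesis using \<epsilon> by simp
    qed
    have "cbox x (x + h *\<^sub>R One) \<subseteq> ball x \<epsilon>"
    proof
      fix y assume y: "y \<in> cbox x (x + h *\<^sub>R One)"
      have "norm (y - x) \<le> (\<Sum>i\<in>Basis. \<bar>(y - x) \<bullet> i\<bar>)" by (rule norm_le_l1)
      also have "\<dots> \<le> (\<Sum>i\<in>(Basis::'a set). h)"
        using y by (intro sum_mono) (auto simp: mem_box inner_diff_left inner_add_left)
      finally show "y \<in> ball x \<epsilon>" using hD by (simp add: dist_norm norm_minus_commute)
    qed
    then have "integral (cbox x (x + h *\<^sub>R One)) F = 0"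
      using h \<epsilon> by (intro zero) (auto simp: box_eq_empty inner_add_left not_le)
    then show False using d(2)[OF h] by simp
  qed
  then have "{x. \<not> (x \<in> \<Omega> \<longrightarrow> D x = 0)} \<subseteq> N" by blast
  then show ?thesis
    using N(1) by (intro AE_I'[of N]) (auto simp: negligible_iff_null_sets)
qed

subsection \<open>Convergence in Lebesgue spaces\<close>

text \<open>An elementary substitute for Hoelder's inequality: below \<delta> the first term
  suffices, and above it s^(p-q) \<le> \<delta>^(p-q) because p - q \<le> 0.\<close>

lemma powr_le_split:
  fixes s \<delta> p q :: real
  assumes "s \<ge> 0" "\<delta> > 0" "0 < p" "p \<le> q"
  shows "s powr p \<le> \<delta> powr p + \<delta> powr (p - q) * s powr q"
proof (cases "s \<le> \<delta>")
  case True
  then have "s powr p \<le> \<delta> powr p" using assms by (intro powr_mono2) auto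
  then show ?thesis by (simp add: add_increasing2)
next
  case False
  have "s powr p = s powr (p - q) * s powr q" by (simp flip: powr_add)
  also have "\<dots> \<le> \<delta> powr (p - q) * s powr q"
    using False assms by (intro mult_right_mono powr_mono2') auto
  finally show ?thesis by (simp add: add_increasing)
qed

lemma ennreal_tendsto_0_iff:
  fixes a :: "nat \<Rightarrow> ennreal"
  shows "a \<longlonglongrightarrow> 0 \<longleftrightarrow> (\<forall>e>0. eventually (\<lambda>n. a n < ennreal e) sequentially)"
proof
  assume "a \<longlonglongrightarrow> 0"
  then show "\<forall>e>0. eventually (\<lambda>n. a n < ennreal e) sequentially"
    by (auto intro: order_tendstoD(2))
next
  assume *: "\<forall>e>0. eventually (\<lambda>n. a n < ennreal e) sequentially"
  show "a \<longlonglongrightarrow> 0"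
  proof (rule order_tendstoI)
    fix b :: ennreal assume "0 < b"
    then obtain c where c: "0 < c" "c < b" using dense by blast
    then obtain r where r: "c = ennreal r" "r > 0"
      by (cases c) (auto simp: top_unique)
    show "eventually (\<lambda>n. a n < b) sequentially"
      using *[rule_format, OF r(2)] by eventually_elim (use c r in auto)
  qed simp
qed

text \<open>With \<delta> fixed small, the splitting bounds the p-integral by a small multiple of
  the total mass plus a constant times the q-integral, which tends to 0. It serves both volume and
  boundary area.\<close>

lemma (in finite_measure) powr_integral_tendsto_0_lower_exponent:
  fixes f :: "nat \<Rightarrow> 'a \<Rightarrow> real"
  assumes p: "0 < p" "p \<le> q" and f [measurable]: "\<And>k. f k \<in> borel_measurable M"
    and nn: "\<And>k x. f k x \<ge> 0"
    and lim: "(\<lambda>k. \<integral>\<^sup>+x. ennreal (f k x powr q) \<partial>M) \<longlonglongrightarrow> 0"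
  shows "(\<lambda>k. \<integral>\<^sup>+x. ennreal (f k x powr p) \<partial>M) \<longlonglongrightarrow> 0"
  unfolding ennreal_tendsto_0_iff
proof (intro allI impI)
  let ?I = "\<lambda>p k. \<integral>\<^sup>+x. ennreal (f k x powr p) \<partial>M"
  fix e :: real assume e: "e > 0"
  define m where "m = measure M (space M)"
  define t where "t = e / (2 * (m + 1))"
  have m: "m \<ge> 0" by (simp add: m_def)
  have t: "t > 0" "t * m \<le> e / 2"
  proof -
    show "t > 0" using e m by (simp add: t_def)
    have "t * m = (e / 2) * (m / (m + 1))" using m by (simp add: t_def)
    also have "\<dots> \<le> e / 2" using m e by (intro mult_left_le) (auto simp: divide_le_eq)
    finally show "t * m \<le> e / 2" .
  qed
  define \<delta> where "\<delta> = t powr (1 / p)"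
  have \<delta>: "\<delta> > 0" "\<delta> powr p = t" using t p by (auto simp: \<delta>_def powr_powr)
  have bound: "?I p k \<le> ennreal (e / 2) + ennreal (\<delta> powr (p - q)) * ?I q k" for k
  proof -
    have "?I p k \<le> (\<integral>\<^sup>+x. ennreal t + ennreal (\<delta> powr (p - q)) * ennreal (f k x powr q) \<partial>M)"
      using powr_le_split[OF nn \<delta>(1) p] t \<delta>(2)
      by (intro nn_integral_mono) (auto simp: ennreal_mult[symmetric] simp flip: ennreal_plus intro!: ennreal_leI)
    also have "\<dots> = ennreal t * emeasure M (space M) + ennreal (\<delta> powr (p - q)) * ?I q k"
      by (subst nn_integral_add) (auto simp: nn_integral_cmult)
    also have "ennreal t * emeasure M (space M) = ennreal (t * m)"
      using t m by (simp add: emeasure_eq_measure m_def ennreal_mult)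
    also have "ennreal (t * m) \<le> ennreal (e / 2)" by (rule ennreal_leI[OF t(2)])
    finally show ?thesis by (simp add: add_right_mono)
  qed
  have "(\<lambda>k. ennreal (\<delta> powr (p - q)) * ?I q k) \<longlonglongrightarrow> ennreal (\<delta> powr (p - q)) * 0"
    using lim by (intro ennreal_tendsto_cmult) auto
  then have "(\<lambda>k. ennreal (\<delta> powr (p - q)) * ?I q k) \<longlonglongrightarrow> 0" by simp
  then have "eventually (\<lambda>k. ennreal (\<delta> powr (p - q)) * ?I q k < ennreal (e / 2)) sequentially"
    unfolding ennreal_tendsto_0_iff using e by simp
  then show "eventually (\<lambda>k. ?I p k < ennreal e) sequentially"
  proof eventually_elim
    case (elim k)
    have "?I p k \<le> ennreal (e / 2) + ennreal (\<delta> powr (p - q)) * ?I q k"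
      by (rule bound)
    also have "\<dots> < ennreal (e / 2) + ennreal (e / 2)"
      using elim by (simp add: ennreal_add_left_cancel_less)
    also have "\<dots> = ennreal e" using e by (simp flip: ennreal_plus)
    finally show ?case .
  qed
qed

lemma finite_measure_lebesgue_on_bounded_open:
  assumes "open \<Omega>" "bounded \<Omega>"
  shows "finite_measure (lebesgue_on \<Omega>)"
  using assms by (intro finite_measure_lebesgue_on lmeasurable_open) auto

lemma
  fixes f :: "real^3 \<Rightarrow> 'b::euclidean_space"
  assumes f: "Lq_on q \<Omega> f" and \<Omega>: "open \<Omega>" "bounded \<Omega>" and q: "2 < q"
  shows Lq_on_measurable: "f \<in> borel_measurable (lebesgue_on \<Omega>)"
    and Lq_on_integrable_powr: "integrable (lebesgue_on \<Omega>) (\<lambda>x. norm (f x) powr q)"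
    and Lq_on_integrable_square: "integrable (lebesgue_on \<Omega>) (\<lambda>x. (norm (f x))\<^sup>2)"
    and Lq_on_integrable: "integrable (lebesgue_on \<Omega>) f"
proof -
  interpret finite_measure "lebesgue_on \<Omega>" by (rule finite_measure_lebesgue_on_bounded_open[OF \<Omega>])
  have \<Omega>m: "\<Omega> \<in> sets lebesgue" using \<Omega> by auto
  show m [measurable]: "f \<in> borel_measurable (lebesgue_on \<Omega>)"
    using f \<Omega>m by (simp add: Lq_on_def set_borel_measurable_def borel_measurable_restrict_space_iff)
  show i: "integrable (lebesgue_on \<Omega>) (\<lambda>x. norm (f x) powr q)"
    using f \<Omega>m by (simp add: Lq_on_def set_integrable_def integrable_restrict_space)
  have sq: "(norm (f x))\<^sup>2 \<le> 1 + norm (f x) powr q" for x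
    using powr_le_split[of "norm (f x)" 1 2 q] q by (simp add: powr_numeral)
  show i2: "integrable (lebesgue_on \<Omega>) (\<lambda>x. (norm (f x))\<^sup>2)"
    using sq by (intro Bochner_Integration.integrable_bound[OF Bochner_Integration.integrable_add[OF integrable_const[of 1] i]])
      (auto intro!: AE_I2)
  have "norm (f x) \<le> 1 + (norm (f x))\<^sup>2" for x
    using zero_le_power2[of "norm (f x) - 1"] by (simp add: power2_diff) (smt (verit) norm_ge_zero)
  then show "integrable (lebesgue_on \<Omega>) f"
    by (intro Bochner_Integration.integrable_bound[OF Bochner_Integration.integrable_add[OF integrable_const[of 1] i2]])
      (auto intro!: AE_I2)
qed

lemma jacobian_component:
  fixes v :: "real^3 \<Rightarrow> real^3"
  assumes "\<And>i. ((\<lambda>x. v x $ i) has_derivative (\<lambda>h. w i \<bullet> h)) (at x)"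
  shows "jacobian v (at x) $ i $ j = w i $ j"
proof -
  have "(v has_derivative (\<lambda>h. \<chi> i. w i \<bullet> h)) (at x)"
    unfolding has_derivative_componentwise_within[of v]
    using assms by (auto simp: Basis_vec_def inner_axis)
  then have "frechet_derivative v (at x) = (\<lambda>h. \<chi> i. w i \<bullet> h)"
    by (rule frechet_derivative_at[symmetric])
  then show ?thesis by (simp add: jacobian_def matrix_def inner_axis)
qed

lemma continuous_on_UNIV_lebesgue_on:
  fixes f :: "'a::euclidean_space \<Rightarrow> 'b::euclidean_space"
  assumes "continuous_on UNIV f" "open \<Omega>" "bounded \<Omega>"
  shows "f \<in> borel_measurable (lebesgue_on \<Omega>)" and "\<exists>B\<ge>0. \<forall>x\<in>\<Omega>. norm (f x) \<le> B"
proof -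
  have "f \<in> borel_measurable borel" using assms(1) by (rule borel_measurable_continuous_onI)
  then have "f \<in> borel_measurable lebesgue" by (intro measurable_completion) simp
  then show "f \<in> borel_measurable (lebesgue_on \<Omega>)" by (rule measurable_restrict_space1)
  have "compact (f ` closure \<Omega>)"
    using assms by (intro compact_continuous_image) (auto intro: continuous_on_subset)
  then obtain B where "\<And>x. x \<in> closure \<Omega> \<Longrightarrow> norm (f x) \<le> B"
    by (metis compact_imp_bounded bounded_iff imageI)
  then show "\<exists>B\<ge>0. \<forall>x\<in>\<Omega>. norm (f x) \<le> B"
    using closure_subset[of \<Omega>] by (intro exI[of _ "max B 0"]) (auto simp: le_max_iff_disj)
qed

lemma integrable_mult_bounded_continuous:
  fixes f g :: "'a::euclidean_space \<Rightarrow> real"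
  assumes f: "integrable (lebesgue_on \<Omega>) f" and g: "continuous_on UNIV g" and \<Omega>: "open \<Omega>" "bounded \<Omega>"
  shows "integrable (lebesgue_on \<Omega>) (\<lambda>x. f x * g x)"
proof -
  obtain B where B: "B \<ge> 0" "\<And>x. x \<in> \<Omega> \<Longrightarrow> norm (g x) \<le> B"
    using continuous_on_UNIV_lebesgue_on(2)[OF g \<Omega>] by blast
  have [measurable]: "g \<in> borel_measurable (lebesgue_on \<Omega>)" "f \<in> borel_measurable (lebesgue_on \<Omega>)"
    using continuous_on_UNIV_lebesgue_on(1)[OF g \<Omega>] f by auto
  show ?thesis
  proof (rule Bochner_Integration.integrable_bound[OF integrable_mult_right[OF integrable_norm[OF f], of B]])
    show "AE x in lebesgue_on \<Omega>. norm (f x * g x) \<le> norm (B * norm (f x))"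
      using B by (intro AE_I2) (auto simp: abs_mult mult.commute[of B] intro!: mult_left_mono)
  qed measurable
qed

lemma integral_lborel_eq_lebesgue_on:
  fixes f :: "'a::euclidean_space \<Rightarrow> real"
  assumes "f \<in> borel_measurable borel" "open \<Omega>"
  shows "(LINT x:\<Omega>|lborel. f x) = integral\<^sup>L (lebesgue_on \<Omega>) f"
proof -
  have "\<Omega> \<in> sets borel" using assms(2) by simp
  then have "(\<lambda>x. indicator \<Omega> x *\<^sub>R f x) \<in> borel_measurable lborel" using assms(1) by simp
  then have "(LINT x:\<Omega>|lborel. f x) = (LINT x:\<Omega>|lebesgue. f x)"
    unfolding set_lebesgue_integral_def by (rule integral_completion[symmetric])
  also have "\<dots> = integral\<^sup>L (lebesgue_on \<Omega>) f"
    using \<open>\<Omega> \<in> sets borel\<close> by (simp add: set_lebesgue_integral_def integral_restrict_space)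
  finally show ?thesis .
qed

subsection \<open>Null Lagrangians under affine boundary conditions\<close>

lemma entry_le_norm: "\<bar>A $ i $ j\<bar> \<le> norm A" for A :: "real^3^3"
  using component_le_norm_cart[of "A $ i" j] Finite_Cartesian_Product.norm_nth_le[of A i] by linarith

lemma bounded_linear_entry: "bounded_linear (\<lambda>A :: real^3^3. A $ i $ j)"
  by (rule bounded_linear_compose[OF bounded_linear_vec_nth bounded_linear_vec_nth])

text \<open>The data extracted from an admissible map, with \<open>F\<close> to be instantiated by
  its weak gradient. The gradients \<open>w k i\<close> of the components of the approximating maps
  are fixed as part of the data, so that they can serve as test factors and be differentiated once
  more.\<close>

locale affine_trace_approximation =
  fixes \<Omega> :: "(real^3) set" and q lam :: real
    and u :: "real^3 \<Rightarrow> real^3" and F :: "real^3 \<Rightarrow> real^3^3"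
    and v :: "nat \<Rightarrow> real^3 \<Rightarrow> real^3" and w :: "nat \<Rightarrow> 3 \<Rightarrow> real^3 \<Rightarrow> real^3"
  assumes domain: "lipschitz_domain \<Omega>" and q: "2 < q"
    and u: "Lq_on q \<Omega> u" and F: "Lq_on q \<Omega> F"
    and v_smooth: "\<And>k i. smooth (\<lambda>x. v k x $ i)"
    and v_grad: "\<And>k i x. ((\<lambda>x. v k x $ i) has_derivative (\<lambda>h. w k i x \<bullet> h)) (at x)"
    and w_smooth: "\<And>k i j. smooth (\<lambda>x. w k i x $ j)"
    and v_lim: "(\<lambda>k. \<integral>\<^sup>+x\<in>\<Omega>. ennreal (norm (v k x - u x) powr q) \<partial>lebesgue) \<longlonglongrightarrow> 0"
    and w_lim: "(\<lambda>k. \<integral>\<^sup>+x\<in>\<Omega>. ennreal (norm (jacobian (v k) (at x) - F x) powr q) \<partial>lebesgue) \<longlonglongrightarrow> 0"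
    and trace_lim: "(\<lambda>k. \<integral>\<^sup>+x\<in>frontier \<Omega>. ennreal (norm (v k x - u_lin lam x) powr q) \<partial>hausdorff2) \<longlonglongrightarrow> 0"
begin

abbreviation M where "M \<equiv> lebesgue_on \<Omega>"

abbreviation G where "G x \<equiv> F x - lam *\<^sub>R mat 1"

lemma open_bounded: "open \<Omega>" "bounded \<Omega>"
  using domain by (auto simp: lipschitz_domain_def)

lemma Omega_sets: "\<Omega> \<in> sets lebesgue" using open_bounded by auto

sublocale M: finite_measure M
  by (rule finite_measure_lebesgue_on_bounded_open[OF open_bounded])

lemma nn_integral_Omega: "(\<integral>\<^sup>+x\<in>\<Omega>. f x \<partial>lebesgue) = (\<integral>\<^sup>+x. f x \<partial>M)"
  using Omega_sets by (simp add: nn_integral_restrict_space)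

lemma measurable_uF [measurable]: "u \<in> borel_measurable M" "F \<in> borel_measurable M"
  using Lq_on_measurable[OF u open_bounded q] Lq_on_measurable[OF F open_bounded q] by auto

lemma jacobian_v: "jacobian (v k) (at x) = (\<chi> i. w k i x)"
  by (simp add: vec_eq_iff jacobian_component[OF v_grad])

lemma continuous_w: "continuous_on UNIV (w k i)"
proof -
  have "continuous_on UNIV (\<lambda>x. \<chi> j. w k i x $ j)"
    by (intro continuous_on_vec_lambda smooth_continuous w_smooth)
  then show ?thesis by simp
qed

lemma continuous_v: "continuous_on UNIV (v k)"
proof -
  have "continuous_on UNIV (\<lambda>x. \<chi> j. v k x $ j)"
    by (intro continuous_on_vec_lambda smooth_continuous v_smooth)
  then show ?thesis by simp
qed

lemma measurable_v [measurable]: "v k \<in> borel_measurable M"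
  by (rule continuous_on_UNIV_lebesgue_on(1)[OF continuous_v open_bounded])

lemma measurable_jacobian [measurable]: "(\<lambda>x. jacobian (v k) (at x)) \<in> borel_measurable M"
  unfolding jacobian_v
  by (intro continuous_on_UNIV_lebesgue_on(1)[OF _ open_bounded] continuous_on_vec_lambda continuous_w)

lemma L1_lim_v: "(\<lambda>k. \<integral>\<^sup>+x. ennreal (norm (v k x - u x)) \<partial>M) \<longlonglongrightarrow> 0"
  using M.powr_integral_tendsto_0_lower_exponent[of 1 q "\<lambda>k x. norm (v k x - u x)"] v_lim q
  by (simp add: nn_integral_Omega)

lemma L1_lim_jacobian: "(\<lambda>k. \<integral>\<^sup>+x. ennreal (norm (jacobian (v k) (at x) - F x)) \<partial>M) \<longlonglongrightarrow> 0"
  using M.powr_integral_tendsto_0_lower_exponent[of 1 q "\<lambda>k x. norm (jacobian (v k) (at x) - F x)"] w_lim q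
  by (simp add: nn_integral_Omega)

lemma L2_lim_jacobian: "(\<lambda>k. \<integral>\<^sup>+x. ennreal ((norm (jacobian (v k) (at x) - F x))\<^sup>2) \<partial>M) \<longlonglongrightarrow> 0"
  using M.powr_integral_tendsto_0_lower_exponent[of 2 q "\<lambda>k x. norm (jacobian (v k) (at x) - F x)"] w_lim q
  by (simp add: nn_integral_Omega)

text \<open>Lowering the exponent from \<open>q\<close> to 1 on the boundary requires finite area,
  which the Lipschitz charts provide.\<close>

lemma L1_lim_trace: "(\<lambda>k. \<integral>\<^sup>+x\<in>frontier \<Omega>. ennreal (norm (v k x - u_lin lam x)) \<partial>hausdorff2) \<longlonglongrightarrow> 0"
proof -
  have fr: "frontier \<Omega> \<in> sets borel" by simp
  have fin: "finite_measure (restrict_space hausdorff2 (frontier \<Omega>))"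
    using hausdorff2_outer_frontier_lipschitz_domain[OF domain]
    by (intro finite_measureI) (simp add: emeasure_restrict_space emeasure_hausdorff2 less_top[symmetric])
  have eq: "(\<integral>\<^sup>+x\<in>frontier \<Omega>. f x \<partial>hausdorff2) = (\<integral>\<^sup>+x. f x \<partial>restrict_space hausdorff2 (frontier \<Omega>))" for f
    by (subst nn_integral_restrict_space) auto
  have "continuous_on UNIV (\<lambda>x. norm (v k x - u_lin lam x))" for k
    unfolding u_lin_def by (intro continuous_intros continuous_v)
  then have "(\<lambda>x. norm (v k x - u_lin lam x)) \<in> borel_measurable hausdorff2" for k
    using borel_measurable_continuous_onI measurable_cong_sets[OF sets_hausdorff2 refl] by blast
  then have m: "(\<lambda>x. norm (v k x - u_lin lam x)) \<in> borel_measurable (restrict_space hausdorff2 (frontier \<Omega>))" for k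
    by (rule measurable_restrict_space1)
  show ?thesis
    using finite_measure.powr_integral_tendsto_0_lower_exponent[OF fin _ _ m, of 1 q] trace_lim q
    by (simp add: eq)
qed

lemma integrable_F: "integrable M (\<lambda>x. F x $ i $ j)"
  by (rule integrable_bounded_linear[OF bounded_linear_entry Lq_on_integrable[OF F open_bounded q]])

lemma integrable_u: "integrable M (\<lambda>x. u x $ i)"
  by (rule integrable_bounded_linear[OF bounded_linear_vec_nth Lq_on_integrable[OF u open_bounded q]])

lemma integrable_F_mult_F: "integrable M (\<lambda>x. F x $ i $ a * F x $ j $ b)"
proof (rule Bochner_Integration.integrable_bound[OF Lq_on_integrable_square[OF F open_bounded q]])
  show "(\<lambda>x. F x $ i $ a * F x $ j $ b) \<in> borel_measurable M"
    using integrable_F by (intro borel_measurable_times) auto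
  show "AE x in M. norm (F x $ i $ a * F x $ j $ b) \<le> norm ((norm (F x))\<^sup>2)"
    by (intro AE_I2) (auto simp: abs_mult power2_eq_square intro!: mult_mono entry_le_norm)
qed

text \<open>The integrand is formally the j-th derivative of (u - u_\<lambda>)_i \<phi>. For the
  approximations it is a genuine derivative \<open>g k x \<bullet> axis j 1\<close>, whose integral
  is controlled by the boundary values of \<open>f k\<close>; and since \<phi> and \<psi> are
  bounded on \<Omega>, L^1 convergence of \<open>v k\<close> and of its Jacobian carries the
  interior integral to the limit.\<close>

lemma integration_by_parts:
  fixes \<phi> :: "real^3 \<Rightarrow> real" and i j :: 3
  assumes \<phi>: "\<And>x. (\<phi> has_derivative (\<lambda>h. \<psi> x \<bullet> h)) (at x)" "continuous_on UNIV \<psi>"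
  shows "integral\<^sup>L M (\<lambda>x. G x $ i $ j * \<phi> x + (u x $ i - lam * x $ i) * \<psi> x $ j) = 0"
proof -
  have cont\<phi>: "continuous_on UNIV \<phi>" using \<phi>(1) by (meson continuous_at_imp_continuous_on has_derivative_continuous)
  define f where "f k x = (v k x $ i - lam * x $ i) * \<phi> x" for k x
  define g where "g k x = (v k x $ i - lam * x $ i) *\<^sub>R \<psi> x + \<phi> x *\<^sub>R (w k i x - lam *\<^sub>R axis i 1)" for k x
  define H where "H x = G x $ i $ j * \<phi> x + (u x $ i - lam * x $ i) * \<psi> x $ j" for x
  have der: "(f k has_derivative (\<lambda>h. g k x \<bullet> h)) (at x)" for k x
  proof -
    have "((\<lambda>x. lam * x $ i) has_derivative (\<lambda>h. lam * h $ i)) (at x)"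
      by (intro has_derivative_mult_right bounded_linear_imp_has_derivative bounded_linear_vec_nth)
    then have "((\<lambda>x. v k x $ i - lam * x $ i) has_derivative (\<lambda>h. w k i x \<bullet> h - lam * h $ i)) (at x)"
      by (intro has_derivative_diff v_grad)
    from has_derivative_mult[OF this \<phi>(1)] show ?thesis
      unfolding f_def
      by (rule has_derivative_eq_rhs)
        (auto simp: g_def fun_eq_iff inner_add_left inner_diff_left inner_axis' algebra_simps)
  qed
  have contg: "continuous_on UNIV (g k)" for k
    unfolding g_def by (intro continuous_intros cont\<phi> \<phi>(2) continuous_w continuous_v)
  have gj: "g k x \<bullet> axis j 1 = (v k x $ i - lam * x $ i) * \<psi> x $ j + \<phi> x * (w k i x $ j - lam * mat 1 $ i $ j)" for k x
    by (simp add: g_def inner_axis mat_def) (auto simp: axis_def)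
  have boundary: "(\<lambda>k. ennreal \<bar>LINT x:\<Omega>|lborel. g k x \<bullet> axis j 1\<bar>) \<longlonglongrightarrow> 0"
  proof -
    have "compact (\<phi> ` frontier \<Omega>)"
      using open_bounded cont\<phi> by (intro compact_continuous_image compact_frontier_bounded) (auto intro: continuous_on_subset)
    then obtain B0 where B0: "\<And>x. x \<in> frontier \<Omega> \<Longrightarrow> norm (\<phi> x) \<le> B0"
      by (metis compact_imp_bounded bounded_iff imageI)
    define B where "B = max B0 0"
    have B: "B \<ge> 0" "\<And>x. x \<in> frontier \<Omega> \<Longrightarrow> \<bar>\<phi> x\<bar> \<le> B"
      using B0 by (auto simp: B_def le_max_iff_disj)
    let ?T = "\<lambda>k. \<integral>\<^sup>+x\<in>frontier \<Omega>. ennreal (norm (v k x - u_lin lam x)) \<partial>hausdorff2"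
    have le: "ennreal \<bar>LINT x:\<Omega>|lborel. g k x \<bullet> axis j 1\<bar> \<le> 4096 * (ennreal B * ?T k)" for k
    proof -
      have "ennreal \<bar>LINT x:\<Omega>|lborel. g k x \<bullet> axis j 1\<bar> \<le> 4096 * (\<integral>\<^sup>+x\<in>frontier \<Omega>. ennreal \<bar>f k x\<bar> \<partial>hausdorff2)"
        by (rule abs_integral_partial_derivative_le_boundary[OF open_bounded
              hausdorff2_outer_frontier_lipschitz_domain[OF domain] der contg]) simp
      also have "(\<integral>\<^sup>+x\<in>frontier \<Omega>. ennreal \<bar>f k x\<bar> \<partial>hausdorff2) \<le>
          (\<integral>\<^sup>+x. ennreal B * (ennreal (norm (v k x - u_lin lam x)) * indicator (frontier \<Omega>) x) \<partial>hausdorff2)"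
      proof (rule nn_integral_mono)
        fix x
        show "ennreal \<bar>f k x\<bar> * indicator (frontier \<Omega>) x \<le>
            ennreal B * (ennreal (norm (v k x - u_lin lam x)) * indicator (frontier \<Omega>) x)"
        proof (cases "x \<in> frontier \<Omega>")
          case True
          have "\<bar>v k x $ i - lam * x $ i\<bar> \<le> norm (v k x - u_lin lam x)"
            using component_le_norm_cart[of "v k x - u_lin lam x" i] by (simp add: u_lin_def)
          then have "\<bar>f k x\<bar> \<le> B * norm (v k x - u_lin lam x)"
            unfolding f_def abs_mult using B(2)[OF True] B(1)
            by (subst mult.commute) (intro mult_mono; simp)
          then show ?thesis using True B(1) by (simp add: ennreal_mult[symmetric] ennreal_leI)
        qed simp
      qed
      also have "\<dots> = ennreal B * ?T k"
      proof (rule nn_integral_cmult)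
        have "continuous_on UNIV (\<lambda>x. norm (v k x - u_lin lam x))"
          unfolding u_lin_def by (intro continuous_intros continuous_v)
        then have "(\<lambda>x. norm (v k x - u_lin lam x)) \<in> borel_measurable borel"
          by (rule borel_measurable_continuous_onI)
        then have "(\<lambda>x. ennreal (norm (v k x - u_lin lam x)) * indicator (frontier \<Omega>) x) \<in> borel_measurable borel"
          by (intro borel_measurable_times_ennreal measurable_compose[OF _ measurable_ennreal] borel_measurable_indicator) auto
        then show "(\<lambda>x. ennreal (norm (v k x - u_lin lam x)) * indicator (frontier \<Omega>) x) \<in> borel_measurable hausdorff2"
          using measurable_cong_sets[OF sets_hausdorff2 refl] by blast
      qed
      finally show ?thesis by (simp add: mult_left_mono)
    qed
    have "(\<lambda>k. ennreal B * ?T k) \<longlonglongrightarrow> ennreal B * 0"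
      by (intro ennreal_tendsto_cmult L1_lim_trace) simp
    then have "(\<lambda>k. 4096 * (ennreal B * ?T k)) \<longlonglongrightarrow> 4096 * (ennreal B * 0)"
      by (rule ennreal_tendsto_cmult[rotated]) simp
    then have "(\<lambda>k. 4096 * (ennreal B * ?T k)) \<longlonglongrightarrow> 0" by simp
    from tendsto_sandwich[OF _ _ tendsto_const this] show ?thesis using le by auto
  qed
  have borel_g: "(\<lambda>x. g k x \<bullet> axis j 1) \<in> borel_measurable borel" for k
    by (intro borel_measurable_continuous_onI continuous_intros contg)
  have "(\<lambda>k. \<bar>LINT x:\<Omega>|lborel. g k x \<bullet> axis j 1\<bar>) \<longlonglongrightarrow> 0"
    using boundary unfolding ennreal_0[symmetric] by (subst (asm) tendsto_ennreal_iff) auto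
  then have lim0: "(\<lambda>k. integral\<^sup>L M (\<lambda>x. g k x \<bullet> axis j 1)) \<longlonglongrightarrow> 0"
    unfolding integral_lborel_eq_lebesgue_on[OF borel_g open_bounded(1)] by (rule tendsto_rabs_zero_cancel)
  have ig: "integrable M (\<lambda>x. g k x \<bullet> axis j 1)" for k
  proof -
    have "continuous_on UNIV (\<lambda>x. g k x \<bullet> axis j 1)" by (intro continuous_intros contg)
    from integrable_mult_bounded_continuous[OF _ this open_bounded, of "\<lambda>_. 1"] show ?thesis by simp
  qed
  have comp_int: "integrable M (\<lambda>x. G x $ i $ j)" "integrable M (\<lambda>x. u x $ i - lam * x $ i)"
  proof -
    have "integrable M (\<lambda>x. 1 * (lam * x $ i))"
      by (intro integrable_mult_bounded_continuous[OF _ _ open_bounded] continuous_intros) simp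
    then show "integrable M (\<lambda>x. u x $ i - lam * x $ i)" using integrable_u by simp
    show "integrable M (\<lambda>x. G x $ i $ j)" using integrable_F by simp
  qed
  have iH: "integrable M H"
    unfolding H_def
    by (intro Bochner_Integration.integrable_add integrable_mult_bounded_continuous[OF _ _ open_bounded]
        comp_int cont\<phi> continuous_on_component \<phi>(2))
  obtain B1 where B1: "B1 \<ge> 0" "\<And>x. x \<in> \<Omega> \<Longrightarrow> norm (\<phi> x) \<le> B1"
    using continuous_on_UNIV_lebesgue_on(2)[OF cont\<phi> open_bounded] by blast
  obtain B2 where B2: "B2 \<ge> 0" "\<And>x. x \<in> \<Omega> \<Longrightarrow> norm (\<psi> x) \<le> B2"
    using continuous_on_UNIV_lebesgue_on(2)[OF \<phi>(2) open_bounded] by blast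
  let ?b = "\<lambda>k. ennreal B2 * (\<integral>\<^sup>+x. ennreal (norm (v k x - u x)) \<partial>M)
      + ennreal B1 * (\<integral>\<^sup>+x. ennreal (norm (jacobian (v k) (at x) - F x)) \<partial>M)"
  have le: "(\<integral>\<^sup>+x. ennreal (norm (g k x \<bullet> axis j 1 - H x)) \<partial>M) \<le> ?b k" for k
  proof -
    have "(\<integral>\<^sup>+x. ennreal (norm (g k x \<bullet> axis j 1 - H x)) \<partial>M)
      \<le> (\<integral>\<^sup>+x. ennreal B2 * ennreal (norm (v k x - u x)) + ennreal B1 * ennreal (norm (jacobian (v k) (at x) - F x)) \<partial>M)"
    proof (rule nn_integral_mono)
      fix x assume "x \<in> space M"
      then have x: "x \<in> \<Omega>" by simp
      have "g k x \<bullet> axis j 1 - H x = \<psi> x $ j * (v k x - u x) $ i + \<phi> x * (jacobian (v k) (at x) - F x) $ i $ j"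
        unfolding gj H_def jacobian_v by (simp add: algebra_simps)
      also have "\<bar>\<dots>\<bar> \<le> \<bar>\<psi> x $ j\<bar> * \<bar>(v k x - u x) $ i\<bar> + \<bar>\<phi> x\<bar> * \<bar>(jacobian (v k) (at x) - F x) $ i $ j\<bar>"
        unfolding abs_mult[symmetric] by (rule abs_triangle_ineq)
      also have "\<dots> \<le> B2 * norm (v k x - u x) + B1 * norm (jacobian (v k) (at x) - F x)"
      proof (intro add_mono mult_mono B1(1) B2(1))
        show "\<bar>\<psi> x $ j\<bar> \<le> B2" using component_le_norm_cart[of "\<psi> x" j] B2(2)[OF x] by linarith
        show "\<bar>\<phi> x\<bar> \<le> B1" using B1(2)[OF x] by simp
        show "\<bar>(v k x - u x) $ i\<bar> \<le> norm (v k x - u x)" by (rule component_le_norm_cart)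
        show "\<bar>(jacobian (v k) (at x) - F x) $ i $ j\<bar> \<le> norm (jacobian (v k) (at x) - F x)"
          by (rule entry_le_norm)
      qed auto
      finally show "ennreal (norm (g k x \<bullet> axis j 1 - H x)) \<le>
          ennreal B2 * ennreal (norm (v k x - u x)) + ennreal B1 * ennreal (norm (jacobian (v k) (at x) - F x))"
        using B1(1) B2(1) by (simp add: ennreal_mult[symmetric] ennreal_leI flip: ennreal_plus)
    qed
    also have "\<dots> = ?b k"
      by (subst nn_integral_add) (auto simp: nn_integral_cmult)
    finally show ?thesis .
  qed
  have "?b \<longlonglongrightarrow> ennreal B2 * 0 + ennreal B1 * 0"
    by (intro tendsto_add ennreal_tendsto_cmult L1_lim_v L1_lim_jacobian) auto
  then have "?b \<longlonglongrightarrow> 0" by simp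
  then have "(\<lambda>k. \<integral>\<^sup>+x. ennreal (norm (g k x \<bullet> axis j 1 - H x)) \<partial>M) \<longlonglongrightarrow> 0"
    using le tendsto_sandwich[OF _ _ tendsto_const] by (metis (no_types, lifting) always_eventually zero_le)
  from tendsto_L1_int[OF ig iH this] have "(\<lambda>k. integral\<^sup>L M (\<lambda>x. g k x \<bullet> axis j 1)) \<longlonglongrightarrow> integral\<^sup>L M H" .
  then show ?thesis using lim0 LIMSEQ_unique unfolding H_def by blast
qed

section \<open>Integrals of the gradient and of its cofactors\<close>

lemma integral_F: "integral\<^sup>L M (\<lambda>x. F x $ i $ j) = measure M \<Omega> * (lam *\<^sub>R mat 1 :: real^3^3) $ i $ j"
proof -
  have "integral\<^sup>L M (\<lambda>x. G x $ i $ j * 1 + (u x $ i - lam * x $ i) * 0 $ j) = 0"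
    by (rule integration_by_parts[where \<psi>="\<lambda>_. 0"]) (auto intro!: derivative_eq_intros)
  then show ?thesis using integrable_F by simp
qed

text \<open>Only the second factor is smooth, while \<open>G\<close> is already the limit.
  Integration by parts is used with \<phi> = \<partial>_b v_j in direction a and with \<phi> =
  \<partial>_a v_j in direction b; the terms containing u - u_\<lambda> carry the two mixed
  derivatives of v_j and cancel in the difference.\<close>

lemma integral_minor_approx:
  "integral\<^sup>L M (\<lambda>x. G x $ i $ a * w k j x $ b - G x $ i $ b * w k j x $ a) = 0"
proof -
  obtain wb where wb: "\<And>x. ((\<lambda>x. w k j x $ b) has_derivative (\<lambda>h. wb x \<bullet> h)) (at x)"
    "\<And>c. c \<in> Basis \<Longrightarrow> smooth (\<lambda>x. wb x \<bullet> c)" by (rule smooth_gradientE[OF w_smooth]) (rule that)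
  obtain wa where wa: "\<And>x. ((\<lambda>x. w k j x $ a) has_derivative (\<lambda>h. wa x \<bullet> h)) (at x)"
    "\<And>c. c \<in> Basis \<Longrightarrow> smooth (\<lambda>x. wa x \<bullet> c)" by (rule smooth_gradientE[OF w_smooth]) (rule that)
  have cont: "continuous_on UNIV wa" "continuous_on UNIV wb"
    using continuous_gradient wa(2) wb(2) by auto
  have mixed: "wa x $ b = wb x $ a" for x
    using mixed_partials_eq[OF v_grad, of k j "axis a 1" wa "axis b 1" wb x] wa(1) wb(1) cont
    by (simp add: inner_axis)
  have int: "integrable M (\<lambda>x. G x $ i $ c * w k j x $ d)" for c d
    using integrable_F by (intro integrable_mult_bounded_continuous[OF _ _ open_bounded]
        continuous_on_component continuous_w) simp
  have intu: "integrable M (\<lambda>x. (u x $ i - lam * x $ i) * wa x $ b)"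
  proof -
    have "integrable M (\<lambda>x. 1 * (lam * x $ i))"
      by (intro integrable_mult_bounded_continuous[OF _ _ open_bounded] continuous_intros) simp
    then show ?thesis
      using integrable_u by (intro integrable_mult_bounded_continuous[OF _ _ open_bounded]
        continuous_on_component cont) simp
  qed
  have "integral\<^sup>L M (\<lambda>x. G x $ i $ a * w k j x $ b + (u x $ i - lam * x $ i) * wb x $ a) = 0"
    by (rule integration_by_parts[OF wb(1) cont(2)])
  moreover have "integral\<^sup>L M (\<lambda>x. G x $ i $ b * w k j x $ a + (u x $ i - lam * x $ i) * wa x $ b) = 0"
    by (rule integration_by_parts[OF wa(1) cont(1)])
  ultimately show ?thesis
    using int intu by (simp add: mixed Bochner_Integration.integral_add[OF int intu[unfolded mixed]] del: vector_minus_component)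
qed

text \<open>Replacing the smooth second factor by \<open>F\<close> costs at most twice the integral
  of |G| |Dv_k - F|, which tends to 0 by the Cauchy-Schwarz inequality and convergence in
  L^2.\<close>

lemma integral_minor:
  "integral\<^sup>L M (\<lambda>x. F x $ i $ a * F x $ j $ b - F x $ i $ b * F x $ j $ a) =
   measure M \<Omega> * ((lam *\<^sub>R mat 1 :: real^3^3) $ i $ a * (lam *\<^sub>R mat 1 :: real^3^3) $ j $ b
     - (lam *\<^sub>R mat 1 :: real^3^3) $ i $ b * (lam *\<^sub>R mat 1 :: real^3^3) $ j $ a)"
proof -
  let ?A = "lam *\<^sub>R mat 1 :: real^3^3"
  let ?d = "\<lambda>k x. norm (jacobian (v k) (at x) - F x)"
  let ?I = "\<lambda>k. \<integral>\<^sup>+x. ennreal (norm (G x)) * ennreal (?d k x) \<partial>M"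
  let ?X = "\<lambda>k x. G x $ i $ a * w k j x $ b - G x $ i $ b * w k j x $ a"
  let ?Y = "\<lambda>x. G x $ i $ a * F x $ j $ b - G x $ i $ b * F x $ j $ a"
  have FF: "integrable M (\<lambda>x. G x $ i $ c * F x $ j $ d)" for c d
    using integrable_F_mult_F integrable_F by (simp add: left_diff_distrib)
  have C: "(\<integral>\<^sup>+x. ennreal (norm (G x))^2 \<partial>M) < top"
  proof -
    have "(norm (G x))\<^sup>2 \<le> 2 * (norm (F x))\<^sup>2 + 2 * (norm ?A)\<^sup>2" for x
    proof -
      have "(norm (G x))\<^sup>2 \<le> (norm (F x) + norm ?A)\<^sup>2"
        by (intro power_mono norm_triangle_ineq4) simp
      also have "\<dots> \<le> 2 * (norm (F x))\<^sup>2 + 2 * (norm ?A)\<^sup>2"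
        using sum_squares_bound[of "norm (F x)" "norm ?A"] by (simp add: power2_sum)
      finally show ?thesis .
    qed
    moreover have "integrable M (\<lambda>x. 2 * (norm (F x))\<^sup>2 + 2 * (norm ?A)\<^sup>2)"
      using Lq_on_integrable_square[OF F open_bounded q] by simp
    ultimately have "integrable M (\<lambda>x. (norm (G x))\<^sup>2)"
      by (rule_tac Bochner_Integration.integrable_bound) (auto intro!: AE_I2)
    then show ?thesis by (auto simp: integrable_iff_bounded ennreal_power)
  qed
  have CS: "(\<lambda>k. ?I k) \<longlonglongrightarrow> 0"
    unfolding ennreal_tendsto_0_iff
  proof (intro allI impI)
    fix e :: real assume e: "e > 0"
    have "(\<lambda>k. (\<integral>\<^sup>+x. ennreal (norm (G x))^2 \<partial>M) * (\<integral>\<^sup>+x. ennreal ((?d k x)\<^sup>2) \<partial>M)) \<longlonglongrightarrow> (\<integral>\<^sup>+x. ennreal (norm (G x))^2 \<partial>M) * 0"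
      by (intro ennreal_tendsto_cmult L2_lim_jacobian C)
    then have "eventually (\<lambda>k. (\<integral>\<^sup>+x. ennreal (norm (G x))^2 \<partial>M) * (\<integral>\<^sup>+x. ennreal ((?d k x)\<^sup>2) \<partial>M) < ennreal (e\<^sup>2)) sequentially"
      using e unfolding mult_zero_right ennreal_tendsto_0_iff by simp
    then show "eventually (\<lambda>k. ?I k < ennreal e) sequentially"
    proof eventually_elim
      case (elim k)
      have "(?I k)\<^sup>2
          \<le> (\<integral>\<^sup>+x. ennreal (norm (G x))^2 \<partial>M) * (\<integral>\<^sup>+x. ennreal (?d k x)^2 \<partial>M)"
        by (rule Cauchy_Schwarz_nn_integral) auto
      also have "\<dots> < ennreal e ^ 2" using elim e by (simp add: ennreal_power)
      finally show ?case by (meson linorder_not_less power_mono zero_le)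
    qed
  qed
  have le: "(\<integral>\<^sup>+x. ennreal (norm (?X k x - ?Y x)) \<partial>M) \<le> 2 * ?I k" for k
  proof -
    have "(\<integral>\<^sup>+x. ennreal (norm (?X k x - ?Y x)) \<partial>M) \<le> (\<integral>\<^sup>+x. 2 * (ennreal (norm (G x)) * ennreal (?d k x)) \<partial>M)"
    proof (rule nn_integral_mono)
      fix x
      let ?E = "jacobian (v k) (at x) - F x"
      have "?X k x - ?Y x = G x $ i $ a * ?E $ j $ b - G x $ i $ b * ?E $ j $ a"
        unfolding jacobian_v by (simp add: algebra_simps)
      also have "\<bar>\<dots>\<bar> \<le> \<bar>G x $ i $ a\<bar> * \<bar>?E $ j $ b\<bar> + \<bar>G x $ i $ b\<bar> * \<bar>?E $ j $ a\<bar>"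
        unfolding abs_mult[symmetric] by (rule abs_triangle_ineq4)
      also have "\<dots> \<le> norm (G x) * norm ?E + norm (G x) * norm ?E"
        by (intro add_mono mult_mono entry_le_norm) auto
      finally have "norm (?X k x - ?Y x) \<le> 2 * (norm (G x) * norm ?E)" by simp
      then have "ennreal (norm (?X k x - ?Y x)) \<le> ennreal (2 * (norm (G x) * norm ?E))" by (rule ennreal_leI)
      also have "\<dots> = 2 * (ennreal (norm (G x)) * ennreal (norm ?E))"
        by (simp add: ennreal_mult)
      finally show "ennreal (norm (?X k x - ?Y x)) \<le> 2 * (ennreal (norm (G x)) * ennreal (?d k x))" .
    qed
    also have "\<dots> = 2 * ?I k"
      by (rule nn_integral_cmult) measurable
    finally show ?thesis .
  qed
  have "(\<lambda>k. 2 * ?I k) \<longlonglongrightarrow> 2 * 0"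
    by (intro ennreal_tendsto_cmult CS) simp
  then have "(\<lambda>k. 2 * ?I k) \<longlonglongrightarrow> 0" by simp
  then have lim: "(\<lambda>k. \<integral>\<^sup>+x. ennreal (norm (?X k x - ?Y x)) \<partial>M) \<longlonglongrightarrow> 0"
    using le tendsto_sandwich[OF _ _ tendsto_const] by (metis (no_types, lifting) always_eventually zero_le)
  have iX: "integrable M (?X k)" for k
    using integrable_F by (intro Bochner_Integration.integrable_diff
        integrable_mult_bounded_continuous[OF _ _ open_bounded] continuous_on_component continuous_w) simp_all
  have iY: "integrable M ?Y" by (intro Bochner_Integration.integrable_diff FF)
  from tendsto_L1_int[OF iX iY lim] have "(\<lambda>k. integral\<^sup>L M (?X k)) \<longlonglongrightarrow> integral\<^sup>L M ?Y" .
  then have Y0: "integral\<^sup>L M ?Y = 0" unfolding integral_minor_approx by (simp add: LIMSEQ_const_iff)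
  \<comment> \<open>Splitting the first factor as G + \<lambda>\<cdot>1 leaves, besides the mixed
    minor \<open>?Y\<close>, an expression linear in \<open>F\<close>, for which
    \<open>integral_F\<close> applies.\<close>
  have "(\<lambda>x. F x $ i $ a * F x $ j $ b - F x $ i $ b * F x $ j $ a)
      = (\<lambda>x. ?Y x + (?A $ i $ a * F x $ j $ b - ?A $ i $ b * F x $ j $ a))"
    by (simp add: algebra_simps)
  then have "integral\<^sup>L M (\<lambda>x. F x $ i $ a * F x $ j $ b - F x $ i $ b * F x $ j $ a)
      = integral\<^sup>L M ?Y + integral\<^sup>L M (\<lambda>x. ?A $ i $ a * F x $ j $ b - ?A $ i $ b * F x $ j $ a)"
    using integrable_F by (simp only:) (intro Bochner_Integration.integral_add iY, simp)
  also have "\<dots> = ?A $ i $ a * integral\<^sup>L M (\<lambda>x. F x $ j $ b) - ?A $ i $ b * integral\<^sup>L M (\<lambda>x. F x $ j $ a)"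
    using integrable_F by (simp only: Y0) simp
  finally show ?thesis unfolding integral_F by (simp add: algebra_simps)
qed

lemma integrable_cof: "integrable M (\<lambda>x. cof (F x) $ i $ j)"
proof -
  have "\<forall>i j. integrable M (\<lambda>x. cof (F x) $ i $ j)"
    unfolding forall_3 cof_3 by (intro conjI Bochner_Integration.integrable_diff integrable_F_mult_F)
  then show ?thesis by blast
qed

lemma integral_cof: "integral\<^sup>L M (\<lambda>x. cof (F x) $ i $ j) = measure M \<Omega> * (lam\<^sup>2 *\<^sub>R mat 1 :: real^3^3) $ i $ j"
proof -
  have "\<forall>i j. integral\<^sup>L M (\<lambda>x. cof (F x) $ i $ j) = measure M \<Omega> * (lam\<^sup>2 *\<^sub>R mat 1 :: real^3^3) $ i $ j"
    unfolding forall_3 cof_3 integral_minor by (simp add: mat_def power2_eq_square)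
  then show ?thesis by blast
qed

lemma integral_affine_null_lagrangian:
  fixes A B :: "real^3^3"
  shows "integrable M (\<lambda>x. A \<bullet> (F x - lam *\<^sub>R mat 1) + B \<bullet> (cof (F x) - lam\<^sup>2 *\<^sub>R mat 1))"
    and "integral\<^sup>L M (\<lambda>x. A \<bullet> (F x - lam *\<^sub>R mat 1) + B \<bullet> (cof (F x) - lam\<^sup>2 *\<^sub>R mat 1)) = 0"
proof -
  let ?N = "\<lambda>x. A \<bullet> (F x - lam *\<^sub>R mat 1) + B \<bullet> (cof (F x) - lam\<^sup>2 *\<^sub>R mat 1)"
  have i: "integrable M (\<lambda>x. A \<bullet> (F x - lam *\<^sub>R mat 1))" "integrable M (\<lambda>x. B \<bullet> (cof (F x) - lam\<^sup>2 *\<^sub>R mat 1))"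
    unfolding inner_vec_def using integrable_F integrable_cof by simp_all
  then show "integrable M ?N" by simp
  have "integral\<^sup>L M (\<lambda>x. F x $ i $ j - (lam *\<^sub>R mat 1 :: real^3^3) $ i $ j) = 0" for i j
    using integrable_F by (simp add: integral_F)
  moreover have "integral\<^sup>L M (\<lambda>x. cof (F x) $ i $ j - (lam\<^sup>2 *\<^sub>R mat 1 :: real^3^3) $ i $ j) = 0" for i j
    using integrable_cof by (simp add: integral_cof)
  ultimately have "integral\<^sup>L M (\<lambda>x. A \<bullet> (F x - lam *\<^sub>R mat 1)) = 0" "integral\<^sup>L M (\<lambda>x. B \<bullet> (cof (F x) - lam\<^sup>2 *\<^sub>R mat 1)) = 0"
    unfolding inner_vec_def using integrable_F integrable_cof
    by (simp_all add: Bochner_Integration.integral_sum del: vector_scaleR_component Bochner_Integration.integral_diff)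
  then show "integral\<^sup>L M ?N = 0"
    using i by simp
qed

end

subsection \<open>Weak gradients and the stability estimate\<close>

lemma Lq_on_continuous:
  fixes f :: "real^3 \<Rightarrow> 'b::euclidean_space"
  assumes f: "continuous_on UNIV f" and \<Omega>: "open \<Omega>" "bounded \<Omega>" and q: "q > 0"
  shows "Lq_on q \<Omega> f"
proof -
  interpret finite_measure "lebesgue_on \<Omega>" by (rule finite_measure_lebesgue_on_bounded_open[OF \<Omega>])
  have \<Omega>m: "\<Omega> \<in> sets lebesgue" using \<Omega> by auto
  have m [measurable]: "f \<in> borel_measurable (lebesgue_on \<Omega>)"
    by (rule continuous_on_UNIV_lebesgue_on(1)[OF f \<Omega>])
  obtain B where B: "B \<ge> 0" "\<And>x. x \<in> \<Omega> \<Longrightarrow> norm (f x) \<le> B"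
    using continuous_on_UNIV_lebesgue_on(2)[OF f \<Omega>] by blast
  have "integrable (lebesgue_on \<Omega>) (\<lambda>x. norm (f x) powr q)"
    using B q by (intro integrable_const_bound[of _ "B powr q"] AE_I2) (auto intro: powr_mono2)
  then show ?thesis
    using m \<Omega>m
    by (simp add: Lq_on_def set_borel_measurable_def set_integrable_def
        borel_measurable_restrict_space_iff integrable_restrict_space)
qed

text \<open>The energy of the comparison map is also defined through \<open>weak_grad\<close>, so
  its weak gradient must be exhibited; the product of \<lambda>x_i with a test function has compact
  support and its derivatives integrate to zero.\<close>

lemma has_weak_gradient_u_lin:
  assumes \<Omega>: "open \<Omega>" "bounded \<Omega>" and q: "q > 0"
  shows "has_weak_gradient q \<Omega> (u_lin lam) (\<lambda>_. lam *\<^sub>R mat 1)"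
  unfolding has_weak_gradient_def
proof (intro conjI ballI allI)
  show "Lq_on q \<Omega> (u_lin lam)" "Lq_on q \<Omega> (\<lambda>_. lam *\<^sub>R mat 1 :: real^3^3)"
    unfolding u_lin_def[abs_def] by (intro Lq_on_continuous[OF _ \<Omega> q] continuous_intros)+
  fix \<phi> :: "real^3 \<Rightarrow> real" and i j :: 3
  assume \<phi>: "\<phi> \<in> test_functions \<Omega>"
  define K where "K = closure {x. \<phi> x \<noteq> 0}"
  have K: "compact K" "K \<subseteq> \<Omega>" and sm: "smooth \<phi>" using \<phi> by (auto simp: test_functions_def K_def)
  obtain \<psi> where \<psi>: "\<And>x. (\<phi> has_derivative (\<lambda>h. \<psi> x \<bullet> h)) (at x)" "\<And>b. b \<in> Basis \<Longrightarrow> smooth (\<lambda>x. \<psi> x \<bullet> b)"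
    by (rule smooth_gradientE[OF sm]) (rule that)
  have cont: "continuous_on UNIV \<phi>" "continuous_on UNIV \<psi>"
    using smooth_continuous[OF sm] continuous_gradient[OF \<psi>(2)] by auto
  have \<phi>0: "\<phi> x = 0" if "x \<notin> K" for x
    using that closure_subset[of "{x. \<phi> x \<noteq> 0}"] by (auto simp: K_def)
  have \<psi>0: "\<psi> x = 0" if "x \<notin> K" for x
  proof -
    have "x \<in> - K" "open (- K)" using that K(1) by (auto simp: compact_imp_closed open_Compl)
    then have "(\<phi> has_derivative (\<lambda>_. 0)) (at x)"
      using \<phi>0 by (intro has_derivative_transform_within_open[of "\<lambda>_. 0" _ x UNIV "- K" \<phi>]) auto
    then have "(\<lambda>h. \<psi> x \<bullet> h) = (\<lambda>_. 0)" using \<psi>(1) has_derivative_unique by blast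
    then have "\<psi> x \<bullet> \<psi> x = 0" by metis
    then show ?thesis by simp
  qed
  define D where "D x h = lam * x $ i * (\<psi> x \<bullet> h) + lam * h $ i * \<phi> x" for x h
  have der: "((\<lambda>x. lam * x $ i * \<phi> x) has_derivative D x) (at x)" for x
  proof -
    have "((\<lambda>x. lam * x $ i) has_derivative (\<lambda>h. lam * h $ i)) (at x)"
      by (intro has_derivative_mult_right bounded_linear_imp_has_derivative bounded_linear_vec_nth)
    from has_derivative_mult[OF this \<psi>(1)] show ?thesis
      by (rule has_derivative_eq_rhs) (auto simp: D_def fun_eq_iff)
  qed
  have contD: "continuous_on UNIV (\<lambda>x. D x (axis j 1))"
    unfolding D_def by (intro continuous_intros cont)
  have "compact ((\<lambda>x. D x (axis j 1)) ` K)"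
    by (intro compact_continuous_image continuous_on_subset[OF contD] K) simp
  then obtain B where B: "\<And>x. x \<in> K \<Longrightarrow> norm (D x (axis j 1)) \<le> B"
    by (metis compact_imp_bounded bounded_iff imageI)
  have "\<bar>D x (axis j 1)\<bar> \<le> max B 0" for x
    using B[of x] \<phi>0[of x] \<psi>0[of x] by (cases "x \<in> K") (auto simp: D_def)
  then have zero0: "integral\<^sup>L lborel (\<lambda>x. D x (axis j 1)) = 0"
    by (rule integral_partial_derivative_eq_0[OF der _ compact_imp_bounded[OF K(1)]]) (simp add: \<phi>0)
  have eqD: "(\<lambda>x. D x (axis j 1)) = (\<lambda>x. indicator \<Omega> x *\<^sub>R D x (axis j 1))"
  proof (rule ext)
    fix x
    have "x \<in> \<Omega> \<or> x \<notin> K" using K(2) by blast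
    then show "D x (axis j 1) = indicator \<Omega> x *\<^sub>R D x (axis j 1)"
      using \<phi>0[of x] \<psi>0[of x] by (auto simp: D_def indicator_def)
  qed
  have "(LINT x:\<Omega>|lborel. D x (axis j 1)) = 0"
    unfolding set_lebesgue_integral_def eqD[symmetric] by (rule zero0)
  then have zero: "integral\<^sup>L (lebesgue_on \<Omega>) (\<lambda>x. D x (axis j 1)) = 0"
    by (simp add: integral_lborel_eq_lebesgue_on[OF borel_measurable_continuous_onI[OF contD] \<Omega>(1)])
  have int: "integrable (lebesgue_on \<Omega>) f" if "continuous_on UNIV f" for f :: "real^3 \<Rightarrow> real"
  proof -
    interpret finite_measure "lebesgue_on \<Omega>" by (rule finite_measure_lebesgue_on_bounded_open[OF \<Omega>])
    from integrable_mult_bounded_continuous[OF _ that \<Omega>, of "\<lambda>_. 1"] show ?thesis by simp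
  qed
  have eq: "(LINT x:\<Omega>|lebesgue. f x) = integral\<^sup>L (lebesgue_on \<Omega>) f" for f :: "real^3 \<Rightarrow> real"
    using \<Omega> by (simp add: set_lebesgue_integral_def integral_restrict_space)
  have fd: "frechet_derivative \<phi> (at x) = (\<lambda>h. \<psi> x \<bullet> h)" for x
    using frechet_derivative_at[OF \<psi>(1)] by simp
  have "integral\<^sup>L (lebesgue_on \<Omega>) (\<lambda>x. D x (axis j 1)) =
      integral\<^sup>L (lebesgue_on \<Omega>) (\<lambda>x. lam * x $ i * (\<psi> x \<bullet> axis j 1)) + integral\<^sup>L (lebesgue_on \<Omega>) (\<lambda>x. lam * axis j 1 $ i * \<phi> x)"
    unfolding D_def by (intro Bochner_Integration.integral_add int continuous_intros cont)
  moreover have "axis j 1 $ i = (mat 1 :: real^3^3) $ i $ j" by (simp add: axis_def mat_def)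
  ultimately show "(LINT x:\<Omega>|lebesgue. u_lin lam x $ i * frechet_derivative \<phi> (at x) (axis j 1)) =
        - (LINT x:\<Omega>|lebesgue. (lam *\<^sub>R mat 1 :: real^3^3) $ i $ j * \<phi> x)"
    using zero by (simp add: eq fd u_lin_def)
qed

text \<open>\<open>weak_grad\<close> is an arbitrary choice; agreement almost everywhere is what
  allows the energy of \<open>u_lin\<close> to be evaluated with the constant matrix.\<close>

lemma weak_gradient_unique:
  assumes G: "has_weak_gradient q \<Omega> u G" "has_weak_gradient q \<Omega> u G'"
    and \<Omega>: "open \<Omega>" "bounded \<Omega>" and q: "2 < q"
  shows "AE x in lebesgue. x \<in> \<Omega> \<longrightarrow> G x = G' x"
proof -
  have int: "integrable (lebesgue_on \<Omega>) (\<lambda>x. A x $ i $ j)" if "has_weak_gradient q \<Omega> u A" for A i j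
  proof (rule integrable_bounded_linear[OF bounded_linear_entry])
    show "integrable (lebesgue_on \<Omega>) A"
      using that by (intro Lq_on_integrable[OF _ \<Omega> q]) (simp add: has_weak_gradient_def)
  qed
  have \<Omega>m: "\<Omega> \<in> sets lebesgue" using \<Omega> by auto
  have "AE x in lebesgue. x \<in> \<Omega> \<longrightarrow> G x $ i $ j - G' x $ i $ j = 0" for i j
  proof (rule fundamental_lemma_calculus_of_variations[OF \<Omega>(1)])
    show "set_integrable lebesgue \<Omega> (\<lambda>x. G x $ i $ j - G' x $ i $ j)"
      using int[OF G(1), of i j] int[OF G(2), of i j] \<Omega>m
      unfolding set_integrable_def by (subst integrable_restrict_space[symmetric]) auto
    fix \<phi> :: "real^3 \<Rightarrow> real" assume \<phi>: "\<phi> \<in> test_functions \<Omega>"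
    then have cont: "continuous_on UNIV \<phi>" by (intro smooth_continuous) (simp add: test_functions_def)
    have eq: "(LINT x:\<Omega>|lebesgue. f x) = integral\<^sup>L (lebesgue_on \<Omega>) f" for f :: "real^3 \<Rightarrow> real"
      using \<Omega>m by (simp add: set_lebesgue_integral_def integral_restrict_space)
    have "(LINT x:\<Omega>|lebesgue. G x $ i $ j * \<phi> x) = (LINT x:\<Omega>|lebesgue. G' x $ i $ j * \<phi> x)"
    proof -
      have "(LINT x:\<Omega>|lebesgue. A x $ i $ j * \<phi> x) = - (LINT x:\<Omega>|lebesgue. u x $ i * frechet_derivative \<phi> (at x) (axis j 1))"
        if "has_weak_gradient q \<Omega> u A" for A
        using that \<phi> by (simp add: has_weak_gradient_def)
      from this[OF G(1)] this[OF G(2)] show ?thesis by simp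
    qed
    moreover have "integral\<^sup>L (lebesgue_on \<Omega>) (\<lambda>x. G x $ i $ j * \<phi> x - G' x $ i $ j * \<phi> x) =
       integral\<^sup>L (lebesgue_on \<Omega>) (\<lambda>x. G x $ i $ j * \<phi> x) - integral\<^sup>L (lebesgue_on \<Omega>) (\<lambda>x. G' x $ i $ j * \<phi> x)"
      by (intro Bochner_Integration.integral_diff integrable_mult_bounded_continuous[OF _ cont \<Omega>] int G)
    ultimately show "(LINT x:\<Omega>|lebesgue. (G x $ i $ j - G' x $ i $ j) * \<phi> x) = 0"
      by (simp add: eq left_diff_distrib)
  qed
  then have "AE x in lebesgue. \<forall>i\<in>UNIV. \<forall>j\<in>UNIV. x \<in> \<Omega> \<longrightarrow> G x $ i $ j - G' x $ i $ j = 0"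
    by (intro AE_finite_allI finite)
  then show ?thesis by eventually_elim (simp add: vec_eq_iff)
qed

text \<open>\<open>ennreal\<close> discards the negative part of \<open>f\<close>, hence only an
  inequality; it is the direction required for a lower energy bound that may be negative at some
  points.\<close>

lemma ennreal_integral_le_nn_integral:
  fixes f :: "'a \<Rightarrow> real"
  assumes "integrable M f"
  shows "ennreal (integral\<^sup>L M f) \<le> (\<integral>\<^sup>+x. ennreal (f x) \<partial>M)"
proof -
  have i: "integrable M (\<lambda>x. max 0 (f x))" using assms by simp
  have "ennreal (integral\<^sup>L M f) \<le> ennreal (integral\<^sup>L M (\<lambda>x. max 0 (f x)))"
    by (intro ennreal_leI integral_mono assms i) simp
  also have "\<dots> = (\<integral>\<^sup>+x. ennreal (max 0 (f x)) \<partial>M)"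
    by (intro nn_integral_eq_integral[symmetric] i) simp
  finally show ?thesis by (simp add: ennreal_max_0)
qed

lemma admissible_trace_approximation:
  assumes "u \<in> admissible q \<Omega> lam" "lipschitz_domain \<Omega>" "2 < q"
  shows "\<exists>v w. affine_trace_approximation \<Omega> q lam u (weak_grad q \<Omega> u) v w"
proof -
  have "has_weak_gradient q \<Omega> u (weak_grad q \<Omega> u)"
    using assms(1) someI_ex[of "has_weak_gradient q \<Omega> u"]
    unfolding admissible_def sobolev_W1_def weak_grad_def by blast
  then have Lq: "Lq_on q \<Omega> u" "Lq_on q \<Omega> (weak_grad q \<Omega> u)" by (auto simp: has_weak_gradient_def)
  have "has_trace q \<Omega> u (u_lin lam)" using assms(1) by (simp add: admissible_def)
  then obtain v where v0: "(\<forall>k i. smooth (\<lambda>x. v k x $ i)) \<and>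
    (\<lambda>k. \<integral>\<^sup>+x\<in>\<Omega>. ennreal (norm (v k x - u x) powr q) \<partial>lebesgue) \<longlonglongrightarrow> 0 \<and>
    (\<lambda>k. \<integral>\<^sup>+x\<in>\<Omega>. ennreal (norm (jacobian (v k) (at x) - weak_grad q \<Omega> u x) powr q) \<partial>lebesgue) \<longlonglongrightarrow> 0 \<and>
    (\<lambda>k. \<integral>\<^sup>+x\<in>frontier \<Omega>. ennreal (norm (v k x - u_lin lam x) powr q) \<partial>hausdorff2) \<longlonglongrightarrow> 0"
    unfolding has_trace_def by (elim exE) (rule that)
  note v = v0[THEN conjunct1, rule_format] v0[THEN conjunct2, THEN conjunct1]
    v0[THEN conjunct2, THEN conjunct2, THEN conjunct1] v0[THEN conjunct2, THEN conjunct2, THEN conjunct2]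
  have "\<exists>g. (\<forall>x. ((\<lambda>x. v k x $ i) has_derivative (\<lambda>h. g x \<bullet> h)) (at x)) \<and> (\<forall>j. smooth (\<lambda>x. g x $ j))" for k i
  proof -
    obtain g where g: "\<And>x. ((\<lambda>x. v k x $ i) has_derivative (\<lambda>h. g x \<bullet> h)) (at x)" "\<And>b. b \<in> Basis \<Longrightarrow> smooth (\<lambda>x. g x \<bullet> b)"
      by (rule smooth_gradientE[OF v(1)]) (rule that)
    have "smooth (\<lambda>x. g x $ j)" for j using g(2)[of "axis j 1"] by (simp add: inner_axis axis_in_Basis_iff)
    then show ?thesis using g(1) by blast
  qed
  then obtain w where w: "\<And>k i x. ((\<lambda>x. v k x $ i) has_derivative (\<lambda>h. w k i x \<bullet> h)) (at x)" "\<And>k i j. smooth (\<lambda>x. w k i x $ j)"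
    by metis
  show ?thesis
    using affine_trace_approximation.intro[OF assms(2,3) Lq v(1) w v(2-4)] by blast
qed

theorem theorem3p5:
  fixes \<Omega> :: "(real^3) set"
    and q \<gamma> \<kappa> lam :: real
    and Z :: "real^3^3 \<Rightarrow> real"
    and h :: "real \<Rightarrow> ennreal"
  assumes "lipschitz_domain \<Omega>"
    and "2 < q" and "q < 3" and "\<gamma> > 0"
    and "\<And>A. Z A \<ge> 0" and "convex_on UNIV Z" and "Ck_on 1 Z UNIV"
    and "\<And>t. t > 0 \<Longrightarrow> h t < \<infinity>"
    and "convex_on {0<..} (\<lambda>t. enn2real (h t))" and "Ck_on 1 (\<lambda>t. enn2real (h t)) {0<..}"
    and "(h \<longlongrightarrow> \<infinity>) (at_right 0)"
    and "Liminf at_top (\<lambda>t. h t / ennreal t) > 0"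
    and "\<And>t. t \<le> 0 \<Longrightarrow> h t = \<infinity>"
    and "2 powr (2 - q) \<le> \<kappa>" and "\<kappa> \<le> q * 2 powr (1 - q)"
    and "\<And>A F :: real^3^3. norm F powr q \<ge>
           norm A powr q + q * norm A powr (q - 2) * (A \<bullet> (F - A)) + \<kappa> * norm (F - A) powr q"
    and "lam > 0" and "deriv (\<lambda>t. enn2real (h t)) (lam ^ 3) > 0"
    and "\<kappa> / (deriv (\<lambda>t. enn2real (h t)) (lam ^ 3) * lam powr (3 - q)) > (q - 2) powr ((q - 2) / 2) * q powr (- q / 2)"
    and "\<gamma> / (lam * deriv (\<lambda>t. enn2real (h t)) (lam ^ 3)) \<ge> 1 / 2"
  shows "\<exists>c>0. \<forall>u\<in>admissible q \<Omega> lam.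
           enn2ereal (\<integral>\<^sup>+x\<in>\<Omega>. ennreal (norm (weak_grad q \<Omega> u x - lam *\<^sub>R mat 1) powr q) \<partial>lebesgue)
             \<le> ereal c * energy_gap q \<gamma> Z h \<Omega> lam u"
proof -
  let ?A = "lam *\<^sub>R mat 1 :: real^3^3"
  let ?M = "lebesgue_on \<Omega>"
  have \<Omega>: "open \<Omega>" "bounded \<Omega>" using assms(1) by (auto simp: lipschitz_domain_def)
  have \<Omega>m: "\<Omega> \<in> sets lebesgue" using \<Omega> by auto
  interpret M: finite_measure ?M by (rule finite_measure_lebesgue_on_bounded_open[OF \<Omega>])
  have \<kappa>: "\<kappa> > 0" using assms(14) powr_gt_zero[of 2 "2 - q"] by linarith
  obtain W0 L N where W: "W0 \<ge> 0" "stored_energy q \<gamma> Z h ?A = ennreal W0"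
    "\<And>F :: real^3^3. det F > 0 \<Longrightarrow>
      ennreal (W0 + L \<bullet> (F - ?A) + N \<bullet> (cof F - lam\<^sup>2 *\<^sub>R mat 1) + \<kappa> * norm (F - ?A) powr q)
        \<le> stored_energy q \<gamma> Z h F"
    by (rule energy_density_lower_bound[OF assms(6,7,5,4,8,9,10,16,17,18,20)]) (assumption | rule that)+
  define m where "m = measure ?M \<Omega>"
  have m: "m \<ge> 0" "emeasure ?M \<Omega> = ennreal m"
    by (auto simp: m_def M.emeasure_eq_measure)
  have energy_eq: "energy q \<gamma> Z h \<Omega> u = (\<integral>\<^sup>+x. stored_energy q \<gamma> Z h (weak_grad q \<Omega> u x) \<partial>?M)" for u
    unfolding energy_def using \<Omega>m by (simp add: nn_integral_restrict_space)
  have AE_eq: "(AE x in ?M. P x) \<longleftrightarrow> (AE x in lebesgue. x \<in> \<Omega> \<longrightarrow> P x)" for P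
    using \<Omega>m by (simp add: AE_restrict_space_iff)
  have E0: "energy q \<gamma> Z h \<Omega> (u_lin lam) = ennreal (W0 * m)"
  proof -
    have q0: "q > 0" using assms(2) by simp
    note lin = has_weak_gradient_u_lin[OF \<Omega> q0, of lam]
    then have "has_weak_gradient q \<Omega> (u_lin lam) (weak_grad q \<Omega> (u_lin lam))"
      unfolding weak_grad_def by (rule someI[of "has_weak_gradient q \<Omega> (u_lin lam)"])
    from weak_gradient_unique[OF this lin \<Omega> assms(2)]
    have "AE x in ?M. weak_grad q \<Omega> (u_lin lam) x = ?A" by (simp add: AE_eq)
    then have "AE x in ?M. stored_energy q \<gamma> Z h (weak_grad q \<Omega> (u_lin lam) x) = ennreal W0"
      by eventually_elim (simp add: W)
    then have "energy q \<gamma> Z h \<Omega> (u_lin lam) = (\<integral>\<^sup>+x. ennreal W0 \<partial>?M)"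
      unfolding energy_eq by (rule nn_integral_cong_AE)
    also have "\<dots> = ennreal (W0 * m)" using W(1) m by (simp add: ennreal_mult)
    finally show ?thesis .
  qed
  show ?thesis
  proof (intro exI[of _ "1 / \<kappa>"] conjI ballI)
    show "1 / \<kappa> > 0" using \<kappa> by simp
    fix u assume adm: "u \<in> admissible q \<Omega> lam"
    obtain v w where "affine_trace_approximation \<Omega> q lam u (weak_grad q \<Omega> u) v w"
      using admissible_trace_approximation[OF adm assms(1,2)] by blast
    then interpret affine_trace_approximation \<Omega> q lam u "weak_grad q \<Omega> u" v w .
    define F where "F = weak_grad q \<Omega> u"
    \<comment> \<open>The \<kappa>-inequality at the constant matrix also provides integrability:
      \<kappa>|F - \<lambda>1|^q is at most \<open>?Q\<close>, a combination of |F|^q, a constant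
      and a linear term.\<close>
    let ?Q = "\<lambda>x. norm (F x) powr q - norm ?A powr q - q * norm ?A powr (q - 2) * (?A \<bullet> (F x - ?A))"
    have iG: "integrable ?M (\<lambda>x. norm (F x - ?A) powr q)"
    proof (rule Bochner_Integration.integrable_bound)
      have "integrable ?M (\<lambda>x. ?A \<bullet> (F x - ?A))"
        using integral_affine_null_lagrangian(1)[of ?A 0] by (simp add: F_def)
      then show "integrable ?M (\<lambda>x. (1 / \<kappa>) * ?Q x)"
        using Lq_on_integrable_powr[OF F open_bounded q] unfolding F_def by simp
      show "(\<lambda>x. norm (F x - ?A) powr q) \<in> borel_measurable ?M"
        unfolding F_def by measurable
      show "AE x in ?M. norm (norm (F x - ?A) powr q) \<le>
          norm ((1 / \<kappa>) * ?Q x)"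
      proof (intro AE_I2)
        fix x
        have "\<kappa> * norm (F x - ?A) powr q \<le> ?Q x"
          using assms(16)[of ?A "F x"] by simp
        then have "norm (F x - ?A) powr q \<le> (1 / \<kappa>) * ?Q x"
          using \<kappa> by (simp add: field_simps)
        then show "norm (norm (F x - ?A) powr q) \<le>
          norm ((1 / \<kappa>) * ?Q x)"
          by (simp del: times_divide_eq_left)
      qed
    qed
    define J where "J = integral\<^sup>L ?M (\<lambda>x. norm (F x - ?A) powr q)"
    have J: "J \<ge> 0" by (simp add: J_def)
    have lhs: "(\<integral>\<^sup>+x\<in>\<Omega>. ennreal (norm (F x - ?A) powr q) \<partial>lebesgue) = ennreal J"
    proof -
      have "(\<integral>\<^sup>+x\<in>\<Omega>. ennreal (norm (F x - ?A) powr q) \<partial>lebesgue) = (\<integral>\<^sup>+x. ennreal (norm (F x - ?A) powr q) \<partial>?M)"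
        using \<Omega>m by (simp add: nn_integral_restrict_space)
      also have "\<dots> = ennreal J" unfolding J_def by (intro nn_integral_eq_integral iG) simp
      finally show ?thesis .
    qed
    \<comment> \<open>The pointwise lower bound as a real function; its integral is
      \<open>W0 * m + \<kappa> * J\<close>, since the bracketed terms integrate to zero.\<close>
    define R where "R x = W0 + (L \<bullet> (F x - ?A) + N \<bullet> (cof (F x) - lam\<^sup>2 *\<^sub>R mat 1)) + \<kappa> * norm (F x - ?A) powr q" for x
    note null = integral_affine_null_lagrangian[of L N, folded F_def]
    have iR: "integrable ?M R"
      unfolding R_def by (intro Bochner_Integration.integrable_add null(1) integrable_mult_right iG) simp
    have "integral\<^sup>L ?M R = W0 * m + \<kappa> * J"
      unfolding R_def J_def m_def using null iG by simp
    then have "ennreal (W0 * m + \<kappa> * J) \<le> (\<integral>\<^sup>+x. ennreal (R x) \<partial>?M)"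
      using ennreal_integral_le_nn_integral[OF iR] by simp
    also have "\<dots> \<le> energy q \<gamma> Z h \<Omega> u"
      unfolding energy_eq
    proof (rule nn_integral_mono_AE)
      have "AE x in ?M. det (F x) > 0" using adm by (simp add: AE_eq admissible_def F_def)
      then show "AE x in ?M. ennreal (R x) \<le> stored_energy q \<gamma> Z h (weak_grad q \<Omega> u x)"
        by eventually_elim (use W(3) in \<open>simp add: R_def F_def add.assoc\<close>)
    qed
    finally have main: "ennreal (W0 * m + \<kappa> * J) \<le> energy q \<gamma> Z h \<Omega> u" .
    show "enn2ereal (\<integral>\<^sup>+x\<in>\<Omega>. ennreal (norm (weak_grad q \<Omega> u x - ?A) powr q) \<partial>lebesgue)
             \<le> ereal (1 / \<kappa>) * energy_gap q \<gamma> Z h \<Omega> lam u"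
    \<comment> \<open>The comparison energy is finite, so an infinite energy of \<open>u\<close>
      makes the gap infinite; otherwise the claim is real arithmetic with the bound
      \<open>main\<close>.\<close>
    proof (cases "energy q \<gamma> Z h \<Omega> u" rule: ennreal_cases)
      case (real r)
      then have "W0 * m + \<kappa> * J \<le> r" using main by simp
      then have "J \<le> (1 / \<kappa>) * (r - W0 * m)" using \<kappa> by (simp add: field_simps)
      then show ?thesis
        unfolding energy_gap_def E0 real lhs[unfolded F_def] using J W(1) m real(1) by (simp add: enn2ereal_ennreal)
    next
      case top
      then show ?thesis
        unfolding energy_gap_def E0 using \<kappa> W(1) m by (simp add: enn2ereal_ennreal)
    qed
  qed
qed

end
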